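(* Let $R>0$, let $N\ge1$ be an integer, let $0<r\le R$, and let $f\colon\mathbb{R}^N\to\mathbb{R}^N$. If $f$ is of class $C^1$ and $\|Df(x)\|=O(|x|^\alpha)$ as $|x|\to\infty$ for some $\alpha\ge1$, then for all $\alpha+1\le p<\infty$, the induced map $$\tilde{\varPhi}_r\colon\mathbb{R}_+\times M^p([-R,0],\mathbb{R}^N)\to M^p([-R,0],\mathbb{R}^N),\qquad \tilde{\varPhi}_r(t,[\phi]):=\tilde{\varPhi}_r^t([\phi]):=[\varPhi_r(t,\phi)],$$ where $\varPhi_r(t,\phi):=R_tx(\cdot;\phi,r)$ and $x(\cdot;\phi,r)$ is the solution of $\dot x(t)=f(x(t-r))$ $(t\ge0)$, $x(t)=\phi(t)$ $(t\in[-R,0])$, is a semiflow of class $C^1$.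
   Context: $\mathbb{R}_+=[0,\infty)$, $|\cdot|$ is a fixed norm on $\mathbb{R}^N$, and $\|Df(x)\|$ is the corresponding operator norm of the real $N\times N$ matrix $Df(x)$. For $1\le p<\infty$, $\bar{\mathcal{L}}^p([-R,0],\mathbb{R}^N)$ is the linear space of Lebesgue measurable functions $\phi\colon[-R,0]\to\mathbb{R}^N$ (actual functions, not equivalence classes) with $\int_{-R}^0|\phi|^p<\infty$, endowed with the seminorm $\|\phi\|_{\bar{\mathcal{L}}^p[-R,0]}=\left(\int_{-R}^0|\phi(\theta)|^p\,d\theta+|\phi(0)|^p\right)^{1/p}$. $M^p([-R,0],\mathbb{R}^N)$ is the quotient normed space of $\bar{\mathcal{L}}^p([-R,0],\mathbb{R}^N)$ by the subspace of functions of zero seminorm; $[\phi]$ is the class of $\phi$ and $\|[\phi]\|=\|\phi\|_{\bar{\mathcal{L}}^p[-R,0]}$. Solution: $x(\cdot;\phi,r)\colon[-R,\infty)\to\mathbb{R}^N$ is the unique function which equals $\phi$ on $[-R,0]$, is continuous on $[0,\infty)$, and satisfies $x(t)=\phi(0)+\int_0^t f(x(s-r))\,ds$ for all $t\ge0$ (constructed by the method of steps; on $[0,r]$ it equals $\phi(0)+\int_0^t f(\phi(s-r))\,ds$). The history of $x$ at $t\ge0$ is $R_tx\colon[-R,0]\to\mathbb{R}^N$, $(R_tx)(\theta)=x(t+\theta)$. A semiflow in a set $X$ is a map $\varPhi\colon\mathbb{R}_+\times X\to X$ with $\varPhi(0,x)=x$ and $\varPhi(t+s,x)=\varPhi(s,\varPhi(t,x))$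 for all $t,s\in\mathbb{R}_+$, $x\in X$. When $X$ is a normed space, it is a semiflow of class $C^1$ if $\varPhi$ is (jointly) continuous on $\mathbb{R}_+\times X$ and for each $t\in\mathbb{R}_+$ the time-$t$ map $\varPhi^t=\varPhi(t,\cdot)\colon X\to X$ is continuously Fréchet differentiable. $\|Df(x)\|=O(|x|^\alpha)$ as $|x|\to\infty$ means that there are $C,K>0$ with $\|Df(x)\|\le C|x|^\alpha$ whenever $|x|\ge K$. *)

theory Defs
  imports "HOL-Analysis.Analysis"
begin

section \<open>Seminormed spaces with explicit carriers\<close>

text \<open>
  The spaces \<open>M\<^sup>p([-R,0], \<real>\<^sup>N)\<close> depend on the real parameters \<open>p\<close> and \<open>R\<close>, so they cannot be
  instances of the class \<^class>\<open>real_normed_vector\<close>.  A (semi)normed space is therefore given by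
  a carrier set with its operations.  The record contains only the data; in a normed space the
  topology is that of the metric \<open>\<parallel>x - y\<parallel>\<close>.
\<close>

record 'v nspace =
  carr :: "'v set"
  vadd :: "'v \<Rightarrow> 'v \<Rightarrow> 'v"
  vscale :: "real \<Rightarrow> 'v \<Rightarrow> 'v"
  vnorm :: "'v \<Rightarrow> real"

definition vminus :: "'v nspace \<Rightarrow> 'v \<Rightarrow> 'v \<Rightarrow> 'v" where
  "vminus V x y = vadd V x (vscale V (-1) y)"

text \<open>The value 0 off the carrier is only there because the locale \<^locale>\<open>Metric_space\<close> demands
  nonnegativity and symmetry on the whole type.\<close>

definition vdist :: "'v nspace \<Rightarrow> 'v \<Rightarrow> 'v \<Rightarrow> real" where
  "vdist V x y = (if x \<in> carr V \<and> y \<in> carr V then vnorm V (vminus V x y) else 0)"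

definition vtop :: "'v nspace \<Rightarrow> 'v topology" where
  "vtop V = Metric_space.mtopology (carr V) (vdist V)"


subsection \<open>Quotient of a seminormed space by its null space\<close>

definition null_rel :: "'v nspace \<Rightarrow> ('v \<times> 'v) set" where
  "null_rel V = {(x, y). x \<in> carr V \<and> y \<in> carr V \<and> vnorm V (vminus V x y) = 0}"

definition vclass :: "'v nspace \<Rightarrow> 'v \<Rightarrow> 'v set" where
  "vclass V x = null_rel V `` {x}"

definition quot_space :: "'v nspace \<Rightarrow> 'v set nspace" where
  "quot_space V =
    \<lparr> carr = carr V // null_rel V,
      vadd = (\<lambda>A B. \<Union>x\<in>A. \<Union>y\<in>B. vclass V (vadd V x y)),
      vscale = (\<lambda>c A. \<Union>x\<in>A. vclass V (vscale V c x)),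
      vnorm = (\<lambda>A. the_elem (vnorm V ` A)) \<rparr>"


subsection \<open>Bounded linear operators and continuous Frechet differentiability\<close>

definition blin_space :: "'v nspace \<Rightarrow> 'w nspace \<Rightarrow> ('v \<Rightarrow> 'w) nspace" where
  "blin_space V W =
    \<lparr> carr = {T \<in> carr V \<rightarrow>\<^sub>E carr W.
                (\<forall>x\<in>carr V. \<forall>y\<in>carr V. T (vadd V x y) = vadd W (T x) (T y)) \<and>
                (\<forall>c. \<forall>x\<in>carr V. T (vscale V c x) = vscale W c (T x)) \<and>
                (\<exists>K. \<forall>x\<in>carr V. vnorm W (T x) \<le> K * vnorm V x)},
      vadd = (\<lambda>S T. \<lambda>x\<in>carr V. vadd W (S x) (T x)),
      vscale = (\<lambda>c T. \<lambda>x\<in>carr V. vscale W c (T x)),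
      vnorm = (\<lambda>T. SUP x\<in>{x \<in> carr V. vnorm V x \<le> 1}. vnorm W (T x)) \<rparr>"

definition frechet_at ::
    "'v nspace \<Rightarrow> 'w nspace \<Rightarrow> ('v \<Rightarrow> 'w) \<Rightarrow> 'v \<Rightarrow> ('v \<Rightarrow> 'w) \<Rightarrow> bool" where
  "frechet_at V W F x T \<longleftrightarrow>
     T \<in> carr (blin_space V W) \<and>
     (\<forall>e>0. \<exists>d>0. \<forall>h\<in>carr V. vnorm V h < d \<longrightarrow>
        vnorm W (vminus W (vminus W (F (vadd V x h)) (F x)) (T h)) \<le> e * vnorm V h)"

definition C1_map :: "'v nspace \<Rightarrow> 'w nspace \<Rightarrow> ('v \<Rightarrow> 'w) \<Rightarrow> bool" where
  "C1_map V W F \<longleftrightarrow>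
     F \<in> carr V \<rightarrow> carr W \<and>
     (\<exists>DF. (\<forall>x\<in>carr V. frechet_at V W F x (DF x)) \<and>
           continuous_map (vtop V) (vtop (blin_space V W)) DF)"


section \<open>Semiflows\<close>

definition semiflow :: "'x set \<Rightarrow> (real \<Rightarrow> 'x \<Rightarrow> 'x) \<Rightarrow> bool" where
  "semiflow X \<Phi> \<longleftrightarrow>
     (\<forall>t\<ge>0. \<Phi> t \<in> X \<rightarrow> X) \<and>
     (\<forall>x\<in>X. \<Phi> 0 x = x) \<and>
     (\<forall>t\<ge>0. \<forall>s\<ge>0. \<forall>x\<in>X. \<Phi> (t + s) x = \<Phi> s (\<Phi> t x))"

definition C1_semiflow :: "'v nspace \<Rightarrow> (real \<Rightarrow> 'v \<Rightarrow> 'v) \<Rightarrow> bool" where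
  "C1_semiflow V \<Phi> \<longleftrightarrow>
     semiflow (carr V) \<Phi> \<and>
     continuous_map (prod_topology (top_of_set {0..}) (vtop V)) (vtop V) (\<lambda>(t, x). \<Phi> t x) \<and>
     (\<forall>t\<ge>0. C1_map V V (\<Phi> t))"


section \<open>Norms and maps on \<open>\<real>\<^sup>N\<close>\<close>

definition is_norm :: "('v::real_vector \<Rightarrow> real) \<Rightarrow> bool" where
  "is_norm \<nu> \<longleftrightarrow>
     (\<forall>x. 0 \<le> \<nu> x) \<and> (\<forall>x. \<nu> x = 0 \<longleftrightarrow> x = 0) \<and>
     (\<forall>c x. \<nu> (c *\<^sub>R x) = \<bar>c\<bar> * \<nu> x) \<and> (\<forall>x y. \<nu> (x + y) \<le> \<nu> x + \<nu> y)"

definition matrix_opnorm :: "(real^'n \<Rightarrow> real) \<Rightarrow> real^'n^'n \<Rightarrow> real" where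
  "matrix_opnorm \<nu> A = (SUP x\<in>{x. \<nu> x \<le> 1}. \<nu> (A *v x))"

definition C1_vec :: "(real^'n \<Rightarrow> real^'n) \<Rightarrow> bool" where
  "C1_vec f \<longleftrightarrow> (\<forall>x. f differentiable (at x)) \<and> continuous_on UNIV (\<lambda>x. jacobian f (at x))"


section \<open>The spaces of initial histories\<close>

text \<open>Functions on \<open>[-R,0]\<close> are represented by total functions that are
  \<^const>\<open>undefined\<close> outside \<open>[-R,0]\<close>.\<close>

definition Lbar :: "(real^'n \<Rightarrow> real) \<Rightarrow> real \<Rightarrow> real \<Rightarrow> (real \<Rightarrow> real^'n) nspace" where
  "Lbar \<nu> p R =
    \<lparr> carr = {\<phi> \<in> {-R..0} \<rightarrow>\<^sub>E UNIV.
                \<phi> \<in> borel_measurable (lebesgue_on {-R..0}) \<and>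
                integrable (lebesgue_on {-R..0}) (\<lambda>\<theta>. \<nu> (\<phi> \<theta>) powr p)},
      vadd = (\<lambda>\<phi> \<psi>. \<lambda>\<theta>\<in>{-R..0}. \<phi> \<theta> + \<psi> \<theta>),
      vscale = (\<lambda>c \<phi>. \<lambda>\<theta>\<in>{-R..0}. c *\<^sub>R \<phi> \<theta>),
      vnorm = (\<lambda>\<phi>. ((LINT \<theta>|lebesgue_on {-R..0}. \<nu> (\<phi> \<theta>) powr p) + \<nu> (\<phi> 0) powr p)
                      powr (1 / p)) \<rparr>"

definition Mspace :: "(real^'n \<Rightarrow> real) \<Rightarrow> real \<Rightarrow> real \<Rightarrow> (real \<Rightarrow> real^'n) set nspace" where
  "Mspace \<nu> p R = quot_space (Lbar \<nu> p R)"


section \<open>The delay differential equation \<open>x'(t) = f (x (t - r))\<close>\<close>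

definition is_solution ::
    "real \<Rightarrow> real \<Rightarrow> (real^'n \<Rightarrow> real^'n) \<Rightarrow> (real \<Rightarrow> real^'n) \<Rightarrow> (real \<Rightarrow> real^'n) \<Rightarrow> bool" where
  "is_solution R r f \<phi> x \<longleftrightarrow>
     x \<in> {-R..} \<rightarrow>\<^sub>E UNIV \<and>
     (\<forall>t\<in>{-R..0}. x t = \<phi> t) \<and>
     continuous_on {0..} x \<and>
     (\<forall>t\<ge>0. integrable (lebesgue_on {0..t}) (\<lambda>s. f (x (s - r))) \<and>
            x t = \<phi> 0 + (LINT s|lebesgue_on {0..t}. f (x (s - r))))"

definition solution ::
    "real \<Rightarrow> real \<Rightarrow> (real^'n \<Rightarrow> real^'n) \<Rightarrow> (real \<Rightarrow> real^'n) \<Rightarrow> real \<Rightarrow> real^'n" where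
  "solution R r f \<phi> = (THE x. is_solution R r f \<phi> x)"

definition history :: "real \<Rightarrow> real \<Rightarrow> (real \<Rightarrow> 'a) \<Rightarrow> real \<Rightarrow> 'a" where
  "history R t x = (\<lambda>\<theta>\<in>{-R..0}. x (t + \<theta>))"

definition dde_flow ::
    "real \<Rightarrow> real \<Rightarrow> (real^'n \<Rightarrow> real^'n) \<Rightarrow> real \<Rightarrow> (real \<Rightarrow> real^'n) \<Rightarrow> real \<Rightarrow> real^'n" where
  "dde_flow R r f t \<phi> = history R t (solution R r f \<phi>)"

text \<open>The map induced on classes.  It sends \<open>[\<phi>]\<close> to \<open>[dde_flow R r f t \<phi>]\<close> as soon as this class
  does not depend on the representative \<open>\<phi>\<close>.\<close>

definition induced_flow ::
    "(real^'n \<Rightarrow> real) \<Rightarrow> real \<Rightarrow> real \<Rightarrow> real \<Rightarrow> (real^'n \<Rightarrow> real^'n) \<Rightarrow>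
     real \<Rightarrow> (real \<Rightarrow> real^'n) set \<Rightarrow> (real \<Rightarrow> real^'n) set" where
  "induced_flow \<nu> p R r f t A = (\<Union>\<phi>\<in>A. vclass (Lbar \<nu> p R) (dde_flow R r f t \<phi>))"

end

theory Submission
  imports Defs
begin

text \<open>
  For \<open>0 \<le> t \<le> r\<close> the delayed argument runs through the initial interval, so the solution is
  explicit: the history at time \<open>t\<close> is the shifted initial history, continued by
  \<open>\<phi>(0) + \<integral> f(\<phi>(s - r)) ds\<close>.  Thus the time-\<open>t\<close> map is a bounded linear map of \<open>\<phi>\<close> plus a bounded
  linear map, defined on \<open>L\<^sup>1\<close>, of \<open>f \<circ> \<phi>\<close> (\<open>flow_eq\<close>).  Everything rests on the superposition
  operator \<open>\<phi> \<mapsto> f \<circ> \<phi>\<close> being continuously Frechet differentiable from \<open>L\<^sup>p\<close> to \<open>L\<^sup>1\<close>, with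
  derivative \<open>h \<mapsto> Df(\<phi>) h\<close>.

  That in turn follows from one pointwise inequality (\<open>jacobian_increment\<close>): because \<open>Df\<close> is
  continuous and grows at most like the power \<open>\<alpha> \<le> p - 1\<close>, the increment \<open>Df(a + k) - Df(a)\<close> is
  bounded by \<open>e + K |k|\<^sup>p\<^sup>-\<^sup>1\<close> plus, where \<open>|a| > M\<close>, a term \<open>C |a|\<^sup>p\<^sup>-\<^sup>1\<close> whose constant \<open>C\<close> depends
  neither on \<open>M\<close> nor on \<open>e\<close>.  By Hoelder's inequality its integral against a history \<open>h\<close> is a
  multiple of the norm of \<open>h\<close>, and the factor becomes small on choosing \<open>M\<close> large, then \<open>e\<close> small, then
  \<open>k\<close> small in norm (\<open>superposition_estimate\<close>).  This is continuity of the derivative; the mean value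
  inequality gives the same bound, with \<open>k = h\<close>, for the Taylor remainder, which is
  differentiability.

  Longer times are reached by doubling.  The solution property is invariant under translation and
  solutions are unique, so the time-\<open>t\<close> map is the square of the time-\<open>t/2\<close> map, and the chain rule
  carries the result from \<open>[0, 2\<^sup>n r]\<close> to \<open>[0, 2\<^sup>n\<^sup>+\<^sup>1 r]\<close> (\<open>flow_C1\<close>).  Joint continuity spreads in
  the same way from \<open>[0, r]\<close>, where it combines a Lipschitz bound that is uniform in time with the
  continuity of translation in \<open>L\<^sup>p\<close> (\<open>history_continuous\<close>); the latter uses the density of
  continuous functions.

  All estimates are proved for functions rather than classes, in a space with a mere seminorm.  A
  differentiable map of a seminormed space is locally Lipschitz, hence respects the relation of
  having distance 0, and its derivative descends to the quotient with it (\<open>C1_map_quot\<close>).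
\<close>

section \<open>Seminormed spaces and their quotients\<close>

text \<open>
  \<open>null\<close> is the zero vector, which the record does not store. Other elements of
  seminorm 0 may exist: in the space of histories these are the functions that vanish at 0 and
  almost everywhere.
\<close>

locale seminormed_space =
  fixes V :: "'v nspace" and null :: 'v
  assumes null_closed: "null \<in> carr V"
    and add_closed: "x \<in> carr V \<Longrightarrow> y \<in> carr V \<Longrightarrow> vadd V x y \<in> carr V"
    and scale_closed: "x \<in> carr V \<Longrightarrow> vscale V c x \<in> carr V"
    and add_commute: "x \<in> carr V \<Longrightarrow> y \<in> carr V \<Longrightarrow> vadd V x y = vadd V y x"
    and add_assoc: "x \<in> carr V \<Longrightarrow> y \<in> carr V \<Longrightarrow> w \<in> carr V \<Longrightarrow>
        vadd V (vadd V x y) w = vadd V x (vadd V y w)"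
    and add_null: "x \<in> carr V \<Longrightarrow> vadd V x null = x"
    and scale_add: "x \<in> carr V \<Longrightarrow> y \<in> carr V \<Longrightarrow>
        vscale V c (vadd V x y) = vadd V (vscale V c x) (vscale V c y)"
    and add_scale: "x \<in> carr V \<Longrightarrow> vscale V (a + b) x = vadd V (vscale V a x) (vscale V b x)"
    and scale_scale: "x \<in> carr V \<Longrightarrow> vscale V a (vscale V b x) = vscale V (a * b) x"
    and scale_one: "x \<in> carr V \<Longrightarrow> vscale V 1 x = x"
    and scale_zero: "x \<in> carr V \<Longrightarrow> vscale V 0 x = null"
    and norm_nonneg: "x \<in> carr V \<Longrightarrow> 0 \<le> vnorm V x"
    and norm_scale: "x \<in> carr V \<Longrightarrow> vnorm V (vscale V c x) = \<bar>c\<bar> * vnorm V x"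
    and norm_triangle: "x \<in> carr V \<Longrightarrow> y \<in> carr V \<Longrightarrow>
        vnorm V (vadd V x y) \<le> vnorm V x + vnorm V y"
begin

abbreviation (input) "gap x y \<equiv> vnorm V (vminus V x y)"

lemma add_left_commute:
  assumes "x \<in> carr V" "y \<in> carr V" "w \<in> carr V"
  shows "vadd V x (vadd V y w) = vadd V y (vadd V x w)"
  using assms by (metis add_assoc add_commute)

lemmas add_ac = add_assoc add_commute add_left_commute

lemma minus_closed: "x \<in> carr V \<Longrightarrow> y \<in> carr V \<Longrightarrow> vminus V x y \<in> carr V"
  by (simp add: vminus_def add_closed scale_closed)

lemmas closed = null_closed add_closed scale_closed minus_closed

lemma add_uminus: "x \<in> carr V \<Longrightarrow> vadd V x (vscale V (-1) x) = null"
  using add_scale[of x 1 "-1"] by (simp add: scale_one scale_zero)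

lemma minus_self: "x \<in> carr V \<Longrightarrow> vminus V x x = null"
  by (simp add: vminus_def add_uminus)

lemma null_add: "x \<in> carr V \<Longrightarrow> vadd V null x = x"
  using add_commute add_null null_closed by metis

lemma add_minus_cancel:
  assumes "x \<in> carr V" "y \<in> carr V"
  shows "vadd V x (vminus V y x) = y"
proof -
  have "vadd V x (vminus V y x) = vadd V y (vadd V x (vscale V (-1) x))"
    using assms by (simp add: vminus_def add_left_commute closed)
  then show ?thesis using assms by (simp add: add_uminus add_null)
qed

lemma add_minus_self:
  assumes "x \<in> carr V" "h \<in> carr V"
  shows "vminus V (vadd V x h) x = h"
proof -
  have "vminus V (vadd V x h) x = vadd V h (vadd V x (vscale V (-1) x))"
    using assms by (simp add: vminus_def add_ac closed)
  then show ?thesis using assms by (simp add: add_uminus add_null)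
qed

lemma add_minus_add:
  assumes "x \<in> carr V" "y \<in> carr V" "x' \<in> carr V" "y' \<in> carr V"
  shows "vminus V (vadd V x y) (vadd V x' y') = vadd V (vminus V x x') (vminus V y y')"
  using assms by (simp add: vminus_def scale_add add_ac closed)

lemma minus_trans:
  assumes "x \<in> carr V" "y \<in> carr V" "w \<in> carr V"
  shows "vadd V (vminus V x y) (vminus V y w) = vminus V x w"
proof -
  have "vadd V (vminus V x y) (vminus V y w)
        = vadd V (vadd V y (vscale V (-1) y)) (vadd V x (vscale V (-1) w))"
    using assms by (simp add: vminus_def add_ac closed)
  then show ?thesis using assms by (simp add: add_uminus null_add vminus_def closed)
qed

lemma scale_minus:
  assumes "x \<in> carr V" "y \<in> carr V"
  shows "vscale V c (vminus V x y) = vminus V (vscale V c x) (vscale V c y)"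
  using assms by (simp add: vminus_def scale_add scale_scale closed)

lemma norm_null: "vnorm V null = 0"
  using norm_scale[OF null_closed, of 0] scale_zero[OF null_closed] by simp

lemma norm_minus_self: "x \<in> carr V \<Longrightarrow> gap x x = 0"
  by (simp add: minus_self norm_null)

lemma norm_minus_commute:
  assumes "x \<in> carr V" "y \<in> carr V"
  shows "gap x y = gap y x"
proof -
  have "vscale V (-1) (vminus V x y) = vminus V y x"
    using assms by (simp add: vminus_def scale_add scale_scale scale_one add_commute closed)
  then show ?thesis using norm_scale[OF minus_closed[OF assms], of "-1"] by simp
qed

lemma norm_minus_triangle:
  assumes "x \<in> carr V" "y \<in> carr V" "w \<in> carr V"
  shows "gap x w \<le> gap x y + gap y w"
  using norm_triangle[of "vminus V x y" "vminus V y w"] assms by (simp add: minus_trans closed)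

lemma norm_le_norm_minus:
  assumes "x \<in> carr V" "y \<in> carr V"
  shows "vnorm V x \<le> gap x y + vnorm V y"
  using norm_triangle[of y "vminus V x y"] assms by (simp add: add_minus_cancel closed)

lemma norm_minus_zero_imp_eq_norm:
  assumes "x \<in> carr V" "y \<in> carr V" "gap x y = 0"
  shows "vnorm V x = vnorm V y"
  using norm_le_norm_minus[of x y] norm_le_norm_minus[of y x] norm_minus_commute[of x y] assms by simp


subsection \<open>The quotient by the null space\<close>

lemma equiv_null_rel: "equiv (carr V) (null_rel V)"
proof (rule equivI)
  show "null_rel V \<subseteq> carr V \<times> carr V" by (auto simp: null_rel_def)
  show "refl_on (carr V) (null_rel V)"
    by (auto simp: refl_on_def null_rel_def norm_minus_self)
  show "sym (null_rel V)"
    by (auto simp: sym_def null_rel_def norm_minus_commute)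
  show "trans (null_rel V)"
  proof (clarsimp simp: trans_def null_rel_def)
    fix x y w assume "x \<in> carr V" "y \<in> carr V" "w \<in> carr V"
      "gap x y = 0" "gap y w = 0"
    then show "gap x w = 0"
      using norm_minus_triangle[of x y w] norm_nonneg[OF minus_closed, of x w] by simp
  qed
qed

lemma vclass_eq_iff:
  assumes "x \<in> carr V" "y \<in> carr V"
  shows "vclass V x = vclass V y \<longleftrightarrow> gap x y = 0"
  using eq_equiv_class_iff[OF equiv_null_rel assms] assms by (simp add: vclass_def null_rel_def)

lemma in_vclass_iff: "y \<in> vclass V x \<longleftrightarrow> x \<in> carr V \<and> y \<in> carr V \<and> gap x y = 0"
  by (auto simp: vclass_def null_rel_def)

lemma self_in_vclass: "x \<in> carr V \<Longrightarrow> x \<in> vclass V x"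
  by (simp add: in_vclass_iff norm_minus_self)

lemma UN_vclass:
  assumes "x \<in> carr V" and "\<And>y. y \<in> vclass V x \<Longrightarrow> G y = G x"
  shows "(\<Union>y\<in>vclass V x. G y) = G x"
  using assms self_in_vclass[OF assms(1)] by blast

abbreviation (input) "Q \<equiv> quot_space V"

lemma carr_quot: "carr Q = vclass V ` carr V"
  by (auto simp: quot_space_def quotient_def vclass_def)

lemma vclass_closed: "x \<in> carr V \<Longrightarrow> vclass V x \<in> carr Q"
  by (simp add: carr_quot)

lemma vadd_quot:
  assumes "x \<in> carr V" "y \<in> carr V"
  shows "vadd Q (vclass V x) (vclass V y) = vclass V (vadd V x y)"
proof -
  have eq: "vclass V (vadd V a b) = vclass V (vadd V x y)" if "a \<in> vclass V x" "b \<in> vclass V y" for a b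
  proof -
    have ab: "a \<in> carr V" "b \<in> carr V" "gap a x = 0" "gap b y = 0"
      using that norm_minus_commute by (auto simp: in_vclass_iff)
    have "gap (vadd V a b) (vadd V x y) \<le> 0"
      using norm_triangle[of "vminus V a x" "vminus V b y"] ab assms
      by (simp add: add_minus_add closed)
    then show ?thesis using ab assms norm_nonneg[of "vminus V (vadd V a b) (vadd V x y)"]
      by (simp add: vclass_eq_iff closed)
  qed
  have "vadd Q (vclass V x) (vclass V y) = (\<Union>a\<in>vclass V x. \<Union>b\<in>vclass V y. vclass V (vadd V a b))"
    by (simp add: quot_space_def)
  also have "\<dots> = vclass V (vadd V x y)"
    using eq self_in_vclass[OF assms(1)] self_in_vclass[OF assms(2)] by blast
  finally show ?thesis .
qed

lemma vscale_quot:
  assumes "x \<in> carr V"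
  shows "vscale Q c (vclass V x) = vclass V (vscale V c x)"
proof -
  have "vclass V (vscale V c a) = vclass V (vscale V c x)" if "a \<in> vclass V x" for a
  proof -
    have "a \<in> carr V" "gap a x = 0"
      using that norm_minus_commute by (auto simp: in_vclass_iff)
    then show ?thesis using assms
      by (simp add: vclass_eq_iff closed flip: scale_minus) (simp add: norm_scale closed)
  qed
  then show ?thesis
    using UN_vclass[OF assms, of "\<lambda>a. vclass V (vscale V c a)"] by (simp add: quot_space_def)
qed

lemma vminus_quot:
  assumes "x \<in> carr V" "y \<in> carr V"
  shows "vminus Q (vclass V x) (vclass V y) = vclass V (vminus V x y)"
  using assms by (simp add: vminus_def vadd_quot vscale_quot closed)

lemma vnorm_quot:
  assumes "x \<in> carr V"
  shows "vnorm Q (vclass V x) = vnorm V x"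
proof -
  have "vnorm V ` vclass V x = {vnorm V x}"
  proof -
    have "vnorm V a = vnorm V x" if "a \<in> vclass V x" for a
      using that norm_minus_zero_imp_eq_norm by (metis in_vclass_iff)
    then show ?thesis using self_in_vclass[OF assms] by blast
  qed
  then show ?thesis by (simp add: quot_space_def)
qed

end

text \<open>
  Definiteness is what turns \<open>vdist\<close> into a metric; the quotient by the null space
  has it.
\<close>

locale normed_space = seminormed_space V null
  for V :: "'v nspace" and null :: 'v +
  assumes norm_eq_zero: "x \<in> carr V \<Longrightarrow> vnorm V x = 0 \<Longrightarrow> x = null"

lemma (in seminormed_space) quot_normed_space: "normed_space (quot_space V) (vclass V null)"
proof unfold_locales
  show "vadd Q A C = vadd Q C A" if "A \<in> carr Q" "C \<in> carr Q" for A C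
    using that by (auto simp: carr_quot vadd_quot add_commute)
  show "vadd Q (vadd Q A C) E = vadd Q A (vadd Q C E)"
    if "A \<in> carr Q" "C \<in> carr Q" "E \<in> carr Q" for A C E
    using that by (auto simp: carr_quot vadd_quot closed add_assoc)
  show "vscale Q c (vadd Q A C) = vadd Q (vscale Q c A) (vscale Q c C)"
    if "A \<in> carr Q" "C \<in> carr Q" for A C c
    using that by (auto simp: carr_quot vadd_quot vscale_quot closed scale_add)
  show "vscale Q (a + b) A = vadd Q (vscale Q a A) (vscale Q b A)" if "A \<in> carr Q" for A a b
    using that by (auto simp: carr_quot vadd_quot vscale_quot closed add_scale)
  show "vscale Q a (vscale Q b A) = vscale Q (a * b) A" if "A \<in> carr Q" for A a b
    using that by (auto simp: carr_quot vscale_quot closed scale_scale)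
  show "vnorm Q (vadd Q A C) \<le> vnorm Q A + vnorm Q C" if "A \<in> carr Q" "C \<in> carr Q" for A C
    using that by (auto simp: carr_quot vadd_quot vnorm_quot closed norm_triangle)
  show "A = vclass V null" if "A \<in> carr Q" "vnorm Q A = 0" for A
  proof -
    obtain x where "x \<in> carr V" "A = vclass V x" "vnorm V x = 0"
      using \<open>A \<in> carr Q\<close> \<open>vnorm Q A = 0\<close> by (auto simp: carr_quot vnorm_quot)
    moreover have "vminus V x null = x" if "x \<in> carr V"
      using add_minus_self[of null x] that by (simp add: null_add closed)
    ultimately show ?thesis by (simp add: vclass_eq_iff closed)
  qed
qed (auto simp: carr_quot vadd_quot vscale_quot vnorm_quot closed add_null scale_one scale_zero
    norm_nonneg norm_scale)

context normed_space
begin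

lemma Metric_space_vdist: "Metric_space (carr V) (vdist V)"
proof
  fix x y show "0 \<le> vdist V x y" "vdist V x y = vdist V y x"
    by (auto simp: vdist_def norm_nonneg closed norm_minus_commute)
next
  fix x y assume "x \<in> carr V" "y \<in> carr V"
  then show "vdist V x y = 0 \<longleftrightarrow> x = y"
    using norm_eq_zero[OF minus_closed, of x y] add_minus_cancel[of y x]
    by (auto simp: vdist_def norm_minus_self add_null)
next
  fix x y w assume "x \<in> carr V" "y \<in> carr V" "w \<in> carr V"
  then show "vdist V x w \<le> vdist V x y + vdist V y w"
    by (simp add: vdist_def norm_minus_triangle)
qed

end


subsection \<open>Bounded operators on a seminormed space\<close>

context seminormed_space
begin

abbreviation (input) "B \<equiv> blin_space V V"

lemma blinD:
  assumes "T \<in> carr B"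
  shows "T \<in> carr V \<rightarrow>\<^sub>E carr V"
    and "x \<in> carr V \<Longrightarrow> T x \<in> carr V"
    and "x \<in> carr V \<Longrightarrow> y \<in> carr V \<Longrightarrow> T (vadd V x y) = vadd V (T x) (T y)"
    and "x \<in> carr V \<Longrightarrow> T (vscale V c x) = vscale V c (T x)"
  using assms by (auto simp: blin_space_def)

lemma blinI:
  assumes "T \<in> carr V \<rightarrow>\<^sub>E carr V"
    and "\<And>x y. x \<in> carr V \<Longrightarrow> y \<in> carr V \<Longrightarrow> T (vadd V x y) = vadd V (T x) (T y)"
    and "\<And>x c. x \<in> carr V \<Longrightarrow> T (vscale V c x) = vscale V c (T x)"
    and "\<And>x. x \<in> carr V \<Longrightarrow> vnorm V (T x) \<le> K * vnorm V x"
  shows "T \<in> carr B"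
  unfolding blin_space_def using assms by (simp, blast)

lemma blin_minus:
  assumes "T \<in> carr B" "x \<in> carr V" "y \<in> carr V"
  shows "T (vminus V x y) = vminus V (T x) (T y)"
  using assms by (simp add: vminus_def blinD closed)

lemma blin_bound:
  assumes "T \<in> carr B"
  obtains K where "K \<ge> 0" "\<And>x. x \<in> carr V \<Longrightarrow> vnorm V (T x) \<le> K * vnorm V x"
proof -
  obtain K where K: "\<And>x. x \<in> carr V \<Longrightarrow> vnorm V (T x) \<le> K * vnorm V x"
    using assms unfolding blin_space_def by (simp, blast)
  have "vnorm V (T x) \<le> \<bar>K\<bar> * vnorm V x" if "x \<in> carr V" for x
  proof -
    have "K * vnorm V x \<le> \<bar>K\<bar> * vnorm V x" by (rule mult_right_mono) (auto simp: that norm_nonneg)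
    then show ?thesis using K[OF that] by linarith
  qed
  then show ?thesis using that[of "\<bar>K\<bar>"] by simp
qed

text \<open>
  The operator norm is only ever used through this equivalence. The supremum over the unit ball
  is finite because the operator is bounded, and rescaling extends its bound to all vectors of
  positive seminorm; on vectors of seminorm 0 boundedness already forces the value to have
  seminorm 0.
\<close>

lemma opnorm_le_iff:
  assumes "T \<in> carr B"
  shows "vnorm B T \<le> e \<longleftrightarrow> 0 \<le> e \<and> (\<forall>h\<in>carr V. vnorm V (T h) \<le> e * vnorm V h)"
proof -
  let ?U = "{x \<in> carr V. vnorm V x \<le> 1}"
  have nB: "vnorm B T = (SUP x\<in>?U. vnorm V (T x))" by (simp add: blin_space_def)
  obtain K where K: "K \<ge> 0" "\<And>x. x \<in> carr V \<Longrightarrow> vnorm V (T x) \<le> K * vnorm V x"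
    using blin_bound[OF assms] by blast
  have bdd: "bdd_above ((\<lambda>x. vnorm V (T x)) ` ?U)"
  proof (rule bdd_aboveI2)
    fix x assume "x \<in> ?U"
    then show "vnorm V (T x) \<le> K" using K(2)[of x] K(1) mult_left_le[of "vnorm V x" K] by auto
  qed
  have T0: "vnorm V (T null) = 0"
    using K(2)[OF null_closed] norm_nonneg[OF blinD(2)[OF assms null_closed]] by (simp add: norm_null)
  have le: "vnorm V (T x) \<le> vnorm B T" if "x \<in> ?U" for x
    unfolding nB by (rule cSUP_upper[OF that bdd])
  show ?thesis
  proof
    assume e: "vnorm B T \<le> e"
    have "0 \<le> e" using le[of null] e T0 by (simp add: null_closed norm_null)
    moreover have "vnorm V (T h) \<le> e * vnorm V h" if h: "h \<in> carr V" for h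
    proof (cases "vnorm V h = 0")
      case True then show ?thesis using K(2)[OF h] by simp
    next
      case False
      then have pos: "vnorm V h > 0" using norm_nonneg[OF h] by simp
      let ?u = "vscale V (1 / vnorm V h) h"
      have "vnorm V (T ?u) \<le> e"
        using le[of ?u] e pos h by (simp add: closed norm_scale)
      then show ?thesis using pos h by (simp add: blinD[OF assms] norm_scale field_simps)
    qed
    ultimately show "0 \<le> e \<and> (\<forall>h\<in>carr V. vnorm V (T h) \<le> e * vnorm V h)" by blast
  next
    assume R: "0 \<le> e \<and> (\<forall>h\<in>carr V. vnorm V (T h) \<le> e * vnorm V h)"
    show "vnorm B T \<le> e"
      unfolding nB
    proof (rule cSUP_least)
      show "?U \<noteq> {}" using null_closed norm_null by (force intro!: exI[of _ null])
      fix x assume "x \<in> ?U"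
      then show "vnorm V (T x) \<le> e" using R mult_left_le[of "vnorm V x" e] by fastforce
    qed
  qed
qed

lemma blin_minus_apply: "h \<in> carr V \<Longrightarrow> vminus B S T h = vminus V (S h) (T h)"
  by (simp add: vminus_def blin_space_def)

lemma blin_minus_closed:
  assumes S: "S \<in> carr B" and T: "T \<in> carr B"
  shows "vminus B S T \<in> carr B"
proof -
  have 1: "vminus B S T \<in> carr V \<rightarrow>\<^sub>E carr V"
    using blinD(2)[OF S] blinD(2)[OF T] by (auto simp: vminus_def blin_space_def closed)
  obtain K where K: "K \<ge> 0" "\<And>x. x \<in> carr V \<Longrightarrow> vnorm V (S x) \<le> K * vnorm V x"
    using blin_bound[OF S] by blast
  obtain L where L: "L \<ge> 0" "\<And>x. x \<in> carr V \<Longrightarrow> vnorm V (T x) \<le> L * vnorm V x"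
    using blin_bound[OF T] by blast
  have 2: "vnorm V (vminus B S T x) \<le> (K + L) * vnorm V x" if "x \<in> carr V" for x
    using K(2)[OF that] L(2)[OF that] that
      norm_triangle[of "S x" "vscale V (-1) (T x)"]
    unfolding blin_minus_apply[OF that] vminus_def[of V]
    by (simp add: blinD[OF S] blinD[OF T] closed norm_scale ring_distribs)
  have 3: "vminus B S T (vadd V x y) = vadd V (vminus B S T x) (vminus B S T y)"
    if "x \<in> carr V" "y \<in> carr V" for x y
    using that by (simp add: blin_minus_apply closed blinD[OF S] blinD[OF T] add_minus_add)
  have 4: "vminus B S T (vscale V c x) = vscale V c (vminus B S T x)"
    if "x \<in> carr V" for x c
    using that by (simp add: blin_minus_apply closed blinD[OF S] blinD[OF T] scale_minus)
  show ?thesis by (rule blinI[OF 1 3 4 2])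
qed

lemma opdist_le_iff:
  assumes "S \<in> carr B" "T \<in> carr B"
  shows "vdist B S T \<le> e \<longleftrightarrow>
     0 \<le> e \<and> (\<forall>h\<in>carr V. gap (S h) (T h) \<le> e * vnorm V h)"
  using assms opnorm_le_iff[OF blin_minus_closed[OF assms]] by (simp add: vdist_def blin_minus_apply)

end

context normed_space
begin

text \<open>
  By \<open>opdist_le_iff\<close> the distance of two operators is the best constant in a
  pointwise inequality, so every metric axiom is inherited from the seminorm of the target.
\<close>

lemma Metric_space_blin: "Metric_space (carr (blin_space V V)) (vdist (blin_space V V))"
proof
  have bound: "gap (S h) (T h) \<le> vdist B S T * vnorm V h" and nonneg: "0 \<le> vdist B S T"
    if "S \<in> carr B" "T \<in> carr B" "h \<in> carr V" for S T h
    using opdist_le_iff[OF that(1,2), of "vdist B S T"] that(3) by auto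
  show "0 \<le> vdist B S T" for S T
    using nonneg[OF _ _ null_closed] by (auto simp: vdist_def)
  show "vdist B S T = vdist B T S" for S T
  proof (cases "S \<in> carr B \<and> T \<in> carr B")
    case True
    have "vdist B S T \<le> vdist B T S" if "S \<in> carr B" "T \<in> carr B" for S T
      using that bound[of T S] nonneg[of T S null] null_closed
      by (simp add: opdist_le_iff norm_minus_commute blinD(2))
    then show ?thesis using True by (meson antisym)
  qed (auto simp: vdist_def)
  show "vdist B S T = 0 \<longleftrightarrow> S = T" if ST: "S \<in> carr B" "T \<in> carr B" for S T
  proof
    assume 0: "vdist B S T = 0"
    have "S h = T h" if h: "h \<in> carr V" for h
    proof -
      have c: "S h \<in> carr V" "T h \<in> carr V" using ST h by (auto simp: blinD(2))
      have "gap (S h) (T h) = 0"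
        using bound[OF ST h] 0 norm_nonneg[OF minus_closed[OF c]] by simp
      then show ?thesis using norm_eq_zero[OF minus_closed[OF c]] add_minus_cancel[of "T h" "S h"] c
        by (simp add: add_null)
    qed
    then show "S = T" using blinD(1)[OF ST(1)] blinD(1)[OF ST(2)] by (meson PiE_ext)
  next
    assume "S = T"
    then have "vdist B S T \<le> 0" using ST by (simp add: opdist_le_iff norm_minus_self blinD(2))
    then show "vdist B S T = 0" using nonneg[OF ST null_closed] by simp
  qed
  show "vdist B S U \<le> vdist B S T + vdist B T U" if "S \<in> carr B" "T \<in> carr B" "U \<in> carr B" for S T U
  proof -
    have "gap (S h) (U h) \<le> (vdist B S T + vdist B T U) * vnorm V h" if "h \<in> carr V" for h
      using norm_minus_triangle[of "S h" "T h" "U h"] bound[of S T h] bound[of T U h] that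
        \<open>S \<in> carr B\<close> \<open>T \<in> carr B\<close> \<open>U \<in> carr B\<close>
      by (simp add: ring_distribs blinD(2))
    then show ?thesis using that nonneg[OF _ _ null_closed] by (simp add: opdist_le_iff)
  qed
qed

lemma continuous_map_into_blin:
  assumes "\<And>x. x \<in> carr V \<Longrightarrow> D x \<in> carr B"
    and "\<And>x e. x \<in> carr V \<Longrightarrow> e > 0 \<Longrightarrow> \<exists>d>0. \<forall>y\<in>carr V. gap y x < d \<longrightarrow>
           (\<forall>h\<in>carr V. gap (D y h) (D x h) \<le> e * vnorm V h)"
  shows "continuous_map (vtop V) (vtop B) D"
proof -
  interpret M: Metric_space "carr V" "vdist V" by (rule Metric_space_vdist)
  interpret N: Metric_space "carr B" "vdist B" by (rule Metric_space_blin)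
  show ?thesis
    unfolding vtop_def N.continuous_map_to_metric
  proof (intro ballI allI impI)
    fix x and e :: real assume x: "x \<in> topspace M.mtopology" and e: "e > 0"
    then have xV: "x \<in> carr V" by simp
    \<comment> \<open>The pointwise hypothesis yields a weak inequality; \<open>e/2\<close> makes it strict.\<close>
    obtain d where d: "d > 0" "\<And>y h. \<lbrakk>y \<in> carr V; gap y x < d; h \<in> carr V\<rbrakk> \<Longrightarrow>
        gap (D y h) (D x h) \<le> e/2 * vnorm V h"
      using assms(2)[OF xV, of "e/2"] e by auto
    show "\<exists>U. openin M.mtopology U \<and> x \<in> U \<and> (\<forall>y\<in>U. D y \<in> N.mball (D x) e)"
    proof (intro exI[of _ "M.mball x d"] conjI ballI)
      fix y assume y: "y \<in> M.mball x d"
      then have "y \<in> carr V" "gap y x < d"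
        by (auto simp: vdist_def norm_minus_commute)
      then have "vdist B (D y) (D x) \<le> e/2"
        using d(2)[of y] e xV assms(1) by (subst opdist_le_iff) auto
      then show "D y \<in> N.mball (D x) e"
        using e assms(1) xV \<open>y \<in> carr V\<close> N.commute[of "D y" "D x"] by simp
    qed (use d xV in auto)
  qed
qed

lemma continuous_map_time_space:
  fixes \<Phi> :: "real \<Rightarrow> 'v \<Rightarrow> 'v"
  assumes "\<And>t x. t \<ge> 0 \<Longrightarrow> x \<in> carr V \<Longrightarrow> \<Phi> t x \<in> carr V"
    and "\<And>t x e. t \<ge> 0 \<Longrightarrow> x \<in> carr V \<Longrightarrow> e > 0 \<Longrightarrow> \<exists>d>0. \<forall>s\<ge>0. \<forall>y\<in>carr V. \<bar>s - t\<bar> < d \<longrightarrow>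
           gap y x < d \<longrightarrow> gap (\<Phi> s y) (\<Phi> t x) < e"
  shows "continuous_map (prod_topology (top_of_set {0..}) (vtop V)) (vtop V) (\<lambda>(t, x). \<Phi> t x)"
proof -
  interpret M: Metric_space "carr V" "vdist V" by (rule Metric_space_vdist)
  show ?thesis
    unfolding vtop_def M.continuous_map_to_metric
  proof (intro ballI allI impI)
    fix a :: "real \<times> 'v" and e :: real assume "a \<in> topspace (prod_topology (top_of_set {0..}) M.mtopology)" and e: "e > 0"
    then obtain t x where a: "a = (t, x)" "t \<ge> 0" "x \<in> carr V" by auto
    obtain d where d: "d > 0" "\<And>s y. \<lbrakk>s \<ge> 0; y \<in> carr V; \<bar>s - t\<bar> < d; gap y x < d\<rbrakk> \<Longrightarrow>
        gap (\<Phi> s y) (\<Phi> t x) < e"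
      using assms(2)[OF a(2,3) e] by auto
    let ?U = "({0..} \<inter> ball t d) \<times> M.mball x d"
    show "\<exists>U. openin (prod_topology (top_of_set {0..}) M.mtopology) U \<and> a \<in> U \<and>
       (\<forall>b\<in>U. (case b of (t, x) \<Rightarrow> \<Phi> t x) \<in> M.mball (case a of (t, x) \<Rightarrow> \<Phi> t x) e)"
    proof (intro exI[of _ ?U] conjI ballI)
      show "openin (prod_topology (top_of_set {0..}) M.mtopology) ?U"
        by (auto simp: openin_prod_Times_iff openin_open_Int)
      show "a \<in> ?U" using a d by simp
      fix b assume "b \<in> ?U"
      then obtain s y where b: "b = (s, y)" "s \<ge> 0" "\<bar>s - t\<bar> < d" "y \<in> carr V" "vdist V x y < d"
        by (auto simp: dist_real_def)
      then have "gap y x < d" using a by (simp add: vdist_def norm_minus_commute)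
      then show "(case b of (t, x) \<Rightarrow> \<Phi> t x) \<in> M.mball (case a of (t, x) \<Rightarrow> \<Phi> t x) e"
        using d(2) a b assms(1) by (simp add: vdist_def norm_minus_commute)
    qed
  qed
qed

end


subsection \<open>Continuous differentiability in a seminormed space\<close>

context seminormed_space
begin

text \<open>
  Continuity of the derivative is phrased with \<open>e\<close> and \<open>d\<close>, since
  \<open>vtop\<close> is the topology of a metric only when the seminorm is definite.
\<close>

definition C1_self_map :: "('v \<Rightarrow> 'v) \<Rightarrow> bool" where
  "C1_self_map F \<longleftrightarrow> F \<in> carr V \<rightarrow> carr V \<and>
     (\<exists>D. (\<forall>x\<in>carr V. frechet_at V V F x (D x)) \<and>
       (\<forall>x\<in>carr V. \<forall>e>0. \<exists>d>0. \<forall>y\<in>carr V. gap y x < d \<longrightarrow>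
          (\<forall>h\<in>carr V. gap (D y h) (D x h) \<le> e * vnorm V h)))"

lemma frechet_atD:
  assumes "frechet_at V V F x T" "e > 0" "x \<in> carr V"
  obtains d where "d > 0" "\<And>y. \<lbrakk>y \<in> carr V; gap y x < d\<rbrakk> \<Longrightarrow>
     gap (vminus V (F y) (F x)) (T (vminus V y x)) \<le> e * gap y x"
proof -
  obtain d where d: "d > 0" "\<And>h. \<lbrakk>h \<in> carr V; vnorm V h < d\<rbrakk> \<Longrightarrow>
      gap (vminus V (F (vadd V x h)) (F x)) (T h) \<le> e * vnorm V h"
    using assms unfolding frechet_at_def by blast
  show ?thesis
  proof (rule that[OF d(1)])
    fix y assume y: "y \<in> carr V" "gap y x < d"
    show "gap (vminus V (F y) (F x)) (T (vminus V y x)) \<le> e * gap y x"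
      using d(2)[OF minus_closed[OF y(1) assms(3)] y(2)] add_minus_cancel[OF assms(3) y(1)] by simp
  qed
qed

text \<open>
  Near \<open>x\<close> the increment of \<open>F\<close> differs from that of the bounded
  operator \<open>T\<close> by at most the seminorm of the displacement. This is the form in
  which differentiability enters the chain rule and the passage to the quotient.
\<close>

lemma frechet_at_imp_locally_lipschitz:
  assumes "frechet_at V V F x T" "F \<in> carr V \<rightarrow> carr V" "x \<in> carr V"
  obtains d L where "d > 0" "L > 0" "\<And>y. \<lbrakk>y \<in> carr V; gap y x < d\<rbrakk> \<Longrightarrow>
     gap (F y) (F x) \<le> L * gap y x"
proof -
  have T: "T \<in> carr B" using assms(1) by (simp add: frechet_at_def)
  obtain K where K: "K \<ge> 0" "\<And>x. x \<in> carr V \<Longrightarrow> vnorm V (T x) \<le> K * vnorm V x"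
    using blin_bound[OF T] by blast
  obtain d where d: "d > 0" "\<And>y. \<lbrakk>y \<in> carr V; gap y x < d\<rbrakk> \<Longrightarrow>
     gap (vminus V (F y) (F x)) (T (vminus V y x)) \<le> 1 * gap y x"
    using frechet_atD[OF assms(1) zero_less_one assms(3)] by blast
  show ?thesis
  proof (rule that[OF d(1), of "1 + K"])
    fix y assume y: "y \<in> carr V" "gap y x < d"
    have c: "F y \<in> carr V" "F x \<in> carr V" using assms y by auto
    then show "gap (F y) (F x) \<le> (1 + K) * gap y x"
      using norm_le_norm_minus[of "vminus V (F y) (F x)" "T (vminus V y x)"] d(2)[OF y]
        K(2)[of "vminus V y x"] y assms(3) by (simp add: closed blinD[OF T] ring_distribs)
  qed (use K in simp)
qed

lemma blin_compose:
  assumes S: "S \<in> carr B" and T: "T \<in> carr B"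
  shows "(\<lambda>h\<in>carr V. S (T h)) \<in> carr B"
proof -
  obtain K where K: "K \<ge> 0" "\<And>x. x \<in> carr V \<Longrightarrow> vnorm V (S x) \<le> K * vnorm V x"
    using blin_bound[OF S] by blast
  obtain L where L: "L \<ge> 0" "\<And>x. x \<in> carr V \<Longrightarrow> vnorm V (T x) \<le> L * vnorm V x"
    using blin_bound[OF T] by blast
  have "vnorm V (S (T x)) \<le> (K * L) * vnorm V x" if "x \<in> carr V" for x
    using K(2)[of "T x"] L(2)[OF that] mult_left_mono[OF L(2)[OF that] K(1)] that
    by (simp add: blinD(2)[OF T])
  then have "\<exists>K. \<forall>x\<in>carr V. vnorm V (S (T x)) \<le> K * vnorm V x" by blast
  then show ?thesis
    using blinD[OF S] blinD[OF T] by (simp add: blin_space_def closed)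
qed

text \<open>
  The chain rule. With \<open>k = F (x + h) - F x\<close>, the remainder of the composition at
  \<open>h\<close> is the remainder of \<open>G\<close> at \<open>k\<close> plus
  \<open>DG (F x)\<close> applied to the remainder of \<open>F\<close> at \<open>h\<close>; the
  constants \<open>e1\<close> and \<open>e2\<close> give each of the two parts half of the error.
\<close>

lemma C1_self_map_compose:
  assumes "C1_self_map F" "C1_self_map G"
  shows "C1_self_map (\<lambda>x. G (F x))"
proof -
  obtain D where F: "F \<in> carr V \<rightarrow> carr V" and D: "\<And>x. x \<in> carr V \<Longrightarrow> frechet_at V V F x (D x)"
    and Dc: "\<And>x e. x \<in> carr V \<Longrightarrow> e > 0 \<Longrightarrow> \<exists>d>0. \<forall>y\<in>carr V. gap y x < d \<longrightarrow>
          (\<forall>h\<in>carr V. gap (D y h) (D x h) \<le> e * vnorm V h)"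
    using assms(1) unfolding C1_self_map_def by blast
  obtain E where G: "G \<in> carr V \<rightarrow> carr V" and E: "\<And>x. x \<in> carr V \<Longrightarrow> frechet_at V V G x (E x)"
    and Ec: "\<And>x e. x \<in> carr V \<Longrightarrow> e > 0 \<Longrightarrow> \<exists>d>0. \<forall>y\<in>carr V. gap y x < d \<longrightarrow>
          (\<forall>h\<in>carr V. gap (E y h) (E x h) \<le> e * vnorm V h)"
    using assms(2) unfolding C1_self_map_def by blast
  have Fc: "F x \<in> carr V" and Gc: "G x \<in> carr V" and DB: "D x \<in> carr B" and EB: "E x \<in> carr B"
    if "x \<in> carr V" for x
    using F G D[OF that] E[OF that] that by (auto simp: frechet_at_def)
  have cl: "D x h \<in> carr V" "E x h \<in> carr V" if "x \<in> carr V" "h \<in> carr V" for x h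
    using DB EB blinD(2) that by blast+
  show ?thesis
    unfolding C1_self_map_def
  proof (intro conjI exI[of _ "\<lambda>x. \<lambda>h\<in>carr V. E (F x) (D x h)"] ballI allI impI)
    show "(\<lambda>x. G (F x)) \<in> carr V \<rightarrow> carr V" using F G by auto
  next
    fix x assume x: "x \<in> carr V"
    obtain d1 L where L: "d1 > 0" "L > 0" "\<And>y. \<lbrakk>y \<in> carr V; gap y x < d1\<rbrakk> \<Longrightarrow>
        gap (F y) (F x) \<le> L * gap y x"
      using frechet_at_imp_locally_lipschitz[OF D[OF x] F x] by blast
    obtain K where K: "K \<ge> 0" "\<And>h. h \<in> carr V \<Longrightarrow> vnorm V (E (F x) h) \<le> K * vnorm V h"
      using blin_bound[OF EB[OF Fc[OF x]]] by blast
    show "frechet_at V V (\<lambda>x. G (F x)) x (\<lambda>h\<in>carr V. E (F x) (D x h))"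
      unfolding frechet_at_def
    proof (intro conjI allI impI)
      show "(\<lambda>h\<in>carr V. E (F x) (D x h)) \<in> carr B" by (intro blin_compose EB DB Fc x)
      fix e :: real assume e: "e > 0"
      define e1 where "e1 = e / (2 * L)"
      define e2 where "e2 = e / (2 * (K + 1))"
      have e12: "e1 > 0" "e2 > 0" using e L K by (auto simp: e1_def e2_def)
      obtain d2 where d2: "d2 > 0" "\<And>y. \<lbrakk>y \<in> carr V; gap y (F x) < d2\<rbrakk> \<Longrightarrow>
         gap (vminus V (G y) (G (F x))) (E (F x) (vminus V y (F x))) \<le> e1 * gap y (F x)"
        using frechet_atD[OF E[OF Fc[OF x]] e12(1) Fc[OF x]] by blast
      obtain d3 where d3: "d3 > 0" "\<And>y. \<lbrakk>y \<in> carr V; gap y x < d3\<rbrakk> \<Longrightarrow>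
         gap (vminus V (F y) (F x)) (D x (vminus V y x)) \<le> e2 * gap y x"
        using frechet_atD[OF D[OF x] e12(2) x] by blast
      show "\<exists>d>0. \<forall>h\<in>carr V. vnorm V h < d \<longrightarrow>
          gap (vminus V (G (F (vadd V x h))) (G (F x))) ((\<lambda>h\<in>carr V. E (F x) (D x h)) h) \<le> e * vnorm V h"
      proof (intro exI[of _ "Min {d1, d3, d2 / L}"] conjI ballI impI)
        show "Min {d1, d3, d2 / L} > 0" using L d2 d3 by simp
        fix h assume h: "h \<in> carr V" "vnorm V h < Min {d1, d3, d2 / L}"
        let ?y = "vadd V x h"
        have y: "?y \<in> carr V" "vminus V ?y x = h" using x h by (auto simp: closed add_minus_self)
        let ?k = "vminus V (F ?y) (F x)"
        have kc: "?k \<in> carr V" using x y by (simp add: closed Fc)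
        have k: "vnorm V ?k \<le> L * vnorm V h" using L(3)[OF y(1)] y h by simp
        also have "\<dots> < d2" using h L by (simp add: field_simps)
        finally have A: "gap (vminus V (G (F ?y)) (G (F x))) (E (F x) ?k) \<le> e1 * vnorm V ?k"
          using d2(2)[of "F ?y"] y Fc by simp
        have "e1 * vnorm V ?k \<le> e/2 * vnorm V h"
          using mult_left_mono[OF k, of e1] e12 L by (simp add: e1_def)
        with A have A: "gap (vminus V (G (F ?y)) (G (F x))) (E (F x) ?k) \<le> e/2 * vnorm V h"
          by linarith
        have "gap (E (F x) ?k) (E (F x) (D x h)) = vnorm V (E (F x) (vminus V ?k (D x h)))"
          using blin_minus[OF EB] x kc h Fc cl by simp
        also have "\<dots> \<le> K * gap ?k (D x h)"
          using K(2) kc cl x h by (simp add: closed)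
        also have "\<dots> \<le> K * (e2 * vnorm V h)"
          using d3(2)[OF y(1)] y h K by (intro mult_left_mono) auto
        also have "\<dots> \<le> e/2 * vnorm V h"
        proof -
          have "K * e2 \<le> e/2" using K e by (simp add: e2_def field_simps)
          then show ?thesis using norm_nonneg[OF h(1)] by (metis mult.assoc mult_right_mono)
        qed
        finally have Bd: "gap (E (F x) ?k) (E (F x) (D x h)) \<le> e/2 * vnorm V h" .
        show "gap (vminus V (G (F ?y)) (G (F x))) ((\<lambda>h\<in>carr V. E (F x) (D x h)) h) \<le> e * vnorm V h"
          using norm_minus_triangle[of "vminus V (G (F ?y)) (G (F x))" "E (F x) ?k" "E (F x) (D x h)"]
            A Bd h x y kc by (simp add: closed Gc Fc cl)
      qed
    qed
  next
    fix x and e :: real assume x: "x \<in> carr V" and e: "e > 0"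
    obtain d1 L where L: "d1 > 0" "L > 0" "\<And>y. \<lbrakk>y \<in> carr V; gap y x < d1\<rbrakk> \<Longrightarrow>
        gap (F y) (F x) \<le> L * gap y x"
      using frechet_at_imp_locally_lipschitz[OF D[OF x] F x] by blast
    obtain K where K: "K \<ge> 0" "\<And>h. h \<in> carr V \<Longrightarrow> vnorm V (E (F x) h) \<le> K * vnorm V h"
      using blin_bound[OF EB[OF Fc[OF x]]] by blast
    obtain M where M: "M \<ge> 0" "\<And>h. h \<in> carr V \<Longrightarrow> vnorm V (D x h) \<le> M * vnorm V h"
      using blin_bound[OF DB[OF x]] by blast
    define e1 where "e1 = e / (2 * (M + 1))"
    define e2 where "e2 = min 1 (e / (2 * (K + 1)))"
    have e12: "e1 > 0" "e2 > 0" "e2 \<le> 1" using e M K by (auto simp: e1_def e2_def)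
    have Ke: "K * e2 \<le> e/2"
    proof -
      have "K * e2 \<le> (K + 1) * (e / (2 * (K + 1)))"
        using K e by (intro mult_mono) (auto simp: e2_def)
      also have "\<dots> = e/2" using K by (simp add: field_simps)
      finally show ?thesis .
    qed
    obtain d2 where d2: "d2 > 0" "\<And>y h. \<lbrakk>y \<in> carr V; gap y (F x) < d2; h \<in> carr V\<rbrakk> \<Longrightarrow>
          gap (E y h) (E (F x) h) \<le> e1 * vnorm V h"
      using Ec[OF Fc[OF x] e12(1)] by blast
    obtain d3 where d3: "d3 > 0" "\<And>y h. \<lbrakk>y \<in> carr V; gap y x < d3; h \<in> carr V\<rbrakk> \<Longrightarrow>
          gap (D y h) (D x h) \<le> e2 * vnorm V h"
      using Dc[OF x e12(2)] by blast
    show "\<exists>d>0. \<forall>y\<in>carr V. gap y x < d \<longrightarrow> (\<forall>h\<in>carr V.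
       gap ((\<lambda>h\<in>carr V. E (F y) (D y h)) h) ((\<lambda>h\<in>carr V. E (F x) (D x h)) h) \<le> e * vnorm V h)"
    proof (intro exI[of _ "Min {d1, d3, d2 / L}"] conjI ballI impI)
      show "Min {d1, d3, d2 / L} > 0" using L d2 d3 by simp
      fix y h assume y: "y \<in> carr V" "gap y x < Min {d1, d3, d2 / L}" and h: "h \<in> carr V"
      have "gap (F y) (F x) \<le> L * gap y x" using L(3) y by simp
      also have "\<dots> < d2" using y L by (simp add: field_simps)
      finally have "gap (E (F y) (D y h)) (E (F x) (D y h)) \<le> e1 * vnorm V (D y h)"
        using d2(2) y h Fc cl by simp
      also have "\<dots> \<le> e1 * ((M + 1) * vnorm V h)"
      proof (rule mult_left_mono)
        have "gap (D y h) (D x h) \<le> e2 * vnorm V h" using d3(2) y h by simp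
        also have "\<dots> \<le> 1 * vnorm V h" using e12 norm_nonneg[OF h] by (intro mult_right_mono) auto
        finally show "vnorm V (D y h) \<le> (M + 1) * vnorm V h"
          using norm_le_norm_minus[of "D y h" "D x h"] M(2)[OF h] cl x y h by (simp add: ring_distribs)
      qed (use e12 in simp)
      also have "\<dots> = e/2 * vnorm V h"
        using M by (simp add: e1_def field_simps)
      finally have A: "gap (E (F y) (D y h)) (E (F x) (D y h)) \<le> e/2 * vnorm V h" .
      have "gap (E (F x) (D y h)) (E (F x) (D x h)) = vnorm V (E (F x) (vminus V (D y h) (D x h)))"
        using blin_minus[OF EB] x y h Fc cl by simp
      also have "\<dots> \<le> K * gap (D y h) (D x h)"
        using K(2) cl x y h by (simp add: closed)
      also have "\<dots> \<le> K * (e2 * vnorm V h)"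
        using d3(2) y h K by (intro mult_left_mono) auto
      also have "\<dots> \<le> e/2 * vnorm V h"
        using Ke norm_nonneg[OF h] by (metis mult.assoc mult_right_mono)
      finally have Bd: "gap (E (F x) (D y h)) (E (F x) (D x h)) \<le> e/2 * vnorm V h" .
      show "gap ((\<lambda>h\<in>carr V. E (F y) (D y h)) h) ((\<lambda>h\<in>carr V. E (F x) (D x h)) h) \<le> e * vnorm V h"
        using norm_minus_triangle[of "E (F y) (D y h)" "E (F x) (D y h)" "E (F x) (D x h)"]
          A Bd h x y by (simp add: Fc cl)
    qed
  qed
qed

text \<open>
  Local Lipschitz continuity sends displacements of seminorm 0 to displacements of seminorm 0, so
  a differentiable map descends to the quotient.
\<close>

lemma C1_self_map_respects:
  assumes "C1_self_map F" "x \<in> carr V" "y \<in> carr V" "gap x y = 0"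
  shows "gap (F x) (F y) = 0"
proof -
  obtain T where F: "F \<in> carr V \<rightarrow> carr V" and T: "frechet_at V V F y T"
    using assms unfolding C1_self_map_def by blast
  obtain d L where "d > 0" "L > 0" "\<And>y'. \<lbrakk>y' \<in> carr V; gap y' y < d\<rbrakk> \<Longrightarrow>
     gap (F y') (F y) \<le> L * gap y' y"
    using frechet_at_imp_locally_lipschitz[OF T F assms(3)] by blast
  then have "gap (F x) (F y) \<le> 0" using assms by fastforce
  moreover have "0 \<le> gap (F x) (F y)" using F assms by (intro norm_nonneg closed) auto
  ultimately show ?thesis by simp
qed

text \<open>
  When \<open>F\<close> respects the null relation, all members of this union are the same class.
\<close>

definition qlift :: "('v \<Rightarrow> 'v) \<Rightarrow> 'v set \<Rightarrow> 'v set" where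
  "qlift F A = (\<Union>x\<in>A. vclass V (F x))"

lemma qlift_vclass:
  assumes "F \<in> carr V \<rightarrow> carr V" "x \<in> carr V"
    and "\<And>x y. \<lbrakk>x \<in> carr V; y \<in> carr V; gap x y = 0\<rbrakk> \<Longrightarrow> gap (F x) (F y) = 0"
  shows "qlift F (vclass V x) = vclass V (F x)"
  unfolding qlift_def
proof (rule UN_vclass[OF assms(2)])
  fix y assume "y \<in> vclass V x"
  then have "y \<in> carr V" "gap y x = 0"
    using norm_minus_commute by (auto simp: in_vclass_iff)
  moreover have "F x \<in> carr V" "F y \<in> carr V" using assms \<open>y \<in> carr V\<close> by auto
  ultimately show "vclass V (F y) = vclass V (F x)" using assms by (simp add: vclass_eq_iff)
qed

lemma qlift_blin:
  assumes T: "T \<in> carr B" and "x \<in> carr V"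
  shows "qlift T (vclass V x) = vclass V (T x)"
proof (rule qlift_vclass)
  show "T \<in> carr V \<rightarrow> carr V" using blinD(2)[OF T] by auto
  obtain K where K: "K \<ge> 0" "\<And>x. x \<in> carr V \<Longrightarrow> vnorm V (T x) \<le> K * vnorm V x"
    using blin_bound[OF T] by blast
  fix x y assume "x \<in> carr V" "y \<in> carr V" "gap x y = 0"
  then show "gap (T x) (T y) = 0"
    using K(2)[of "vminus V x y"] norm_nonneg[of "T (vminus V x y)"] blin_minus[OF T, of x y]
      blinD(2)[OF T] by (simp add: closed)
qed (fact assms)

lemma qlift_blin_closed:
  assumes T: "T \<in> carr B"
  shows "restrict (qlift T) (carr Q) \<in> carr (blin_space Q Q)"
proof -
  obtain K where K: "K \<ge> 0" "\<And>x. x \<in> carr V \<Longrightarrow> vnorm V (T x) \<le> K * vnorm V x"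
    using blin_bound[OF T] by blast
  have "\<exists>K. \<forall>x\<in>carr Q. vnorm Q (qlift T x) \<le> K * vnorm Q x"
    using K by (intro exI[of _ K]) (auto simp: carr_quot qlift_blin[OF T] vnorm_quot blinD[OF T])
  moreover interpret N: normed_space Q "vclass V null" by (rule quot_normed_space)
  have "qlift T (vadd Q x y) = vadd Q (qlift T x) (qlift T y)" if "x \<in> carr Q" "y \<in> carr Q" for x y
    using that by (auto simp: carr_quot vadd_quot qlift_blin[OF T] blinD[OF T] closed)
  moreover have "qlift T (vscale Q c x) = vscale Q c (qlift T x)" if "x \<in> carr Q" for x c
    using that by (auto simp: carr_quot vscale_quot qlift_blin[OF T] blinD[OF T] closed)
  moreover have "qlift T \<in> carr Q \<rightarrow> carr Q"
    by (auto simp: carr_quot qlift_blin[OF T] blinD[OF T])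
  ultimately show ?thesis by (simp add: blin_space_def N.closed)
qed

text \<open>
  The derivative at a class is the lift of the derivative at a representative. The estimates that
  define differentiability and continuity of the derivative have the same constants for all
  members of a class, so representatives may be picked by choice.
\<close>

lemma C1_map_quot:
  assumes "C1_self_map F"
  shows "C1_map Q Q (qlift F)"
proof -
  interpret N: normed_space Q "vclass V null" by (rule quot_normed_space)
  obtain D where F: "F \<in> carr V \<rightarrow> carr V" and D: "\<And>x. x \<in> carr V \<Longrightarrow> frechet_at V V F x (D x)"
    and Dc: "\<And>x e. x \<in> carr V \<Longrightarrow> e > 0 \<Longrightarrow> \<exists>d>0. \<forall>y\<in>carr V. gap y x < d \<longrightarrow>
          (\<forall>h\<in>carr V. gap (D y h) (D x h) \<le> e * vnorm V h)"
    using assms unfolding C1_self_map_def by blast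
  have DB: "D x \<in> carr B" if "x \<in> carr V" for x using D[OF that] by (simp add: frechet_at_def)
  have Fc: "F x \<in> carr V" if "x \<in> carr V" for x using F that by auto
  have qF: "qlift F (vclass V x) = vclass V (F x)" if "x \<in> carr V" for x
    using qlift_vclass[OF F that] C1_self_map_respects[OF assms] by blast
  define rep where "rep A = (SOME x. x \<in> carr V \<and> vclass V x = A)" for A
  have rep: "rep A \<in> carr V" "vclass V (rep A) = A" if "A \<in> carr Q" for A
  proof -
    have "\<exists>x. x \<in> carr V \<and> vclass V x = A" using that by (auto simp: carr_quot)
    then show "rep A \<in> carr V" "vclass V (rep A) = A" unfolding rep_def by (metis (mono_tags, lifting) someI_ex)+
  qed
  define DQ where "DQ A = restrict (qlift (D (rep A))) (carr Q)" for A
  have DQ: "DQ A (vclass V h) = vclass V (D (rep A) h)" if "A \<in> carr Q" "h \<in> carr V" for A h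
    using that rep by (simp add: DQ_def qlift_blin DB vclass_closed)
  have DQB: "DQ A \<in> carr (blin_space Q Q)" if "A \<in> carr Q" for A
    unfolding DQ_def using qlift_blin_closed DB rep that by blast
  show ?thesis
    unfolding C1_map_def
  proof (intro conjI exI[of _ DQ] ballI)
    show "qlift F \<in> carr Q \<rightarrow> carr Q" by (auto simp: carr_quot qF Fc)
    show "continuous_map (vtop Q) (vtop (blin_space Q Q)) DQ"
    proof (rule N.continuous_map_into_blin[OF DQB])
      fix A and e :: real assume A: "A \<in> carr Q" and e: "e > 0"
      obtain d where d: "d > 0" "\<And>y h. \<lbrakk>y \<in> carr V; gap y (rep A) < d; h \<in> carr V\<rbrakk> \<Longrightarrow>
          gap (D y h) (D (rep A) h) \<le> e * vnorm V h"
        using Dc[OF rep(1)[OF A] e] by blast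
      show "\<exists>d>0. \<forall>C\<in>carr Q. vnorm Q (vminus Q C A) < d \<longrightarrow>
         (\<forall>H\<in>carr Q. vnorm Q (vminus Q (DQ C H) (DQ A H)) \<le> e * vnorm Q H)"
      proof (intro exI[of _ d] conjI ballI impI)
        fix C H assume C: "C \<in> carr Q" "vnorm Q (vminus Q C A) < d" and "H \<in> carr Q"
        then obtain h where h: "h \<in> carr V" "H = vclass V h" by (auto simp: carr_quot)
        have "vminus Q C A = vclass V (vminus V (rep C) (rep A))"
          using rep[OF A] rep[OF C(1)] by (simp flip: vminus_quot)
        then have "gap (rep C) (rep A) < d"
          using C rep[OF A] rep[OF C(1)] by (simp add: vnorm_quot closed)
        then have "gap (D (rep C) h) (D (rep A) h) \<le> e * vnorm V h"
          using d(2) rep C h by blast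
        then show "vnorm Q (vminus Q (DQ C H) (DQ A H)) \<le> e * vnorm Q H"
          using h A C rep by (simp add: DQ vminus_quot vnorm_quot blinD(2) DB closed)
      qed (fact d)
    qed
  next
    fix A assume A: "A \<in> carr Q"
    note r = rep[OF A]
    show "frechet_at Q Q (qlift F) A (DQ A)"
      unfolding frechet_at_def
    proof (intro conjI allI impI DQB A)
      fix e :: real assume "e > 0"
      then obtain d where d: "d > 0" "\<And>h. \<lbrakk>h \<in> carr V; vnorm V h < d\<rbrakk> \<Longrightarrow>
          gap (vminus V (F (vadd V (rep A) h)) (F (rep A))) (D (rep A) h) \<le> e * vnorm V h"
        using D[OF r(1)] unfolding frechet_at_def by blast
      show "\<exists>d>0. \<forall>H\<in>carr Q. vnorm Q H < d \<longrightarrow>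
          vnorm Q (vminus Q (vminus Q (qlift F (vadd Q A H)) (qlift F A)) (DQ A H)) \<le> e * vnorm Q H"
      proof (intro exI[of _ d] conjI ballI impI)
        fix H assume "H \<in> carr Q" "vnorm Q H < d"
        then obtain h where h: "h \<in> carr V" "H = vclass V h" "vnorm V h < d"
          by (auto simp: carr_quot vnorm_quot)
        have 1: "vadd Q A H = vclass V (vadd V (rep A) h)" using r h vadd_quot by metis
        have 2: "qlift F A = vclass V (F (rep A))" using r qF by metis
        show "vnorm Q (vminus Q (vminus Q (qlift F (vadd Q A H)) (qlift F A)) (DQ A H)) \<le> e * vnorm Q H"
          unfolding 1 2 using d(2)[OF h(1,3)] h r A
          by (simp add: DQ qF vminus_quot vnorm_quot closed Fc blinD(2)[OF DB])
      qed (fact d)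
    qed
  qed
qed

end

text \<open>
  It suffices to work with representatives: seminorms and differences of classes are computed on
  them, and each time map respects the null relation because it is differentiable.
\<close>

theorem (in seminormed_space) C1_semiflow_quot:
  assumes C1: "\<And>t. t \<ge> 0 \<Longrightarrow> C1_self_map (\<Phi> t)"
    and zero: "\<And>x. x \<in> carr V \<Longrightarrow> \<Phi> 0 x = x"
    and add: "\<And>t s x. t \<ge> 0 \<Longrightarrow> s \<ge> 0 \<Longrightarrow> x \<in> carr V \<Longrightarrow> \<Phi> (t + s) x = \<Phi> s (\<Phi> t x)"
    and cont: "\<And>t x e. t \<ge> 0 \<Longrightarrow> x \<in> carr V \<Longrightarrow> e > 0 \<Longrightarrow> \<exists>d>0. \<forall>s\<ge>0. \<forall>y\<in>carr V. \<bar>s - t\<bar> < d \<longrightarrow>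
           gap y x < d \<longrightarrow> gap (\<Phi> s y) (\<Phi> t x) < e"
  shows "C1_semiflow (quot_space V) (\<lambda>t. qlift (\<Phi> t))"
proof -
  interpret N: normed_space Q "vclass V null" by (rule quot_normed_space)
  have F: "\<Phi> t \<in> carr V \<rightarrow> carr V" and cl: "x \<in> carr V \<Longrightarrow> \<Phi> t x \<in> carr V" if "t \<ge> 0" for t x
    using C1[OF that] by (auto simp: C1_self_map_def)
  have q: "qlift (\<Phi> t) (vclass V x) = vclass V (\<Phi> t x)" if "t \<ge> 0" "x \<in> carr V" for t x
    using qlift_vclass[OF F[OF that(1)] that(2)] C1_self_map_respects[OF C1[OF that(1)]] by blast
  have "semiflow (carr Q) (\<lambda>t. qlift (\<Phi> t))"
    unfolding semiflow_def by (auto simp: carr_quot q cl zero add)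
  moreover have "continuous_map (prod_topology (top_of_set {0..}) (vtop Q)) (vtop Q) (\<lambda>(t, x). qlift (\<Phi> t) x)"
  proof (rule N.continuous_map_time_space)
    fix t :: real and A assume t: "t \<ge> 0" and "A \<in> carr Q"
    then obtain x where x: "x \<in> carr V" "A = vclass V x" by (auto simp: carr_quot)
    show "qlift (\<Phi> t) A \<in> carr Q" using t x by (simp add: q vclass_closed cl)
    fix e :: real assume e: "e > 0"
    show "\<exists>d>0. \<forall>s\<ge>0. \<forall>y\<in>carr Q. \<bar>s - t\<bar> < d \<longrightarrow> vnorm Q (vminus Q y A) < d \<longrightarrow>
        vnorm Q (vminus Q (qlift (\<Phi> s) y) (qlift (\<Phi> t) A)) < e"
      using cont[OF t x(1) e] t x by (auto simp: carr_quot q vminus_quot vnorm_quot closed cl)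
  qed
  ultimately show ?thesis
    unfolding C1_semiflow_def using C1_map_quot C1 by blast
qed


section \<open>Norms on \<open>\<real>\<^sup>N\<close>\<close>

locale Rn_norm =
  fixes \<nu> :: "real^'n \<Rightarrow> real"
  assumes is_norm: "is_norm \<nu>"
begin

lemma nu_nonneg [simp]: "0 \<le> \<nu> x"
  and nu_eq_zero [simp]: "\<nu> x = 0 \<longleftrightarrow> x = 0"
  and nu_scale: "\<nu> (c *\<^sub>R x) = \<bar>c\<bar> * \<nu> x"
  and nu_triangle: "\<nu> (x + y) \<le> \<nu> x + \<nu> y"
  using is_norm unfolding is_norm_def by blast+

lemma nu_zero [simp]: "\<nu> 0 = 0" by simp

lemma nu_minus [simp]: "\<nu> (- x) = \<nu> x"
  using nu_scale[of "-1" x] by simp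

lemma nu_diff: "\<nu> (x - y) \<le> \<nu> x + \<nu> y"
  using nu_triangle[of x "- y"] by simp

lemma nu_minus_commute: "\<nu> (x - y) = \<nu> (y - x)"
  using nu_minus[of "x - y"] by simp

lemma nu_sum: "\<nu> (\<Sum>i\<in>A. g i) \<le> (\<Sum>i\<in>A. \<nu> (g i))"
proof (induction A rule: infinite_finite_induct)
  case (insert x F)
  then show ?case using nu_triangle[of "g x" "sum g F"] by simp
qed auto

text \<open>
  The two norms are equivalent: differential calculus and matrix algebra live in the Euclidean
  norm, the seminorm of histories is built from \<open>\<nu>\<close>.
\<close>

lemma nu_le_norm: "\<exists>c>0. \<forall>x. \<nu> x \<le> c * norm x"
proof -
  let ?c = "(\<Sum>b\<in>Basis. \<nu> b) + 1"
  have "\<nu> x \<le> ?c * norm x" for x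
  proof -
    have "\<nu> x = \<nu> (\<Sum>b\<in>Basis. (x \<bullet> b) *\<^sub>R b)" by (simp add: euclidean_representation)
    also have "\<dots> \<le> (\<Sum>b\<in>Basis. \<bar>x \<bullet> b\<bar> * \<nu> b)"
      using nu_sum[of "\<lambda>b. (x \<bullet> b) *\<^sub>R b" Basis] by (simp add: nu_scale)
    also have "\<dots> \<le> (\<Sum>b\<in>Basis. norm x * \<nu> b)"
      by (intro sum_mono mult_right_mono Basis_le_norm) auto
    also have "\<dots> \<le> ?c * norm x" by (simp add: sum_distrib_left algebra_simps)
    finally show ?thesis .
  qed
  moreover have "?c > 0" using sum_nonneg[of Basis \<nu>] by (simp add: add_nonneg_pos)
  ultimately show ?thesis by blast
qed

lemma continuous_on_nu: "continuous_on UNIV \<nu>"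
proof -
  obtain c where c: "c > 0" "\<And>x. \<nu> x \<le> c * norm x" using nu_le_norm by blast
  have "\<bar>\<nu> x - \<nu> y\<bar> \<le> c * dist x y" for x y
    using nu_triangle[of "x - y" y] nu_triangle[of "y - x" x] c(2)[of "x - y"] nu_minus_commute[of x y]
    by (simp add: dist_norm)
  then have "c-lipschitz_on UNIV \<nu>" using c by (intro lipschitz_onI) (auto simp: dist_real_def)
  then show ?thesis by (rule lipschitz_on_continuous_on)
qed

lemma continuous_on_nu' [continuous_intros]:
  "continuous_on S g \<Longrightarrow> continuous_on S (\<lambda>x. \<nu> (g x))"
  using continuous_on_compose2[OF continuous_on_nu] by blast

lemma borel_measurable_nu [measurable]: "\<nu> \<in> borel_measurable borel"
  by (rule borel_measurable_continuous_onI[OF continuous_on_nu])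

lemma norm_le_nu: "\<exists>c>0. \<forall>x. norm x \<le> c * \<nu> x"
proof -
  let ?S = "sphere (0::real^'n) 1"
  \<comment> \<open>The constant is the reciprocal of the minimum of \<open>\<nu>\<close> on the Euclidean unit sphere.\<close>
  have "?S \<noteq> {}" by simp
  then obtain m where m: "m \<in> ?S" "\<And>y. y \<in> ?S \<Longrightarrow> \<nu> m \<le> \<nu> y"
    using continuous_attains_inf[OF compact_sphere _ continuous_on_subset[OF continuous_on_nu]] by blast
  have pos: "\<nu> m > 0" using m(1) nu_nonneg[of m] nu_eq_zero[of m] by (auto simp: less_le)
  have "norm x \<le> (1 / \<nu> m) * \<nu> x" for x
  proof (cases "x = 0")
    case False
    then have "\<nu> m \<le> \<nu> ((1 / norm x) *\<^sub>R x)" by (intro m) simp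
    then show ?thesis using False pos by (simp add: nu_scale field_simps)
  qed simp
  then show ?thesis using pos by (intro exI[of _ "1 / \<nu> m"]) auto
qed

end


section \<open>Two integral inequalities\<close>

text \<open>
  Convexity of the power function at the convex combination
  \<open>(u + v) / (a + b) = (a / (a + b)) * (u / a) + (b / (a + b)) * (v / b)\<close>. With
  \<open>a\<close> and \<open>b\<close> close to the norms of two functions, integration turns
  this into the Minkowski inequality.
\<close>

lemma powr_add_le_weighted:
  fixes a b u v p :: real
  assumes "a > 0" "b > 0" "u \<ge> 0" "v \<ge> 0" "p \<ge> 1"
  shows "(u + v) powr p \<le> (a + b) powr (p - 1) * (a powr (1 - p) * u powr p + b powr (1 - p) * v powr p)"
proof -
  have edge: "s powr p \<le> (c + d) powr (p - 1) * (c powr (1 - p) * s powr p)"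
    if "c > 0" "d > 0" "s \<ge> 0" for c d s :: real
  proof -
    have "1 = c powr (p - 1) * c powr (1 - p)" using that by (simp flip: powr_add)
    also have "\<dots> \<le> (c + d) powr (p - 1) * c powr (1 - p)"
      using that assms by (intro mult_right_mono powr_mono2) auto
    finally have "1 * s powr p \<le> (c + d) powr (p - 1) * c powr (1 - p) * s powr p"
      by (rule mult_right_mono) simp
    then show ?thesis by (simp add: mult.assoc)
  qed
  consider "u = 0" | "v = 0" | "u > 0" "v > 0" using assms by linarith
  then show ?thesis
  proof cases
    case 1 then show ?thesis using edge[of b a v] assms by (simp add: add.commute)
  next
    case 2 then show ?thesis using edge[of a b u] assms by simp
  next
    case 3
    have "((a / (a + b)) *\<^sub>R (u / a) + (b / (a + b)) *\<^sub>R (v / b)) powr p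
        \<le> (a / (a + b)) * (u / a) powr p + (b / (a + b)) * (v / b) powr p"
    proof -
      have "1 - b / (a + b) = a / (a + b)" using assms by (simp add: field_simps)
      then show ?thesis
        using convex_onD[OF powr_convex[OF assms(5)], of "b / (a + b)" "u / a" "v / b"] 3 assms by simp
    qed
    moreover have "(a / (a + b)) *\<^sub>R (u / a) + (b / (a + b)) *\<^sub>R (v / b) = (u + v) / (a + b)"
      using assms by (simp add: add_divide_distrib)
    ultimately have "((u + v) / (a + b)) powr p
        \<le> (a / (a + b)) * (u / a) powr p + (b / (a + b)) * (v / b) powr p" by simp
    then have "(a + b) powr p * ((u + v) / (a + b)) powr p
        \<le> (a + b) powr p * ((a / (a + b)) * (u / a) powr p + (b / (a + b)) * (v / b) powr p)"
      by (rule mult_left_mono) simp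
    also have "\<dots> = ((a + b) powr p / (a + b)) * (a * (u powr p / a powr p) + b * (v powr p / b powr p))"
    proof -
      have "S * ((a / c) * y + (b / c) * z) = (S / c) * (a * y + b * z)" for S c y z :: real
        by (simp add: distrib_left add_divide_distrib)
      then show ?thesis using 3 assms by (simp only: powr_divide less_imp_le)
    qed
    also have "\<dots> = (a + b) powr (p - 1) * (a powr (1 - p) * u powr p + b powr (1 - p) * v powr p)"
      using assms by (simp add: powr_diff)
    finally show ?thesis using assms by (simp add: powr_divide)
  qed
qed

lemma powr_add_le:
  fixes u v p :: real
  assumes "u \<ge> 0" "v \<ge> 0" "p \<ge> 1"
  shows "(u + v) powr p \<le> 2 powr (p - 1) * (u powr p + v powr p)"
  using powr_add_le_weighted[of 1 1 u v p] assms by simp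

text \<open>
  Young's inequality with exponents \<open>p / (p - 1)\<close> and \<open>p\<close>, scaled by
  weights that will be upper bounds for the norms of \<open>w\<close> and \<open>u\<close>; at
  those values the bracket integrates to at most 1.
\<close>

lemma Young_powr:
  fixes u w a b p :: real
  assumes "a > 0" "b > 0" "u \<ge> 0" "w \<ge> 0" "p > 1"
  shows "w powr (p - 1) * u \<le>
    a powr (p - 1) * b * ((1 - 1/p) * (w powr p / a powr p) + (1/p) * (u powr p / b powr p))"
proof -
  define q where "q = p / (p - 1)"
  have q: "q > 1" "1/q = 1 - 1/p" "(p - 1) * q = p" using assms by (auto simp: q_def field_simps)
  have "(w / a) powr (p - 1) * (u / b) \<le> ((w / a) powr (p - 1)) powr q / q + (u / b) powr p / p"
    using Youngs_inequality[of q p "(w / a) powr (p - 1)" "u / b"] q assms by simp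
  also have "((w / a) powr (p - 1)) powr q / q = (1 - 1/p) * (w / a) powr p"
    using q by (simp add: powr_powr) (simp add: field_simps flip: q(2))
  finally have "(w / a) powr (p - 1) * (u / b) \<le> (1 - 1/p) * (w / a) powr p + (1/p) * (u / b) powr p"
    by simp
  then have "a powr (p - 1) * b * ((w / a) powr (p - 1) * (u / b))
     \<le> a powr (p - 1) * b * ((1 - 1/p) * (w / a) powr p + (1/p) * (u / b) powr p)"
    using assms by (intro mult_left_mono) auto
  then show ?thesis using assms by (simp add: powr_divide)
qed

text \<open>
  The inequality is stated for upper bounds \<open>a\<close> and \<open>b\<close> of the two
  norms. This lets a small \<open>a\<close> be prescribed where an error term has to be small;
  \<open>b = 0\<close> is reached from positive bounds by a limit.
\<close>

lemma Holder_powr: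
  fixes u w :: "'a \<Rightarrow> real"
  assumes p: "p > 1" and m: "u \<in> borel_measurable M" "w \<in> borel_measurable M"
    and nn: "\<And>x. u x \<ge> 0" "\<And>x. w x \<ge> 0"
    and i: "integrable M (\<lambda>x. u x powr p)" "integrable M (\<lambda>x. w x powr p)"
  shows "integrable M (\<lambda>x. w x powr (p - 1) * u x)"
    and "\<lbrakk>a > 0; b \<ge> 0; (LINT x|M. w x powr p) \<le> a powr p; (LINT x|M. u x powr p) \<le> b powr p\<rbrakk> \<Longrightarrow>
      (LINT x|M. w x powr (p - 1) * u x) \<le> a powr (p - 1) * b"
proof -
  note [measurable] = m
  show int: "integrable M (\<lambda>x. w x powr (p - 1) * u x)"
  proof (rule Bochner_Integration.integrable_bound)
    show "integrable M (\<lambda>x. (1 - 1/p) * w x powr p + (1/p) * u x powr p)"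
      using i by auto
    show "AE x in M. norm (w x powr (p - 1) * u x) \<le> norm ((1 - 1/p) * w x powr p + (1/p) * u x powr p)"
    proof (rule AE_I2)
      fix x show "norm (w x powr (p - 1) * u x) \<le> norm ((1 - 1/p) * w x powr p + (1/p) * u x powr p)"
        using Young_powr[of 1 1 "u x" "w x" p] p nn by simp
    qed
  qed measurable
  assume a: "a > 0" and b: "b \<ge> 0" and le: "(LINT x|M. w x powr p) \<le> a powr p" "(LINT x|M. u x powr p) \<le> b powr p"
  have main: "(LINT x|M. w x powr (p - 1) * u x) \<le> a powr (p - 1) * c" if c: "c > b" for c
  proof -
    have "c > 0" using b c by simp
    have lc: "(LINT x|M. u x powr p) \<le> c powr p"
      using le(2) powr_mono2[of p b c] p b c by simp
    have "(LINT x|M. w x powr (p - 1) * u x) \<le>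
        (LINT x|M. a powr (p - 1) * c * ((1 - 1/p) * (w x powr p / a powr p) + (1/p) * (u x powr p / c powr p)))"
      using i p nn a \<open>c > 0\<close> by (intro integral_mono int Young_powr) auto
    also have "\<dots> = a powr (p - 1) * c * ((1 - 1/p) * ((LINT x|M. w x powr p) / a powr p)
         + (1/p) * ((LINT x|M. u x powr p) / c powr p))"
      using i by simp
    also have "\<dots> \<le> a powr (p - 1) * c * ((1 - 1/p) * 1 + (1/p) * 1)"
      using a p \<open>c > 0\<close> le(1) lc by (intro mult_left_mono add_mono) (auto simp: divide_le_eq_1)
    also have "\<dots> = a powr (p - 1) * c" by simp
    finally show ?thesis .
  qed
  show "(LINT x|M. w x powr (p - 1) * u x) \<le> a powr (p - 1) * b"
  proof (rule field_le_epsilon)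
    fix e :: real assume e: "e > 0"
    have "a powr (p - 1) * (b + e / a powr (p - 1)) = a powr (p - 1) * b + e"
      using a by (simp add: distrib_left)
    then show "(LINT x|M. w x powr (p - 1) * u x) \<le> a powr (p - 1) * b + e"
      using main[of "b + e / a powr (p - 1)"] a e by simp
  qed
qed


section \<open>The seminormed space of histories\<close>

locale history_space = Rn_norm \<nu> for \<nu> :: "real^'n \<Rightarrow> real" +
  fixes p R :: real
  assumes p_ge_1: "p \<ge> 1" and R_pos: "R > 0"
begin

abbreviation "I \<equiv> {-R..0}"
abbreviation "L \<equiv> lebesgue_on {-R..0}"
abbreviation "X \<equiv> Lbar \<nu> p R"

text \<open>
  The \<open>p\<close>-th power of the seminorm, which is the additive quantity behind it.
\<close>

definition pmoment :: "(real \<Rightarrow> real^'n) \<Rightarrow> real" where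
  "pmoment \<phi> = (LINT \<theta>|L. \<nu> (\<phi> \<theta>) powr p) + \<nu> (\<phi> 0) powr p"

lemma p_pos: "p > 0" using p_ge_1 by simp

lemma vnorm_X: "vnorm X \<phi> = pmoment \<phi> powr (1 / p)"
  by (simp add: Lbar_def pmoment_def)

lemma pmoment_nonneg: "pmoment \<phi> \<ge> 0"
  by (simp add: pmoment_def)

lemma pmoment_eq: "pmoment \<phi> = vnorm X \<phi> powr p"
  using p_pos by (simp add: vnorm_X powr_powr pmoment_nonneg)

lemma vnorm_nonneg: "vnorm X \<phi> \<ge> 0" by (simp add: vnorm_X)

lemma vnorm_le_iff:
  assumes "a \<ge> 0" shows "vnorm X \<phi> \<le> a \<longleftrightarrow> pmoment \<phi> \<le> a powr p"
proof
  show "pmoment \<phi> \<le> a powr p" if "vnorm X \<phi> \<le> a"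
    using that p_pos by (simp add: pmoment_eq powr_mono2 vnorm_nonneg)
  show "vnorm X \<phi> \<le> a" if "pmoment \<phi> \<le> a powr p"
  proof -
    have "pmoment \<phi> powr (1/p) \<le> (a powr p) powr (1/p)"
      using that p_pos by (intro powr_mono2) (auto simp: pmoment_nonneg)
    then show ?thesis using assms p_pos by (simp add: vnorm_X powr_powr)
  qed
qed

lemma carr_X: "\<phi> \<in> carr X \<longleftrightarrow> \<phi> \<in> extensional I \<and> \<phi> \<in> borel_measurable L \<and>
    integrable L (\<lambda>\<theta>. \<nu> (\<phi> \<theta>) powr p)"
  by (auto simp: Lbar_def PiE_def)

lemma carr_XD:
  assumes "\<phi> \<in> carr X"
  shows "\<phi> \<in> extensional I" "\<phi> \<in> borel_measurable L" "integrable L (\<lambda>\<theta>. \<nu> (\<phi> \<theta>) powr p)"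
  using assms by (auto simp: carr_X)

lemma vadd_X: "vadd X \<phi> \<psi> = (\<lambda>\<theta>\<in>I. \<phi> \<theta> + \<psi> \<theta>)"
  and vscale_X: "vscale X c \<phi> = (\<lambda>\<theta>\<in>I. c *\<^sub>R \<phi> \<theta>)"
  by (simp_all add: Lbar_def)

lemma vminus_X: "vminus X \<phi> \<psi> = (\<lambda>\<theta>\<in>I. \<phi> \<theta> - \<psi> \<theta>)"
  by (auto simp: vminus_def vadd_X vscale_X fun_eq_iff)

lemma borel_measurable_L_restrict:
  assumes "\<phi> \<in> borel_measurable L" shows "(\<lambda>\<theta>\<in>I. \<phi> \<theta>) \<in> borel_measurable L"
  using assms by (subst measurable_cong[where g = \<phi>]) auto

lemma integral_L_cong: "(\<And>\<theta>. \<theta> \<in> I \<Longrightarrow> g \<theta> = h \<theta>) \<Longrightarrow> (LINT \<theta>|L. g \<theta>) = (LINT \<theta>|L. h \<theta>)"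
  by (rule Bochner_Integration.integral_cong) auto

lemma integrable_L_cong: "(\<And>\<theta>. \<theta> \<in> I \<Longrightarrow> g \<theta> = h \<theta>) \<Longrightarrow> integrable L g = integrable L h"
  by (rule Bochner_Integration.integrable_cong) auto

lemma zero_in_I [simp]: "0 \<in> I" using R_pos by simp

lemma finite_measure_L: "finite_measure L"
  by (rule finite_measure_lebesgue_on) simp

lemma measure_L: "measure L I = R"
  using R_pos by (simp add: measure_restrict_space)

lemma integrable_L_const: "integrable L (\<lambda>_. c :: real)"
  by (rule finite_measure.integrable_const[OF finite_measure_L])

lemma integrable_bounded_L:
  fixes g :: "real \<Rightarrow> 'b::euclidean_space"
  assumes "g \<in> borel_measurable L" "\<And>\<theta>. \<theta> \<in> I \<Longrightarrow> norm (g \<theta>) \<le> b"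
  shows "integrable L g"
  by (rule finite_measure.integrable_const_bound[OF finite_measure_L _ assms(1)])
     (rule AE_I2, use assms(2) in auto)

lemma restrict_carr_X:
  assumes "g \<in> borel_measurable L" "integrable L (\<lambda>\<theta>. \<nu> (g \<theta>) powr p)"
  shows "(\<lambda>\<theta>\<in>I. g \<theta>) \<in> carr X"
proof -
  have "integrable L (\<lambda>\<theta>. \<nu> ((\<lambda>\<theta>\<in>I. g \<theta>) \<theta>) powr p)"
    by (rule integrable_L_cong[THEN iffD1, OF _ assms(2)]) simp
  then show ?thesis using assms(1) by (simp add: carr_X borel_measurable_L_restrict del: restrict_apply)
qed

lemma add_carr_X:
  assumes "\<phi> \<in> carr X" "\<psi> \<in> carr X" shows "vadd X \<phi> \<psi> \<in> carr X"
proof -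
  note [measurable] = carr_XD(2)[OF assms(1)] carr_XD(2)[OF assms(2)]
  have "integrable L (\<lambda>\<theta>. \<nu> (\<phi> \<theta> + \<psi> \<theta>) powr p)"
  proof (rule Bochner_Integration.integrable_bound)
    show "integrable L (\<lambda>\<theta>. 2 powr (p - 1) * (\<nu> (\<phi> \<theta>) powr p + \<nu> (\<psi> \<theta>) powr p))"
      using carr_XD(3)[OF assms(1)] carr_XD(3)[OF assms(2)] by auto
    show "AE \<theta> in L. norm (\<nu> (\<phi> \<theta> + \<psi> \<theta>) powr p)
        \<le> norm (2 powr (p - 1) * (\<nu> (\<phi> \<theta>) powr p + \<nu> (\<psi> \<theta>) powr p))"
    proof (rule AE_I2)
      fix \<theta>
      have "\<nu> (\<phi> \<theta> + \<psi> \<theta>) powr p \<le> (\<nu> (\<phi> \<theta>) + \<nu> (\<psi> \<theta>)) powr p"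
        using p_pos by (intro powr_mono2) (auto simp: nu_triangle)
      also have "\<dots> \<le> 2 powr (p - 1) * (\<nu> (\<phi> \<theta>) powr p + \<nu> (\<psi> \<theta>) powr p)"
        using p_ge_1 by (intro powr_add_le) auto
      finally show "norm (\<nu> (\<phi> \<theta> + \<psi> \<theta>) powr p)
        \<le> norm (2 powr (p - 1) * (\<nu> (\<phi> \<theta>) powr p + \<nu> (\<psi> \<theta>) powr p))" by simp
    qed
  qed measurable
  then show ?thesis unfolding vadd_X by (rule restrict_carr_X[rotated]) measurable
qed

lemma scale_carr_X:
  assumes "\<phi> \<in> carr X" shows "vscale X c \<phi> \<in> carr X"
proof -
  note [measurable] = carr_XD(2)[OF assms(1)]
  have "integrable L (\<lambda>\<theta>. \<nu> (c *\<^sub>R \<phi> \<theta>) powr p)"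
    using carr_XD(3)[OF assms] by (simp add: nu_scale powr_mult)
  then show ?thesis unfolding vscale_X by (rule restrict_carr_X[rotated]) measurable
qed

lemma pmoment_scale: "pmoment (vscale X c \<phi>) = \<bar>c\<bar> powr p * pmoment \<phi>"
proof -
  have "(LINT \<theta>|L. \<nu> (vscale X c \<phi> \<theta>) powr p) = (LINT \<theta>|L. \<bar>c\<bar> powr p * \<nu> (\<phi> \<theta>) powr p)"
    by (rule integral_L_cong) (auto simp: vscale_X nu_scale powr_mult)
  then show ?thesis
    using R_pos by (simp add: pmoment_def vscale_X nu_scale powr_mult ring_distribs)
qed

lemma pmoment_add:
  assumes "\<phi> \<in> carr X" "\<psi> \<in> carr X" "a > 0" "b > 0"
  shows "pmoment (vadd X \<phi> \<psi>)
    \<le> (a + b) powr (p - 1) * (a powr (1 - p) * pmoment \<phi> + b powr (1 - p) * pmoment \<psi>)"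
proof -
  have pt: "\<nu> (vadd X \<phi> \<psi> \<theta>) powr p
      \<le> (a + b) powr (p - 1) * (a powr (1 - p) * \<nu> (\<phi> \<theta>) powr p + b powr (1 - p) * \<nu> (\<psi> \<theta>) powr p)"
    if "\<theta> \<in> I" for \<theta>
  proof -
    have "\<nu> (\<phi> \<theta> + \<psi> \<theta>) powr p \<le> (\<nu> (\<phi> \<theta>) + \<nu> (\<psi> \<theta>)) powr p"
      using p_pos by (intro powr_mono2) (auto simp: nu_triangle)
    also have "\<dots> \<le> (a + b) powr (p - 1) * (a powr (1 - p) * \<nu> (\<phi> \<theta>) powr p + b powr (1 - p) * \<nu> (\<psi> \<theta>) powr p)"
      using p_ge_1 assms by (intro powr_add_le_weighted) auto
    finally show ?thesis using that by (simp add: vadd_X)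
  qed
  have "(LINT \<theta>|L. \<nu> (vadd X \<phi> \<psi> \<theta>) powr p)
      \<le> (LINT \<theta>|L. (a + b) powr (p - 1) * (a powr (1 - p) * \<nu> (\<phi> \<theta>) powr p + b powr (1 - p) * \<nu> (\<psi> \<theta>) powr p))"
    using assms carr_XD(3)[OF assms(1)] carr_XD(3)[OF assms(2)] carr_XD(3)[OF add_carr_X[OF assms(1,2)]]
    by (intro integral_mono) (auto intro: pt)
  also have "\<dots> = (a + b) powr (p - 1) * (a powr (1 - p) * (LINT \<theta>|L. \<nu> (\<phi> \<theta>) powr p)
        + b powr (1 - p) * (LINT \<theta>|L. \<nu> (\<psi> \<theta>) powr p))"
    using carr_XD(3)[OF assms(1)] carr_XD(3)[OF assms(2)] by simp
  finally show ?thesis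
    using pt[of 0] R_pos by (simp add: pmoment_def ring_distribs)
qed

text \<open>
  The Minkowski inequality from \<open>pmoment_add\<close>, whose weights are taken slightly
  larger than the two seminorms to keep them positive.
\<close>

lemma vnorm_triangle:
  assumes "\<phi> \<in> carr X" "\<psi> \<in> carr X"
  shows "vnorm X (vadd X \<phi> \<psi>) \<le> vnorm X \<phi> + vnorm X \<psi>"
proof (rule field_le_epsilon)
  fix e :: real assume e: "e > 0"
  define a where "a = vnorm X \<phi> + e / 2"
  define b where "b = vnorm X \<psi> + e / 2"
  have ab: "a > 0" "b > 0" using e vnorm_nonneg[of \<phi>] vnorm_nonneg[of \<psi>] by (auto simp: a_def b_def)
  have le: "pmoment \<phi> \<le> a powr p" "pmoment \<psi> \<le> b powr p"
    using vnorm_le_iff[of a \<phi>] vnorm_le_iff[of b \<psi>] ab e by (auto simp: a_def b_def)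
  have "pmoment (vadd X \<phi> \<psi>)
      \<le> (a + b) powr (p - 1) * (a powr (1 - p) * a powr p + b powr (1 - p) * b powr p)"
    by (rule order_trans[OF pmoment_add[OF assms ab]])
       (intro mult_left_mono add_mono le; simp)
  also have "\<dots> = (a + b) powr (p - 1) * (a + b)"
    using ab by (simp flip: powr_add)
  also have "\<dots> = (a + b) powr p" using ab by (simp add: powr_diff)
  finally have "vnorm X (vadd X \<phi> \<psi>) \<le> a + b" using ab by (subst vnorm_le_iff) auto
  then show "vnorm X (vadd X \<phi> \<psi>) \<le> vnorm X \<phi> + vnorm X \<psi> + e" by (simp add: a_def b_def)
qed

sublocale X: seminormed_space "Lbar \<nu> p R" "\<lambda>\<theta>\<in>{-R..0}. 0"
proof unfold_locales
  show "(\<lambda>\<theta>\<in>I. 0) \<in> carr X"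
    by (rule restrict_carr_X) auto
  show "vnorm X (vscale X c \<phi>) = \<bar>c\<bar> * vnorm X \<phi>" for c \<phi>
    using p_pos by (simp add: vnorm_X pmoment_scale powr_mult powr_powr pmoment_nonneg)
  have ext: "\<phi> = \<psi>" if "\<phi> \<in> extensional I" "\<psi> \<in> extensional I" "\<And>\<theta>. \<theta> \<in> I \<Longrightarrow> \<phi> \<theta> = \<psi> \<theta>"
    for \<phi> \<psi> :: "real \<Rightarrow> real^'n" using that by (auto intro: extensionalityI)
  show "vadd X \<phi> (\<lambda>\<theta>\<in>I. 0) = \<phi>" if "\<phi> \<in> carr X" for \<phi>
    by (rule ext) (use that in \<open>auto simp: vadd_X carr_X\<close>)
  show "vscale X 1 \<phi> = \<phi>" if "\<phi> \<in> carr X" for \<phi>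
    by (rule ext) (use that in \<open>auto simp: vscale_X carr_X\<close>)
  show "vnorm X (vadd X \<phi> \<psi>) \<le> vnorm X \<phi> + vnorm X \<psi>" if "\<phi> \<in> carr X" "\<psi> \<in> carr X" for \<phi> \<psi>
    using that by (rule vnorm_triangle)
qed ((simp add: add_carr_X scale_carr_X vnorm_nonneg; fail) |
     (auto simp: vadd_X vscale_X fun_eq_iff algebra_simps))+

lemma integral_le_vnorm:
  assumes "\<phi> \<in> carr X"
  shows "(LINT \<theta>|L. \<nu> (\<phi> \<theta>) powr p) \<le> vnorm X \<phi> powr p"
  by (simp add: pmoment_def flip: pmoment_eq)

text \<open>
  The interval has length \<open>R\<close> and the end point has mass 1, hence the factor
  \<open>R + 1\<close>.
\<close>

lemma vnorm_bounded:
  assumes "\<phi> \<in> borel_measurable L" "b \<ge> 0" "\<And>\<theta>. \<theta> \<in> I \<Longrightarrow> \<nu> (\<phi> \<theta>) \<le> b"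
  shows "integrable L (\<lambda>\<theta>. \<nu> (\<phi> \<theta>) powr p)"
    and "vnorm X \<phi> \<le> (R + 1) powr (1/p) * b"
proof -
  note [measurable] = assms(1)
  have le: "\<nu> (\<phi> \<theta>) powr p \<le> b powr p" if "\<theta> \<in> I" for \<theta>
    using assms(3)[OF that] p_pos by (intro powr_mono2) auto
  show int: "integrable L (\<lambda>\<theta>. \<nu> (\<phi> \<theta>) powr p)"
    by (rule integrable_bounded_L[where b = "b powr p"]) (use le in auto)
  have "(LINT \<theta>|L. \<nu> (\<phi> \<theta>) powr p) \<le> (LINT \<theta>|L. b powr p)"
    by (intro integral_mono int integrable_L_const) (use le in auto)
  then have "pmoment \<phi> \<le> (R + 1) * b powr p"
    using le[of 0] R_pos by (simp add: pmoment_def measure_L ring_distribs)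
  also have "\<dots> = ((R + 1) powr (1/p) * b) powr p"
    using R_pos assms p_pos by (simp add: powr_mult powr_powr)
  finally show "vnorm X \<phi> \<le> (R + 1) powr (1/p) * b" using assms(2) by (subst vnorm_le_iff) auto
qed

text \<open>
  Dominated convergence as the truncation level goes to infinity.
\<close>

lemma tail_integral_small:
  assumes "\<phi> \<in> carr X" "e > 0"
  shows "\<exists>M\<ge>1. (LINT \<theta>|L. (if \<nu> (\<phi> \<theta>) > M then \<nu> (\<phi> \<theta>) else 0) powr p) \<le> e"
proof -
  note [measurable] = carr_XD(2)[OF assms(1)]
  let ?g = "\<lambda>n \<theta>. (if \<nu> (\<phi> \<theta>) > real (Suc n) then \<nu> (\<phi> \<theta>) else 0) powr p"
  have "(\<lambda>n. LINT \<theta>|L. ?g n \<theta>) \<longlonglongrightarrow> (LINT \<theta>|L. 0)"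
  proof (rule integral_dominated_convergence[where w = "\<lambda>\<theta>. \<nu> (\<phi> \<theta>) powr p"])
    show "integrable L (\<lambda>\<theta>. \<nu> (\<phi> \<theta>) powr p)" by (rule carr_XD(3)[OF assms(1)])
    show "AE \<theta> in L. (\<lambda>n. ?g n \<theta>) \<longlonglongrightarrow> 0"
    proof (rule AE_I2)
      fix \<theta>
      obtain N :: nat where N: "\<nu> (\<phi> \<theta>) < real N" using reals_Archimedean2 by blast
      have "eventually (\<lambda>n. ?g n \<theta> = 0) sequentially"
        using eventually_ge_at_top[of N] by eventually_elim (use N p_pos in auto)
      then show "(\<lambda>n. ?g n \<theta>) \<longlonglongrightarrow> 0" by (rule tendsto_eventually)
    qed
  qed (auto simp: p_pos)
  then have "eventually (\<lambda>n. (LINT \<theta>|L. ?g n \<theta>) < e) sequentially"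
    using assms(2) by (intro order_tendstoD) auto
  then obtain n where "(LINT \<theta>|L. ?g n \<theta>) < e" by (auto simp: eventually_sequentially)
  then show ?thesis by (intro exI[of _ "real (Suc n)"]) auto
qed

end


section \<open>The superposition operator from \<open>L\<^sup>p\<close> to \<open>L\<^sup>1\<close>\<close>

lemma bounded_bilinear_matrix_vector:
  "bounded_bilinear ((*v) :: real^'n^'m \<Rightarrow> real^'n \<Rightarrow> real^'m)"
  unfolding bilinear_conv_bounded_bilinear[symmetric] bilinear_def
  by (auto intro!: linearI simp: matrix_vector_mult_add_rdistrib matrix_vector_right_distrib
      matrix_vector_mult_scaleR simp flip: scaleR_matrix_vector_assoc)

locale C1_growth = history_space \<nu> p R for \<nu> :: "real^'n \<Rightarrow> real" and p R :: real +
  fixes f :: "real^'n \<Rightarrow> real^'n" and \<alpha> :: real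
  assumes C1: "C1_vec f"
    and alpha: "\<alpha> \<ge> 1" "\<alpha> + 1 \<le> p"
    and growth: "\<exists>C>0. \<exists>K>0. \<forall>x. \<nu> x \<ge> K \<longrightarrow>
        matrix_opnorm \<nu> (jacobian f (at x)) \<le> C * \<nu> x powr \<alpha>"
begin

abbreviation J :: "real^'n \<Rightarrow> real^'n^'n" where "J x \<equiv> jacobian f (at x)"

lemma p_gt_1: "p > 1" using alpha by simp

lemma f_has_derivative: "(f has_derivative (\<lambda>h. J x *v h)) (at x within S)"
proof -
  have "f differentiable (at x)" using C1 unfolding C1_vec_def by blast
  then show ?thesis unfolding jacobian_works by (rule has_derivative_at_withinI)
qed

lemma continuous_J: "continuous_on UNIV J"
  using C1 unfolding C1_vec_def by blast

lemma continuous_f: "continuous_on UNIV f"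
  unfolding continuous_on_eq_continuous_within
  by (intro ballI has_derivative_continuous[OF f_has_derivative])

lemma borel_measurable_J [measurable]: "J \<in> borel_measurable borel"
  by (rule borel_measurable_continuous_onI[OF continuous_J])

lemma borel_measurable_f [measurable]: "f \<in> borel_measurable borel"
  by (rule borel_measurable_continuous_onI[OF continuous_f])

lemma borel_measurable_matrix_vector [measurable (raw)]:
  fixes A :: "'a \<Rightarrow> real^'n^'n" and h :: "'a \<Rightarrow> real^'n"
  assumes [measurable]: "A \<in> borel_measurable M" "h \<in> borel_measurable M"
  shows "(\<lambda>x. A x *v h x) \<in> borel_measurable M"
proof -
  have "continuous_on UNIV (\<lambda>x :: (real^'n^'n) \<times> (real^'n). fst x *v snd x)"
    by (intro bounded_bilinear.continuous_on[OF bounded_bilinear_matrix_vector] continuous_intros)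
  from borel_measurable_continuous_Pair[OF assms this] show ?thesis by simp
qed

text \<open>
  The supremum in \<open>matrix_opnorm\<close> is finite by equivalence of norms; rescaling to
  the unit ball does the rest.
\<close>

lemma nu_matrix_le: "\<nu> (A *v h) \<le> matrix_opnorm \<nu> A * \<nu> h"
proof -
  obtain c where c: "c > 0" "\<And>x. \<nu> x \<le> c * norm x" using nu_le_norm by blast
  obtain c' where c': "c' > 0" "\<And>x. norm x \<le> c' * \<nu> x" using norm_le_nu by blast
  obtain m where m: "m > 0" "\<And>x. norm (A *v x) \<le> norm x * m"
    using bounded_linear.pos_bounded[OF matrix_vector_mul_bounded_linear[of A]] by blast
  have bdd: "bdd_above ((\<lambda>x. \<nu> (A *v x)) ` {x. \<nu> x \<le> 1})"
  proof (rule bdd_aboveI2)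
    fix x assume "x \<in> {x. \<nu> x \<le> 1}"
    then have "c' * \<nu> x \<le> c' * 1" using c'(1) by (intro mult_left_mono) auto
    then have "norm x \<le> c'" using c'(2)[of x] by linarith
    then have "norm (A *v x) \<le> c' * m" using m(2)[of x] m(1) by (meson less_imp_le mult_right_mono order_trans)
    then show "\<nu> (A *v x) \<le> c * (c' * m)" using c(2)[of "A *v x"] c(1) by (meson less_imp_le mult_left_mono order_trans)
  qed
  show ?thesis
  proof (cases "h = 0")
    case False
    then have pos: "\<nu> h > 0" using nu_nonneg[of h] nu_eq_zero[of h] by (auto simp: less_le)
    have "\<nu> (A *v ((1 / \<nu> h) *\<^sub>R h)) \<le> matrix_opnorm \<nu> A"
      unfolding matrix_opnorm_def using pos by (intro cSUP_upper[OF _ bdd]) (simp add: nu_scale)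
    then show ?thesis using pos by (simp add: matrix_vector_mult_scaleR nu_scale field_simps)
  qed simp
qed

lemma matrix_vector_nu_bound: "\<exists>m>0. \<forall>A :: real^'n^'n. \<forall>h. norm (A *v h) \<le> m * norm A * \<nu> h"
proof -
  obtain c' where c': "c' > 0" "\<And>x. norm x \<le> c' * \<nu> x" using norm_le_nu by blast
  obtain m where m: "m > 0" "\<And>(A :: real^'n^'n) h. norm (A *v h) \<le> norm A * norm h * m"
    using bounded_bilinear.pos_bounded[OF bounded_bilinear_matrix_vector] by blast
  have "norm (A *v h) \<le> (m * c') * norm A * \<nu> h" for A :: "real^'n^'n" and h
  proof -
    have "norm A * m * norm h \<le> norm A * m * (c' * \<nu> h)"
      using m by (intro mult_left_mono c') simp
    then show ?thesis using m(2)[of A h] by (simp add: mult_ac)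
  qed
  then show ?thesis using m c' by (intro exI[of _ "m * c'"]) auto
qed

lemma compact_nu_ball: "compact {x. \<nu> x \<le> M}"
proof -
  obtain c' where c': "c' > 0" "\<And>x. norm x \<le> c' * \<nu> x" using norm_le_nu by blast
  have "norm x \<le> c' * M" if "\<nu> x \<le> M" for x
    using c'(2)[of x] c'(1) that by (meson less_imp_le mult_left_mono order_trans)
  then have "bounded {x. \<nu> x \<le> M}" by (auto simp: bounded_iff)
  moreover have "closed {x. \<nu> x \<le> M}"
    by (intro closed_Collect_le continuous_on_nu continuous_intros)
  ultimately show ?thesis by (simp add: compact_eq_bounded_closed)
qed

text \<open>
  For large \<open>x\<close> the growth hypothesis applies, with
  \<open>\<alpha> \<le> p - 1\<close>; on the remaining compact ball the continuous Jacobian is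
  bounded.
\<close>

lemma jacobian_growth: "\<exists>C>0. \<forall>x h. norm (J x *v h) \<le> C * (1 + \<nu> x powr (p - 1)) * \<nu> h"
proof -
  obtain C K where CK: "C > 0" "K > 0" "\<And>x. \<nu> x \<ge> K \<Longrightarrow> matrix_opnorm \<nu> (J x) \<le> C * \<nu> x powr \<alpha>"
    using growth by blast
  obtain c where c: "c > 0" "\<And>x. norm x \<le> c * \<nu> x" using norm_le_nu by blast
  obtain m where m: "m > 0" "\<And>(A :: real^'n^'n) h. norm (A *v h) \<le> m * norm A * \<nu> h"
    using matrix_vector_nu_bound by blast
  have "compact (J ` {x. \<nu> x \<le> K})"
    by (rule compact_continuous_image[OF continuous_on_subset[OF continuous_J] compact_nu_ball]) simp
  then obtain B where B: "B > 0" "\<And>x. \<nu> x \<le> K \<Longrightarrow> norm (J x) \<le> B"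
    using compact_imp_bounded bounded_pos by (metis (mono_tags, lifting) imageI mem_Collect_eq)
  show ?thesis
  proof (intro exI[of _ "m * B + c * C"] conjI allI)
    show "m * B + c * C > 0" using m B c CK by (simp add: add_pos_pos)
    fix x h
    have "\<exists>D\<in>{m * B, c * C}. norm (J x *v h) \<le> D * (1 + \<nu> x powr (p - 1)) * \<nu> h"
    proof (cases "\<nu> x \<le> K")
      case True
      have "norm (J x *v h) \<le> m * norm (J x) * \<nu> h" by (rule m)
      also have "\<dots> \<le> (m * B) * (1 + \<nu> x powr (p - 1)) * \<nu> h"
      proof (rule mult_right_mono)
        have "m * norm (J x) \<le> m * B * 1" using B(2)[OF True] m by simp
        also have "\<dots> \<le> m * B * (1 + \<nu> x powr (p - 1))" using m B by (intro mult_left_mono) auto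
        finally show "m * norm (J x) \<le> m * B * (1 + \<nu> x powr (p - 1))" .
      qed simp
      finally show ?thesis by blast
    next
      case False
      have "\<nu> x powr \<alpha> \<le> 1 + \<nu> x powr (p - 1)"
      proof (cases "\<nu> x \<ge> 1")
        case True
        then show ?thesis using powr_mono[of \<alpha> "p - 1" "\<nu> x"] alpha by simp
      next
        case False
        then show ?thesis using powr_le1[of \<alpha> "\<nu> x"] alpha by (simp add: add_increasing2)
      qed
      then have D: "C * \<nu> x powr \<alpha> \<le> C * (1 + \<nu> x powr (p - 1))" using CK by simp
      have "norm (J x *v h) \<le> c * \<nu> (J x *v h)" by (rule c)
      also have "\<dots> \<le> c * (C * (1 + \<nu> x powr (p - 1)) * \<nu> h)"
      proof (rule mult_left_mono)
        have "\<nu> (J x *v h) \<le> matrix_opnorm \<nu> (J x) * \<nu> h" by (rule nu_matrix_le)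
        also have "\<dots> \<le> C * (1 + \<nu> x powr (p - 1)) * \<nu> h"
          using CK(3)[of x] False D by (intro mult_right_mono) auto
        finally show "\<nu> (J x *v h) \<le> C * (1 + \<nu> x powr (p - 1)) * \<nu> h" .
      qed (use c in simp)
      finally show ?thesis by (simp add: mult.assoc)
    qed
    then obtain D where D: "D \<in> {m * B, c * C}" "norm (J x *v h) \<le> D * ((1 + \<nu> x powr (p - 1)) * \<nu> h)"
      unfolding mult.assoc by blast
    have "D \<le> m * B + c * C" using D m B c CK by auto
    then have "D * ((1 + \<nu> x powr (p - 1)) * \<nu> h) \<le> (m * B + c * C) * ((1 + \<nu> x powr (p - 1)) * \<nu> h)"
      by (rule mult_right_mono) simp
    then show "norm (J x *v h) \<le> (m * B + c * C) * (1 + \<nu> x powr (p - 1)) * \<nu> h"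
      using D(2) by (simp add: mult.assoc)
  qed
qed

text \<open>
  A bound for the increment of the Jacobian from \<open>a\<close> to \<open>a + k\<close>. After
  integration against a history \<open>h\<close>, the third term is small for large
  \<open>M\<close>, the first for small \<open>e\<close>, and the second for small
  \<open>k\<close>, in this order of choice.
\<close>

definition weight :: "real \<Rightarrow> real \<Rightarrow> real \<Rightarrow> real \<Rightarrow> real^'n \<Rightarrow> real^'n \<Rightarrow> real" where
  "weight C M K e a k = e + K * \<nu> k powr (p - 1) + C * (if \<nu> a > M then \<nu> a else 0) powr (p - 1)"

text \<open>
  The decisive point is that \<open>C\<close> is fixed before \<open>M\<close> and
  \<open>e\<close>. If \<open>\<nu> a \<le> M\<close> and \<open>k\<close> is small, uniform
  continuity of the Jacobian on a compact ball gives the bound \<open>e\<close>. If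
  \<open>\<nu> a \<le> M\<close> and \<open>\<nu> k \<ge> \<eta>\<close>, every constant is at
  most a multiple, depending on \<open>M\<close> and \<open>\<eta>\<close>, of
  \<open>\<nu> k powr (p - 1)\<close>. If \<open>\<nu> a > M\<close>, the growth bound is used as
  it stands; there \<open>M \<ge> 1\<close> absorbs its additive constant into
  \<open>\<nu> a powr (p - 1)\<close>.
\<close>

lemma jacobian_increment:
  "\<exists>C>0. \<forall>M\<ge>1. \<forall>e>0. \<exists>K\<ge>0. \<forall>a k h. norm (J (a + k) *v h - J a *v h) \<le> weight C M K e a k * \<nu> h"
proof -
  obtain C where C: "C > 0" "\<And>x h. norm (J x *v h) \<le> C * (1 + \<nu> x powr (p - 1)) * \<nu> h"
    using jacobian_growth by blast
  obtain m where m: "m > 0" "\<And>(A :: real^'n^'n) h. norm (A *v h) \<le> m * norm A * \<nu> h"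
    using matrix_vector_nu_bound by blast
  obtain c where c: "c > 0" "\<And>x. norm x \<le> c * \<nu> x" using norm_le_nu by blast
  define P where "P = (2::real) powr (p - 1)"
  have P: "P \<ge> 1" unfolding P_def using p_gt_1 by (simp add: ge_one_powr_ge_zero)
  define C' where "C' = C * (P + 3)"
  have C': "C' > 0" using C P by (simp add: C'_def)
  have crude: "norm (J (a + k) *v h - J a *v h) \<le> C * (2 + (P + 1) * \<nu> a powr (p - 1) + P * \<nu> k powr (p - 1)) * \<nu> h"
    for a k h
  proof -
    have "\<nu> (a + k) powr (p - 1) \<le> (2 * max (\<nu> a) (\<nu> k)) powr (p - 1)"
      using nu_triangle[of a k] p_gt_1 by (intro powr_mono2) auto
    also have "\<dots> = P * max (\<nu> a) (\<nu> k) powr (p - 1)" by (simp add: powr_mult P_def)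
    also have "\<dots> \<le> P * (\<nu> a powr (p - 1) + \<nu> k powr (p - 1))"
      using P by (intro mult_left_mono) (auto simp: max_def)
    finally have 1: "\<nu> (a + k) powr (p - 1) \<le> P * (\<nu> a powr (p - 1) + \<nu> k powr (p - 1))" .
    have "norm (J (a + k) *v h - J a *v h) \<le> C * (1 + \<nu> (a + k) powr (p - 1)) * \<nu> h + C * (1 + \<nu> a powr (p - 1)) * \<nu> h"
      using norm_triangle_ineq4[of "J (a + k) *v h" "J a *v h"] C(2)[of "a + k" h] C(2)[of a h] by linarith
    also have "\<dots> = C * (2 + \<nu> (a + k) powr (p - 1) + \<nu> a powr (p - 1)) * \<nu> h" by (simp add: algebra_simps)
    also have "\<dots> \<le> C * (2 + (P + 1) * \<nu> a powr (p - 1) + P * \<nu> k powr (p - 1)) * \<nu> h"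
      using 1 C by (intro mult_right_mono mult_left_mono) (auto simp: algebra_simps)
    finally show ?thesis .
  qed
  show ?thesis
  proof (rule exI[of _ C'], intro conjI allI impI C')
    fix M e :: real assume M: "M \<ge> 1" and e: "e > 0"
    have "uniformly_continuous_on {x. \<nu> x \<le> M + 1} J"
      by (rule compact_uniformly_continuous[OF continuous_on_subset[OF continuous_J] compact_nu_ball]) simp
    then obtain d where d: "d > 0" "\<And>x y. \<lbrakk>\<nu> x \<le> M + 1; \<nu> y \<le> M + 1; dist y x < d\<rbrakk> \<Longrightarrow> dist (J y) (J x) < e / m"
      unfolding uniformly_continuous_on_def using divide_pos_pos[OF e m(1)] by (metis (mono_tags, lifting) mem_Collect_eq)
    define \<eta> where "\<eta> = min 1 (d / c)"
    have eta: "\<eta> > 0" "\<eta> \<le> 1" using d c by (auto simp: \<eta>_def)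
    define S where "S = 2 + (P + 1) * M powr (p - 1)"
    have S: "S \<ge> 0" using P by (simp add: S_def)
    define K where "K = C' + C * (S / \<eta> powr (p - 1) + P)"
    have K: "K \<ge> C'" "K \<ge> C * (S / \<eta> powr (p - 1) + P)" "K \<ge> 0"
      using C C' P S eta by (auto simp: K_def)
    show "\<exists>K\<ge>0. \<forall>a k h. norm (J (a + k) *v h - J a *v h) \<le> weight C' M K e a k * \<nu> h"
    proof (intro exI[of _ K] conjI allI K)
      fix a k h :: "real^'n"
      let ?T = "2 + (P + 1) * \<nu> a powr (p - 1) + P * \<nu> k powr (p - 1)"
      consider (small) "\<nu> a \<le> M" "\<nu> k < \<eta>" | (far) "\<nu> a \<le> M" "\<nu> k \<ge> \<eta>" | (large) "\<nu> a > M" by linarith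
      then show "norm (J (a + k) *v h - J a *v h) \<le> weight C' M K e a k * \<nu> h"
      proof cases
        case small
        have "norm k < d"
        proof -
          have "norm k \<le> c * \<nu> k" by (rule c)
          also have "\<dots> < c * \<eta>" using small c by simp
          also have "\<dots> \<le> c * (d / c)" using c by (intro mult_left_mono) (auto simp: \<eta>_def)
          finally show ?thesis using c by simp
        qed
        moreover have "\<nu> (a + k) \<le> M + 1" using nu_triangle[of a k] small eta by linarith
        ultimately have "norm (J (a + k) - J a) \<le> e / m"
          using d(2)[of a "a + k"] small by (simp add: dist_norm)
        then have "m * norm (J (a + k) - J a) \<le> e" using m by (simp add: field_simps)
        have "norm (J (a + k) *v h - J a *v h) \<le> m * norm (J (a + k) - J a) * \<nu> h"
          using m(2)[of "J (a + k) - J a" h] by (simp add: matrix_vector_mult_diff_rdistrib)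
        also have "\<dots> \<le> e * \<nu> h"
          using \<open>m * norm (J (a + k) - J a) \<le> e\<close> by (rule mult_right_mono) simp
        also have "\<dots> \<le> weight C' M K e a k * \<nu> h"
          using K C' by (intro mult_right_mono) (auto simp: weight_def)
        finally show ?thesis .
      next
        case far
        have "\<nu> a powr (p - 1) \<le> M powr (p - 1)"
          using far p_gt_1 by (intro powr_mono2) auto
        then have "(P + 1) * \<nu> a powr (p - 1) \<le> (P + 1) * M powr (p - 1)"
          using P by (intro mult_left_mono) auto
        then have 1: "2 + (P + 1) * \<nu> a powr (p - 1) \<le> S" by (simp add: S_def)
        have "\<eta> powr (p - 1) \<le> \<nu> k powr (p - 1)"
          using far eta p_gt_1 by (intro powr_mono2) auto
        then have "S * 1 \<le> S * (\<nu> k powr (p - 1) / \<eta> powr (p - 1))"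
          using S eta by (intro mult_left_mono) auto
        then have "?T \<le> (S / \<eta> powr (p - 1) + P) * \<nu> k powr (p - 1)"
          using 1 by (simp add: ring_distribs)
        then have "C * ?T \<le> C * ((S / \<eta> powr (p - 1) + P) * \<nu> k powr (p - 1))"
          using C by (intro mult_left_mono) auto
        also have "\<dots> \<le> K * \<nu> k powr (p - 1)"
          using mult_right_mono[OF K(2), of "\<nu> k powr (p - 1)"] by (simp add: mult.assoc)
        also have "\<dots> \<le> weight C' M K e a k" using e C' by (simp add: weight_def)
        finally have "C * ?T * \<nu> h \<le> weight C' M K e a k * \<nu> h"
          by (rule mult_right_mono) simp
        then show ?thesis using crude[of a k h] by linarith
      next
        case large
        have "1 \<le> \<nu> a powr (p - 1)" using large M p_gt_1 by (simp add: ge_one_powr_ge_zero)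
        then have "?T
            \<le> (P + 3) * \<nu> a powr (p - 1) + (P + 3) * \<nu> k powr (p - 1)"
        proof -
          have "0 \<le> \<nu> k powr (p - 1)" by simp
          then show ?thesis using \<open>1 \<le> \<nu> a powr (p - 1)\<close> unfolding ring_distribs by linarith
        qed
        then have "C * ?T
            \<le> C * ((P + 3) * \<nu> a powr (p - 1) + (P + 3) * \<nu> k powr (p - 1))"
          using C by (intro mult_left_mono) auto
        also have "\<dots> = C' * \<nu> a powr (p - 1) + C' * \<nu> k powr (p - 1)" by (simp add: C'_def algebra_simps)
        also have "\<dots> \<le> weight C' M K e a k"
          using mult_right_mono[OF K(1), of "\<nu> k powr (p - 1)"] large e by (simp add: weight_def)
        finally have "C * ?T * \<nu> h \<le> weight C' M K e a k * \<nu> h"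
          by (rule mult_right_mono) simp
        then show ?thesis using crude[of a k h] by linarith
      qed
    qed
  qed
qed

text \<open>
  The mean value inequality on the segment from \<open>a\<close> to \<open>a + h\<close>. The
  bound at an intermediate point \<open>a + t h\<close> is at most the one at
  \<open>a + h\<close> because the weight increases with \<open>\<nu> k\<close>.
\<close>

lemma taylor_bound:
  assumes "\<And>a k h. norm (J (a + k) *v h - J a *v h) \<le> weight C M K e a k * \<nu> h" "K \<ge> 0"
  shows "norm (f (a + h) - f a - J a *v h) \<le> weight C M K e a h * \<nu> h"
proof -
  let ?g = "\<lambda>t::real. f (a + t *\<^sub>R h) - t *\<^sub>R (J a *v h)"
  have der: "(?g has_derivative (\<lambda>s. J (a + t *\<^sub>R h) *v (s *\<^sub>R h) - s *\<^sub>R (J a *v h))) (at t)" for t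
  proof (intro has_derivative_diff)
    have "((\<lambda>t. a + t *\<^sub>R h) has_derivative (\<lambda>s. s *\<^sub>R h)) (at t)"
      by (auto intro!: derivative_eq_intros)
    then show "((\<lambda>t. f (a + t *\<^sub>R h)) has_derivative (\<lambda>s. J (a + t *\<^sub>R h) *v (s *\<^sub>R h))) (at t)"
      by (rule has_derivative_compose[OF _ f_has_derivative])
  qed (auto intro!: derivative_eq_intros)
  have "continuous_on {0..1} ?g"
    using der by (meson continuous_at_imp_continuous_on has_derivative_continuous)
  then obtain t where t: "t \<in> {0<..<1}" "norm (?g 1 - ?g 0) \<le> norm (J (a + t *\<^sub>R h) *v h - J a *v h)"
    using mvt_general[of 0 1 ?g, OF _ _ der] by auto
  have "\<nu> (t *\<^sub>R h) \<le> \<nu> h" using t(1) mult_right_mono[of t 1 "\<nu> h"] by (simp add: nu_scale)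
  then have "\<nu> (t *\<^sub>R h) powr (p - 1) \<le> \<nu> h powr (p - 1)"
    using p_gt_1 by (intro powr_mono2) auto
  then have "weight C M K e a (t *\<^sub>R h) * \<nu> h \<le> weight C M K e a h * \<nu> h"
    using assms(2) by (intro mult_right_mono) (auto simp: weight_def mult_left_mono)
  then have "norm (J (a + t *\<^sub>R h) *v h - J a *v h) \<le> weight C M K e a h * \<nu> h"
    using assms(1)[of a "t *\<^sub>R h" h] by linarith
  with t(2) have "norm (?g 1 - ?g 0) \<le> weight C M K e a h * \<nu> h" by (rule order_trans)
  moreover have "?g 1 - ?g 0 = f (a + h) - f a - J a *v h" by simp
  ultimately show ?thesis by (simp only:)
qed

text \<open>
  The Taylor bound at the origin shows growth of order \<open>p\<close>, so \<open>f\<close> maps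
  \<open>L\<^sup>p\<close> into \<open>L\<^sup>1\<close>.
\<close>

lemma f_growth: "\<exists>A\<ge>0. \<forall>x. norm (f x) \<le> A * (1 + \<nu> x powr p)"
proof -
  obtain C K where K: "K \<ge> 0" "\<And>a k h. norm (J (a + k) *v h - J a *v h) \<le> weight C 1 K 1 a k * \<nu> h"
    using jacobian_increment by (metis zero_less_one order_refl)
  obtain D where D: "D > 0" "\<And>x h. norm (J x *v h) \<le> D * (1 + \<nu> x powr (p - 1)) * \<nu> h"
    using jacobian_growth by blast
  show ?thesis
  proof (intro exI[of _ "norm (f 0) + D + 1 + K"] conjI allI)
    fix x
    have "norm (f x) \<le> norm (f x - f 0 - J 0 *v x) + norm (J 0 *v x) + norm (f 0)"
      using norm_triangle_ineq[of "f x - f 0 - J 0 *v x" "J 0 *v x + f 0"]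
        norm_triangle_ineq[of "J 0 *v x" "f 0"] by simp
    also have "\<dots> \<le> (1 + K * \<nu> x powr (p - 1)) * \<nu> x + D * \<nu> x + norm (f 0)"
      using taylor_bound[OF K(2,1), of 0 x] D(2)[of 0 x] p_gt_1 by (simp add: weight_def)
    also have "\<nu> x powr (p - 1) * \<nu> x = \<nu> x powr p"
      by (cases "\<nu> x = 0") (auto simp: powr_diff)
    then have "(1 + K * \<nu> x powr (p - 1)) * \<nu> x = \<nu> x + K * \<nu> x powr p"
      by (simp add: ring_distribs mult.assoc)
    also have "\<nu> x + K * \<nu> x powr p + D * \<nu> x + norm (f 0) \<le> (norm (f 0) + D + 1 + K) * (1 + \<nu> x powr p)"
    proof -
      have le: "\<nu> x \<le> 1 + \<nu> x powr p"
      proof (cases "\<nu> x \<ge> 1")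
        case True then show ?thesis using powr_mono[of 1 p "\<nu> x"] p_gt_1 by simp
      qed (simp add: add_increasing2)
      have "D * \<nu> x \<le> D + D * \<nu> x powr p"
        using mult_left_mono[OF le less_imp_le[OF D(1)]] by (simp only: distrib_left mult_1_right)
      moreover have "0 \<le> norm (f 0) * \<nu> x powr p" by simp
      ultimately show ?thesis using le K(1) unfolding ring_distribs by linarith
    qed
    finally show "norm (f x) \<le> (norm (f 0) + D + 1 + K) * (1 + \<nu> x powr p)" .
  qed (use D K in simp)
qed

lemma integrable_f:
  assumes "\<phi> \<in> carr X" shows "integrable L (\<lambda>\<theta>. f (\<phi> \<theta>))"
proof -
  note [measurable] = carr_XD(2)[OF assms]
  obtain A where A: "A \<ge> 0" "\<And>x. norm (f x) \<le> A * (1 + \<nu> x powr p)" using f_growth by blast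
  show ?thesis
  proof (rule Bochner_Integration.integrable_bound)
    show "integrable L (\<lambda>\<theta>. A * (1 + \<nu> (\<phi> \<theta>) powr p))"
      using carr_XD(3)[OF assms] integrable_L_const by auto
    show "AE \<theta> in L. norm (f (\<phi> \<theta>)) \<le> norm (A * (1 + \<nu> (\<phi> \<theta>) powr p))"
      using A by (intro AE_I2) (auto simp: abs_mult)
  qed measurable
qed

lemma Holder_L:
  assumes h: "h \<in> carr X" and w: "w \<in> borel_measurable L" "\<And>\<theta>. w \<theta> \<ge> 0" "integrable L (\<lambda>\<theta>. w \<theta> powr p)"
  shows "integrable L (\<lambda>\<theta>. w \<theta> powr (p - 1) * \<nu> (h \<theta>))"
    and "a > 0 \<Longrightarrow> (LINT \<theta>|L. w \<theta> powr p) \<le> a powr p \<Longrightarrow>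
      (LINT \<theta>|L. w \<theta> powr (p - 1) * \<nu> (h \<theta>)) \<le> a powr (p - 1) * vnorm X h"
proof -
  note [measurable] = carr_XD(2)[OF h]
  have m: "(\<lambda>\<theta>. \<nu> (h \<theta>)) \<in> borel_measurable L" by measurable
  note H = Holder_powr[OF p_gt_1 m w(1) _ w(2) carr_XD(3)[OF h] w(3)]
  show "integrable L (\<lambda>\<theta>. w \<theta> powr (p - 1) * \<nu> (h \<theta>))" by (rule H(1)) simp
  show "(LINT \<theta>|L. w \<theta> powr (p - 1) * \<nu> (h \<theta>)) \<le> a powr (p - 1) * vnorm X h"
    if "a > 0" "(LINT \<theta>|L. w \<theta> powr p) \<le> a powr p"
    by (rule H(2)) (use that vnorm_nonneg integral_le_vnorm[OF h] in auto)
qed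

lemma integral_nu_le:
  assumes h: "h \<in> carr X"
  shows "integrable L (\<lambda>\<theta>. \<nu> (h \<theta>))"
    and "(LINT \<theta>|L. \<nu> (h \<theta>)) \<le> (R powr (1/p)) powr (p - 1) * vnorm X h"
  using Holder_L[OF h, of "\<lambda>_. 1"] Holder_L(2)[OF h, of "\<lambda>_. 1" "R powr (1/p)"] R_pos p_pos
  by (auto simp: integrable_L_const measure_L powr_powr)

text \<open>
  Hoelder's inequality for each of the three terms of the weight, namely with the constant 1,
  with \<open>\<nu> k\<close> and with the part of \<open>\<nu> \<phi>\<close> above
  \<open>M\<close>.
\<close>

lemma weight_integral:
  assumes phi: "\<phi> \<in> carr X" and k: "k \<in> carr X" and h: "h \<in> carr X"
    and a: "a > 0" "(LINT \<theta>|L. (if \<nu> (\<phi> \<theta>) > M then \<nu> (\<phi> \<theta>) else 0) powr p) \<le> a powr p"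
    and d: "d > 0" "vnorm X k \<le> d" and ck: "C \<ge> 0" "K \<ge> 0" "e \<ge> 0"
  shows "integrable L (\<lambda>\<theta>. weight C M K e (\<phi> \<theta>) (k \<theta>) * \<nu> (h \<theta>))"
    and "(LINT \<theta>|L. weight C M K e (\<phi> \<theta>) (k \<theta>) * \<nu> (h \<theta>))
      \<le> (e * (R powr (1/p)) powr (p - 1) + K * d powr (p - 1) + C * a powr (p - 1)) * vnorm X h"
proof -
  note [measurable] = carr_XD(2)[OF phi] carr_XD(2)[OF k] carr_XD(2)[OF h]
  let ?w = "\<lambda>\<theta>. if \<nu> (\<phi> \<theta>) > M then \<nu> (\<phi> \<theta>) else 0"
  have w: "integrable L (\<lambda>\<theta>. ?w \<theta> powr p)"
  proof (rule Bochner_Integration.integrable_bound[OF carr_XD(3)[OF phi]])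
    show "(\<lambda>\<theta>. ?w \<theta> powr p) \<in> borel_measurable L" by measurable
    show "AE \<theta> in L. norm (?w \<theta> powr p) \<le> norm (\<nu> (\<phi> \<theta>) powr p)" by (rule AE_I2) simp
  qed
  have k': "(LINT \<theta>|L. \<nu> (k \<theta>) powr p) \<le> d powr p"
    using integral_le_vnorm[OF k] powr_mono2[OF _ vnorm_nonneg d(2), of p] p_pos by simp
  have i2: "integrable L (\<lambda>\<theta>. \<nu> (k \<theta>) powr (p - 1) * \<nu> (h \<theta>))"
    "(LINT \<theta>|L. \<nu> (k \<theta>) powr (p - 1) * \<nu> (h \<theta>)) \<le> d powr (p - 1) * vnorm X h"
    using Holder_L[OF h _ _ carr_XD(3)[OF k]] d(1) k' by auto
  have i3: "integrable L (\<lambda>\<theta>. ?w \<theta> powr (p - 1) * \<nu> (h \<theta>))"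
    "(LINT \<theta>|L. ?w \<theta> powr (p - 1) * \<nu> (h \<theta>)) \<le> a powr (p - 1) * vnorm X h"
    by (rule Holder_L[OF h _ _ w]; use a in auto)+
  have eq: "(\<lambda>\<theta>. weight C M K e (\<phi> \<theta>) (k \<theta>) * \<nu> (h \<theta>)) =
    (\<lambda>\<theta>. e * \<nu> (h \<theta>) + K * (\<nu> (k \<theta>) powr (p - 1) * \<nu> (h \<theta>)) + C * (?w \<theta> powr (p - 1) * \<nu> (h \<theta>)))"
    by (auto simp: weight_def fun_eq_iff algebra_simps)
  show "integrable L (\<lambda>\<theta>. weight C M K e (\<phi> \<theta>) (k \<theta>) * \<nu> (h \<theta>))"
    unfolding eq using integral_nu_le(1)[OF h] i2(1) i3(1)
    by (intro Bochner_Integration.integrable_add integrable_mult_right)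
  have "(LINT \<theta>|L. weight C M K e (\<phi> \<theta>) (k \<theta>) * \<nu> (h \<theta>)) =
    e * (LINT \<theta>|L. \<nu> (h \<theta>)) + K * (LINT \<theta>|L. \<nu> (k \<theta>) powr (p - 1) * \<nu> (h \<theta>))
     + C * (LINT \<theta>|L. ?w \<theta> powr (p - 1) * \<nu> (h \<theta>))"
    unfolding eq
    using integral_nu_le(1)[OF h] i2(1) i3(1) by simp
  also have "\<dots> \<le> e * ((R powr (1/p)) powr (p - 1) * vnorm X h) + K * (d powr (p - 1) * vnorm X h)
      + C * (a powr (p - 1) * vnorm X h)"
    using ck integral_nu_le(2)[OF h] i2(2) i3(2) by (intro add_mono mult_left_mono) auto
  finally show "(LINT \<theta>|L. weight C M K e (\<phi> \<theta>) (k \<theta>) * \<nu> (h \<theta>))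
      \<le> (e * (R powr (1/p)) powr (p - 1) + K * d powr (p - 1) + C * a powr (p - 1)) * vnorm X h"
    by (simp add: algebra_simps)
qed

lemma integral_norm_le:
  fixes g :: "real \<Rightarrow> real^'n"
  assumes "g \<in> borel_measurable L" "integrable L w" "\<And>\<theta>. norm (g \<theta>) \<le> w \<theta>"
  shows "integrable L g" "(LINT \<theta>|L. norm (g \<theta>)) \<le> (LINT \<theta>|L. w \<theta>)"
proof -
  show "integrable L g"
    by (rule Bochner_Integration.integrable_bound[OF assms(2,1)])
      (rule AE_I2, use assms(3) abs_ge_self order_trans in \<open>simp, blast\<close>)
  then show "(LINT \<theta>|L. norm (g \<theta>)) \<le> (LINT \<theta>|L. w \<theta>)"
    by (intro integral_mono assms) auto
qed

text \<open>
  One weight bounds the Taylor remainder, with \<open>h = k\<close>, and the increment of the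
  derivative; these are differentiability of the superposition operator and continuity of its
  derivative. Each of the three terms of the weight is allotted a third of \<open>e\<close>.
\<close>

lemma superposition_estimate:
  assumes phi: "\<phi> \<in> carr X" and e: "e > 0"
  shows "\<exists>d>0. \<forall>k\<in>carr X. vnorm X k < d \<longrightarrow>
     (LINT \<theta>|L. norm (f (\<phi> \<theta> + k \<theta>) - f (\<phi> \<theta>) - J (\<phi> \<theta>) *v k \<theta>)) \<le> e * vnorm X k \<and>
     (\<forall>h\<in>carr X. (LINT \<theta>|L. norm (J (\<phi> \<theta> + k \<theta>) *v h \<theta> - J (\<phi> \<theta>) *v h \<theta>)) \<le> e * vnorm X h)"
proof -
  obtain C where C: "C > 0" "\<And>M e. \<lbrakk>M \<ge> 1; e > 0\<rbrakk> \<Longrightarrow> \<exists>K\<ge>0. \<forall>a k h.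
      norm (J (a + k) *v h - J a *v h) \<le> weight C M K e a k * \<nu> h"
    using jacobian_increment by blast
  \<comment> \<open>The tail bound \<open>a\<close> depends on \<open>e\<close> and \<open>C\<close> only, so \<open>M\<close> can be fixed before \<open>e'\<close> and \<open>K\<close>.\<close>
  define a where "a = (e / (3 * C)) powr (1 / (p - 1))"
  have a: "a > 0" "C * a powr (p - 1) = e / 3"
    using e C p_gt_1 by (auto simp: a_def powr_powr)
  obtain M where M: "M \<ge> 1" "(LINT \<theta>|L. (if \<nu> (\<phi> \<theta>) > M then \<nu> (\<phi> \<theta>) else 0) powr p) \<le> a powr p"
    using tail_integral_small[OF phi, of "a powr p"] a(1) by auto
  define S where "S = (R powr (1/p)) powr (p - 1)"
  have S: "S > 0" using R_pos by (simp add: S_def)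
  define e' where "e' = e / (3 * S)"
  have e': "e' > 0" "e' * S = e / 3" using e S by (auto simp: e'_def)
  obtain K where K: "K \<ge> 0" "\<And>a k h. norm (J (a + k) *v h - J a *v h) \<le> weight C M K e' a k * \<nu> h"
    using C(2)[OF M(1) e'(1)] by blast
  define d where "d = (e / (3 * (K + 1))) powr (1 / (p - 1))"
  have d: "d > 0" using e K by (simp add: d_def)
  have "K * d powr (p - 1) \<le> e / 3"
  proof -
    have "d powr (p - 1) = e / (3 * (K + 1))"
      using e K p_gt_1 by (simp add: d_def powr_powr)
    then have "K * d powr (p - 1) = (K / (K + 1)) * (e / 3)" by simp
    also have "\<dots> \<le> 1 * (e / 3)" using K e by (intro mult_right_mono) auto
    finally show ?thesis by simp
  qed
  then have tot: "e' * S + K * d powr (p - 1) + C * a powr (p - 1) \<le> e" using e' a by simp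
  have est: "(LINT \<theta>|L. norm (g \<theta> :: real^'n)) \<le> e * vnorm X h"
    if k: "k \<in> carr X" "vnorm X k < d" and h: "h \<in> carr X" and g: "g \<in> borel_measurable L"
      "\<And>\<theta>. norm (g \<theta>) \<le> weight C M K e' (\<phi> \<theta>) (k \<theta>) * \<nu> (h \<theta>)" for k h g
  proof -
    note w = weight_integral[OF phi k(1) h a(1) M(2) d less_imp_le[OF k(2)] less_imp_le[OF C(1)] K(1)
        less_imp_le[OF e'(1)]]
    show ?thesis
      using integral_norm_le(2)[OF g(1) w(1) g(2)] w(2) mult_right_mono[OF tot vnorm_nonneg[of h]]
      by (simp add: S_def)
  qed
  show ?thesis
  proof (intro exI[of _ d] conjI ballI impI d)
    fix k assume k: "k \<in> carr X" "vnorm X k < d"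
    note [measurable] = carr_XD(2)[OF phi] carr_XD(2)[OF k(1)]
    show "(LINT \<theta>|L. norm (f (\<phi> \<theta> + k \<theta>) - f (\<phi> \<theta>) - J (\<phi> \<theta>) *v k \<theta>)) \<le> e * vnorm X k"
      by (rule est[OF k k(1) _ taylor_bound[OF K(2,1)]]) measurable
    fix h assume h: "h \<in> carr X"
    note [measurable] = carr_XD(2)[OF h]
    show "(LINT \<theta>|L. norm (J (\<phi> \<theta> + k \<theta>) *v h \<theta> - J (\<phi> \<theta>) *v h \<theta>)) \<le> e * vnorm X h"
      by (rule est[OF k h _ K(2)]) measurable
  qed
qed

lemma integrable_J:
  assumes phi: "\<phi> \<in> carr X"
  obtains K where "K \<ge> 0" "\<And>h. h \<in> carr X \<Longrightarrow> integrable L (\<lambda>\<theta>. J (\<phi> \<theta>) *v h \<theta>)"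
    "\<And>h. h \<in> carr X \<Longrightarrow> (LINT \<theta>|L. norm (J (\<phi> \<theta>) *v h \<theta>)) \<le> K * vnorm X h"
proof -
  obtain C where C: "C > 0" "\<And>x h. norm (J x *v h) \<le> C * (1 + \<nu> x powr (p - 1)) * \<nu> h"
    using jacobian_growth by blast
  define a where "a = vnorm X \<phi> + 1"
  have a: "a > 0" using vnorm_nonneg[of \<phi>] by (simp add: a_def)
  have "(LINT \<theta>|L. \<nu> (\<phi> \<theta>) powr p) \<le> vnorm X \<phi> powr p" by (rule integral_le_vnorm[OF phi])
  also have "\<dots> \<le> a powr p" using p_pos vnorm_nonneg by (intro powr_mono2) (auto simp: a_def)
  finally have le: "(LINT \<theta>|L. \<nu> (\<phi> \<theta>) powr p) \<le> a powr p" .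
  define S where "S = (R powr (1/p)) powr (p - 1)"
  have main: "integrable L (\<lambda>\<theta>. J (\<phi> \<theta>) *v h \<theta>)"
     "(LINT \<theta>|L. norm (J (\<phi> \<theta>) *v h \<theta>)) \<le> C * (S + a powr (p - 1)) * vnorm X h" if h: "h \<in> carr X" for h
  proof -
    note [measurable] = carr_XD(2)[OF phi] carr_XD(2)[OF h]
    have i2: "integrable L (\<lambda>\<theta>. \<nu> (\<phi> \<theta>) powr (p - 1) * \<nu> (h \<theta>))"
      "(LINT \<theta>|L. \<nu> (\<phi> \<theta>) powr (p - 1) * \<nu> (h \<theta>)) \<le> a powr (p - 1) * vnorm X h"
      using Holder_L[OF h _ _ carr_XD(3)[OF phi]] a le by auto
    have i: "integrable L (\<lambda>\<theta>. C * (\<nu> (h \<theta>) + \<nu> (\<phi> \<theta>) powr (p - 1) * \<nu> (h \<theta>)))"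
      using i2 integral_nu_le(1)[OF h] by auto
    have b: "norm (J (\<phi> \<theta>) *v h \<theta>) \<le> C * (\<nu> (h \<theta>) + \<nu> (\<phi> \<theta>) powr (p - 1) * \<nu> (h \<theta>))" for \<theta>
      using C(2)[of "\<phi> \<theta>" "h \<theta>"] by (simp add: algebra_simps)
    have m: "(\<lambda>\<theta>. J (\<phi> \<theta>) *v h \<theta>) \<in> borel_measurable L" by measurable
    note G = integral_norm_le[OF m i b]
    show "integrable L (\<lambda>\<theta>. J (\<phi> \<theta>) *v h \<theta>)" by (rule G)
    have "(LINT \<theta>|L. norm (J (\<phi> \<theta>) *v h \<theta>)) \<le> C * ((LINT \<theta>|L. \<nu> (h \<theta>)) + (LINT \<theta>|L. \<nu> (\<phi> \<theta>) powr (p - 1) * \<nu> (h \<theta>)))"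
      using G(2) i2(1) integral_nu_le(1)[OF h] by simp
    also have "\<dots> \<le> C * (S * vnorm X h + a powr (p - 1) * vnorm X h)"
      using C i2(2) integral_nu_le(2)[OF h] by (intro mult_left_mono add_mono) (auto simp: S_def)
    finally show "(LINT \<theta>|L. norm (J (\<phi> \<theta>) *v h \<theta>)) \<le> C * (S + a powr (p - 1)) * vnorm X h"
      by (simp add: algebra_simps)
  qed
  show ?thesis
    by (rule that[OF _ main]) (use C S_def in simp)
qed

text \<open>
  Here the displacement in \<open>superposition_estimate\<close> is
  \<open>k = \<psi> - \<phi>\<close>; the bound holds for all \<open>h\<close>, so it is one in
  operator norm.
\<close>

lemma superposition_derivative_continuous:
  assumes phi: "\<phi> \<in> carr X" and e: "e > 0"
  shows "\<exists>d>0. \<forall>\<psi>\<in>carr X. X.gap \<psi> \<phi> < d \<longrightarrow> (\<forall>h\<in>carr X.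
     (LINT \<theta>|L. norm (J (\<psi> \<theta>) *v h \<theta> - J (\<phi> \<theta>) *v h \<theta>)) \<le> e * vnorm X h)"
proof -
  obtain d where d: "d > 0" "\<And>k h. \<lbrakk>k \<in> carr X; vnorm X k < d; h \<in> carr X\<rbrakk> \<Longrightarrow>
      (LINT \<theta>|L. norm (J (\<phi> \<theta> + k \<theta>) *v h \<theta> - J (\<phi> \<theta>) *v h \<theta>)) \<le> e * vnorm X h"
    using superposition_estimate[OF assms] by blast
  have "(LINT \<theta>|L. norm (J (\<psi> \<theta>) *v h \<theta> - J (\<phi> \<theta>) *v h \<theta>)) \<le> e * vnorm X h"
    if "\<psi> \<in> carr X" "X.gap \<psi> \<phi> < d" "h \<in> carr X" for \<psi> h
  proof -
    have "(LINT \<theta>|L. norm (J (\<psi> \<theta>) *v h \<theta> - J (\<phi> \<theta>) *v h \<theta>))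
        = (LINT \<theta>|L. norm (J (\<phi> \<theta> + vminus X \<psi> \<phi> \<theta>) *v h \<theta> - J (\<phi> \<theta>) *v h \<theta>))"
      by (rule integral_L_cong) (simp add: vminus_X)
    then show ?thesis using d(2)[of "vminus X \<psi> \<phi>" h] that phi by (simp add: X.closed)
  qed
  then show ?thesis using d(1) by blast
qed

end


section \<open>Solutions of the delay equation\<close>

text \<open>
  Solutions are defined with Lebesgue integrals over varying intervals. They are treated as gauge
  integrals, for which combination and translation of intervals and continuity of indefinite
  integrals are at hand.
\<close>

lemma integrable_lebesgue_on_iff:
  "integrable (lebesgue_on {a..b::real}) g \<longleftrightarrow> g absolutely_integrable_on {a..b}"
  for g :: "real \<Rightarrow> 'b::euclidean_space"
  by (simp add: integrable_restrict_space set_integrable_def)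

lemma integral_lebesgue_on_eq:
  "g absolutely_integrable_on {a..b::real} \<Longrightarrow> integral\<^sup>L (lebesgue_on {a..b}) g = integral {a..b} g"
  for g :: "real \<Rightarrow> 'b::euclidean_space"
  by (intro lebesgue_integral_eq_integral) (auto simp: integrable_lebesgue_on_iff)

lemma absolutely_integrable_shift:
  "(\<lambda>s. g (c + s)) absolutely_integrable_on {a..b::real} \<longleftrightarrow> g absolutely_integrable_on {a + c..b + c}"
  for g :: "real \<Rightarrow> 'b::euclidean_space"
  using integrable_on_shift_Icc_real[of g c a b] integrable_on_shift_Icc_real[of "\<lambda>x. norm (g x)" c a b]
  by (simp add: absolutely_integrable_on_def o_def)

lemma integral_shift_Icc: "integral {a..b::real} (\<lambda>s. g (c + s)) = integral {a + c..b + c} g"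
  using integral_shift_Icc_real[of a b g c] by (simp add: o_def)

lemma absolutely_integrable_glue:
  fixes g :: "real \<Rightarrow> 'b::euclidean_space"
  assumes "g absolutely_integrable_on {a..c}" "g absolutely_integrable_on {c..b}" "a \<le> c" "c \<le> b"
  shows "g absolutely_integrable_on {a..b}"
  using assms unfolding absolutely_integrable_on_def
  by (blast intro: Henstock_Kurzweil_Integration.integrable_combine)

lemma absolutely_integrable_cong_Icc:
  fixes g :: "real \<Rightarrow> 'b::euclidean_space"
  assumes "\<And>x. x \<in> {a..b} \<Longrightarrow> g x = h x"
  shows "g absolutely_integrable_on {a..b} \<longleftrightarrow> h absolutely_integrable_on {a..b}"
  by (rule absolutely_integrable_spike_eq[of "{}"]) (use assms in auto)

lemma continuous_on_atLeast_iff: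
  fixes g :: "real \<Rightarrow> 'b::topological_space"
  assumes "\<And>T. T \<ge> 0 \<Longrightarrow> continuous_on {0..T} g"
  shows "continuous_on {0..} g"
  unfolding continuous_on_eq_continuous_within
proof
  fix t :: real assume t: "t \<in> {0..}"
  have "at t within {0..} = at t within {0..t + 1}"
    by (rule at_within_nhd[of _ "{..<t + 1}"]) auto
  then show "continuous (at t within {0..}) g"
    using assms[of "t + 1"] t by (simp add: continuous_on_eq_continuous_within)
qed

locale delay_equation = C1_growth \<nu> p R f \<alpha>
  for \<nu> :: "real^'n \<Rightarrow> real" and p R :: real and f :: "real^'n \<Rightarrow> real^'n" and \<alpha> :: real +
  fixes r :: real
  assumes r_pos: "0 < r" and r_le_R: "r \<le> R"
begin

text \<open>
  What the Picard iterates and the solutions have in common. When the history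
  \<open>\<phi>\<close> belongs to \<open>L\<^sup>p\<close>, this makes the right-hand side of
  the integral equation locally integrable.
\<close>

definition admissible :: "(real \<Rightarrow> real^'n) \<Rightarrow> (real \<Rightarrow> real^'n) \<Rightarrow> bool" where
  "admissible \<phi> x \<longleftrightarrow> x \<in> extensional {-R..} \<and> (\<forall>t\<in>I. x t = \<phi> t) \<and> continuous_on {0..} x"

lemma absolutely_integrable_admissible:
  fixes g :: "real^'n \<Rightarrow> 'b::euclidean_space"
  assumes "admissible \<phi> x" "(\<lambda>t. g (\<phi> t)) absolutely_integrable_on I" "continuous_on UNIV g" "-R \<le> a"
  shows "(\<lambda>t. g (x t)) absolutely_integrable_on {a..b}"
proof -
  have 1: "(\<lambda>t. g (x t)) absolutely_integrable_on {-R..0}"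
    by (rule absolutely_integrable_cong_Icc[THEN iffD1, OF _ assms(2)])
       (use assms(1) in \<open>simp add: admissible_def\<close>)
  have "continuous_on {0..max 0 b} x"
    using assms(1) continuous_on_subset[of "{0..}" x "{0..max 0 b}"] by (auto simp: admissible_def)
  then have 2: "(\<lambda>t. g (x t)) absolutely_integrable_on {0..max 0 b}"
    using continuous_on_compose2[OF assms(3)] by (intro absolutely_integrable_continuous_real) blast
  have "(\<lambda>t. g (x t)) absolutely_integrable_on {-R..max 0 b}"
    by (rule absolutely_integrable_glue[OF 1 2]) (use R_pos in auto)
  then show ?thesis
    by (rule absolutely_integrable_on_subinterval) (use assms(4) in auto)
qed

lemma history_integrable:
  assumes "\<phi> \<in> carr X"
  shows "(\<lambda>t. f (\<phi> t)) absolutely_integrable_on I"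
    and "(\<lambda>t. \<phi> t) absolutely_integrable_on I"
    and "(\<lambda>t. \<nu> (\<phi> t) powr p) absolutely_integrable_on I"
proof -
  show "(\<lambda>t. f (\<phi> t)) absolutely_integrable_on I"
    using integrable_f[OF assms] by (simp add: integrable_lebesgue_on_iff)
  show "(\<lambda>t. \<nu> (\<phi> t) powr p) absolutely_integrable_on I"
    using carr_XD(3)[OF assms] by (simp add: integrable_lebesgue_on_iff)
  obtain c where c: "c > 0" "\<And>x. norm x \<le> c * \<nu> x" using norm_le_nu by blast
  have i: "integrable L (\<lambda>t. c * \<nu> (\<phi> t))" using integral_nu_le(1)[OF assms] by simp
  have "integrable L \<phi>"
    by (rule integral_norm_le(1)[OF carr_XD(2)[OF assms] i c(2)])
  then show "(\<lambda>t. \<phi> t) absolutely_integrable_on I" by (simp add: integrable_lebesgue_on_iff)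
qed

lemma delayed_integrable:
  assumes "admissible \<phi> x" "\<phi> \<in> carr X" "a \<ge> 0"
  shows "(\<lambda>s. f (x (s - r))) absolutely_integrable_on {a..b}"
proof -
  have "(\<lambda>t. f (x t)) absolutely_integrable_on {a + - r..b + - r}"
    using absolutely_integrable_admissible[OF assms(1) history_integrable(1)[OF assms(2)] continuous_f]
      assms(3) r_le_R by simp
  from absolutely_integrable_shift[THEN iffD2, OF this] show ?thesis by simp
qed

lemma continuous_on_nu_powr: "continuous_on UNIV (\<lambda>x. \<nu> x powr p)"
  using p_pos by (intro continuous_on_powr' continuous_intros continuous_on_nu) auto

lemma history_carr:
  assumes "admissible \<phi> x" "\<phi> \<in> carr X" "t \<ge> 0"
  shows "history R t x \<in> carr X"
  unfolding history_def
proof (rule restrict_carr_X)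
  have "(\<lambda>s. x s) absolutely_integrable_on {-R + t..0 + t}"
    using absolutely_integrable_admissible[OF assms(1) history_integrable(2)[OF assms(2)] continuous_on_id]
      assms(3) by simp
  then have "(\<lambda>s. x (t + s)) absolutely_integrable_on I" by (rule absolutely_integrable_shift[THEN iffD2])
  then show "(\<lambda>s. x (t + s)) \<in> borel_measurable L"
    by (intro borel_measurable_integrable) (simp add: integrable_lebesgue_on_iff)
  have "(\<lambda>s. \<nu> (x s) powr p) absolutely_integrable_on {-R + t..0 + t}"
    using absolutely_integrable_admissible[OF assms(1) history_integrable(3)[OF assms(2)] continuous_on_nu_powr]
      assms(3) by simp
  then have "(\<lambda>s. \<nu> (x (t + s)) powr p) absolutely_integrable_on I"
    by (rule absolutely_integrable_shift[where g = "\<lambda>s. \<nu> (x s) powr p", THEN iffD2])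
  then show "integrable L (\<lambda>s. \<nu> (x (t + s)) powr p)" by (simp add: integrable_lebesgue_on_iff)
qed

lemma is_solution_iff:
  assumes "\<phi> \<in> carr X"
  shows "is_solution R r f \<phi> x \<longleftrightarrow> admissible \<phi> x \<and>
     (\<forall>t\<ge>0. x t = \<phi> 0 + integral {0..t} (\<lambda>s. f (x (s - r))))"
proof -
  have iff: "is_solution R r f \<phi> x \<longleftrightarrow> admissible \<phi> x \<and>
     (\<forall>t\<ge>0. (\<lambda>s. f (x (s - r))) absolutely_integrable_on {0..t} \<and>
        x t = \<phi> 0 + (LINT s|lebesgue_on {0..t}. f (x (s - r))))"
    unfolding is_solution_def admissible_def integrable_lebesgue_on_iff by (simp add: PiE_def)
  show ?thesis
  proof (cases "admissible \<phi> x")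
    case True
    then have int: "(\<lambda>s. f (x (s - r))) absolutely_integrable_on {0..t}" for t
      using delayed_integrable assms by blast
    show ?thesis unfolding iff using int integral_lebesgue_on_eq[OF int] True by simp
  qed (simp add: iff)
qed

text \<open>
  Since the right-hand side at time \<open>t\<close> involves the argument only up to time
  \<open>t - r\<close>, each application of this operator makes a function correct on a further
  interval of length \<open>r\<close>: the method of steps.
\<close>

definition picard :: "(real \<Rightarrow> real^'n) \<Rightarrow> (real \<Rightarrow> real^'n) \<Rightarrow> real \<Rightarrow> real^'n" where
  "picard \<phi> x = (\<lambda>t\<in>{-R..}. if t \<le> 0 then \<phi> t else \<phi> 0 + integral {0..t} (\<lambda>s. f (x (s - r))))"

lemma picard_nonneg: "t \<ge> 0 \<Longrightarrow> picard \<phi> x t = \<phi> 0 + integral {0..t} (\<lambda>s. f (x (s - r)))"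
  using R_pos by (auto simp: picard_def)

lemma admissible_picard:
  assumes "admissible \<phi> x" "\<phi> \<in> carr X"
  shows "admissible \<phi> (picard \<phi> x)"
proof -
  have "continuous_on {0..T} (picard \<phi> x)" if "T \<ge> 0" for T
  proof -
    have "(\<lambda>s. f (x (s - r))) integrable_on {0..T}"
      using delayed_integrable[OF assms] by (simp add: absolutely_integrable_on_def)
    from indefinite_integral_continuous_1[OF this]
    have "continuous_on {0..T} (\<lambda>t. \<phi> 0 + integral {0..t} (\<lambda>s. f (x (s - r))))"
      by (intro continuous_intros)
    then show ?thesis
      by (rule continuous_on_eq) (simp add: picard_nonneg)
  qed
  then show ?thesis
    unfolding admissible_def by (auto intro!: continuous_on_atLeast_iff simp: picard_def)
qed

definition iterate :: "(real \<Rightarrow> real^'n) \<Rightarrow> nat \<Rightarrow> real \<Rightarrow> real^'n" where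
  "iterate \<phi> n = (picard \<phi> ^^ n) (\<lambda>t\<in>{-R..}. if t \<le> 0 then \<phi> t else \<phi> 0)"

lemma admissible_iterate:
  assumes "\<phi> \<in> carr X" shows "admissible \<phi> (iterate \<phi> n)"
proof (induction n)
  case 0
  have "continuous_on {0..} (\<lambda>t\<in>{-R..}. if t \<le> 0 then \<phi> t else \<phi> 0)"
    by (rule continuous_on_eq[OF continuous_on_const[of _ "\<phi> 0"]]) (use R_pos in auto)
  then show ?case
    unfolding admissible_def iterate_def funpow_0 by (intro conjI restrict_extensional) auto
next
  case (Suc n)
  then show ?case using admissible_picard[OF _ assms] by (simp add: iterate_def)
qed

lemma iterate_Suc_eq:
  assumes "t \<le> real n * r"
  shows "iterate \<phi> (Suc n) t = iterate \<phi> n t"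
  using assms
proof (induction n arbitrary: t)
  case 0
  then show ?case by (simp add: iterate_def picard_def)
next
  case (Suc n)
  have "integral {0..t} (\<lambda>s. f (iterate \<phi> (Suc n) (s - r))) = integral {0..t} (\<lambda>s. f (iterate \<phi> n (s - r)))"
  proof (rule Henstock_Kurzweil_Integration.integral_cong)
    fix s assume "s \<in> {0..t}"
    then have "s - r \<le> real n * r" using Suc.prems by (simp add: ring_distribs)
    then show "f (iterate \<phi> (Suc n) (s - r)) = f (iterate \<phi> n (s - r))" using Suc.IH by simp
  qed
  then have "picard \<phi> (iterate \<phi> (Suc n)) t = picard \<phi> (iterate \<phi> n) t"
    by (simp add: picard_def restrict_def)
  then show ?case by (simp add: iterate_def)
qed

lemma iterate_eq:
  assumes "t \<le> real n * r" "n \<le> m"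
  shows "iterate \<phi> m t = iterate \<phi> n t"
  using assms(2)
proof (induction m rule: dec_induct)
  case (step k)
  have "real n * r \<le> real k * r" using step r_pos by (intro mult_right_mono) auto
  then show ?case using iterate_Suc_eq[of t k \<phi>] step assms(1) by simp
qed simp

text \<open>
  At time \<open>t\<close> all iterates from number \<open>t / r\<close> on agree; their common
  value is the solution.
\<close>

theorem solution_exists:
  assumes "\<phi> \<in> carr X" shows "\<exists>x. is_solution R r f \<phi> x"
proof -
  define x where "x t = iterate \<phi> (nat \<lceil>t / r\<rceil>) t" for t
  have x: "x t = iterate \<phi> n t" if "t \<le> real n * r" for t n
  proof -
    have "t / r \<le> real n" using that r_pos by (simp add: field_simps)
    then have "nat \<lceil>t / r\<rceil> \<le> n" by linarith
    moreover have "t / r \<le> real (nat \<lceil>t / r\<rceil>)" by linarith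
    then have "t \<le> real (nat \<lceil>t / r\<rceil>) * r" using r_pos by (simp add: field_simps)
    ultimately show ?thesis unfolding x_def using iterate_eq by metis
  qed
  have reach: "\<exists>n. t \<le> real n * r" for t
    using reals_Archimedean3[OF r_pos] less_imp_le by blast
  note adm = admissible_iterate[OF assms]
  have "continuous_on {0..T} x" for T
  proof -
    obtain n where n: "T \<le> real n * r" using reach by blast
    have "continuous_on {0..T} (iterate \<phi> n)"
      using adm[of n] by (auto simp: admissible_def intro: continuous_on_subset)
    then show ?thesis by (rule continuous_on_eq) (use n in \<open>auto intro!: x[symmetric]\<close>)
  qed
  then have "continuous_on {0..} x" by (rule continuous_on_atLeast_iff)
  moreover have "x t = \<phi> t" if "t \<in> I" for t
    using x[where t = t and n = 0] that by (simp add: iterate_def)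
  moreover have "x \<in> extensional {-R..}"
    using adm by (auto simp: x_def extensional_def admissible_def)
  moreover have "x t = \<phi> 0 + integral {0..t} (\<lambda>s. f (x (s - r)))" if t: "t \<ge> 0" for t
  proof -
    obtain n where n: "t \<le> real n * r" using reach by blast
    have "x t = iterate \<phi> (Suc n) t" using x[where t = t and n = "Suc n"] n r_pos by (simp add: ring_distribs)
    also have "\<dots> = \<phi> 0 + integral {0..t} (\<lambda>s. f (iterate \<phi> n (s - r)))"
      using t picard_nonneg by (simp add: iterate_def)
    also have "integral {0..t} (\<lambda>s. f (iterate \<phi> n (s - r))) = integral {0..t} (\<lambda>s. f (x (s - r)))"
    proof (rule Henstock_Kurzweil_Integration.integral_cong)
      fix s assume "s \<in> {0..t}"
      then have "s - r \<le> real n * r" using n r_pos by simp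
      then show "f (iterate \<phi> n (s - r)) = f (x (s - r))" using x by simp
    qed
    finally show ?thesis .
  qed
  ultimately have "is_solution R r f \<phi> x" by (simp add: is_solution_iff[OF assms] admissible_def)
  then show ?thesis by blast
qed

theorem solution_unique:
  assumes "\<phi> \<in> carr X" "is_solution R r f \<phi> x" "is_solution R r f \<phi> y"
  shows "x = y"
proof -
  have x: "admissible \<phi> x" "\<And>t. t \<ge> 0 \<Longrightarrow> x t = \<phi> 0 + integral {0..t} (\<lambda>s. f (x (s - r)))"
   and y: "admissible \<phi> y" "\<And>t. t \<ge> 0 \<Longrightarrow> y t = \<phi> 0 + integral {0..t} (\<lambda>s. f (y (s - r)))"
    using assms by (auto simp: is_solution_iff)
  have hist: "x t = y t" if "t \<le> 0" for t
    using x(1) y(1) that by (cases "t \<ge> -R") (auto simp: admissible_def extensional_def)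
  have "x t = y t" if "t \<le> real n * r" for n t
    using that
  proof (induction n arbitrary: t)
    case 0 then show ?case using hist by simp
  next
    case (Suc n)
    show ?case
    proof (cases "t \<le> 0")
      case False
      have "integral {0..t} (\<lambda>s. f (x (s - r))) = integral {0..t} (\<lambda>s. f (y (s - r)))"
      proof (rule Henstock_Kurzweil_Integration.integral_cong)
        fix s assume "s \<in> {0..t}"
        then have "s - r \<le> real n * r" using Suc.prems by (simp add: ring_distribs)
        then show "f (x (s - r)) = f (y (s - r))" using Suc.IH by simp
      qed
      then show ?thesis using x(2) y(2) False by simp
    qed (fact hist)
  qed
  then show ?thesis
    using reals_Archimedean3[OF r_pos] less_imp_le by (metis ext)
qed

lemma ex1_solution: "\<phi> \<in> carr X \<Longrightarrow> \<exists>!x. is_solution R r f \<phi> x"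
  using solution_exists solution_unique by blast

abbreviation "sol \<equiv> solution R r f"
abbreviation "flow \<equiv> dde_flow R r f"

lemma is_solution_sol: "\<phi> \<in> carr X \<Longrightarrow> is_solution R r f \<phi> (sol \<phi>)"
  unfolding solution_def by (rule theI'[OF ex1_solution])

lemma sol_admissible: "\<phi> \<in> carr X \<Longrightarrow> admissible \<phi> (sol \<phi>)"
  and sol_eq: "\<phi> \<in> carr X \<Longrightarrow> t \<ge> 0 \<Longrightarrow> sol \<phi> t = \<phi> 0 + integral {0..t} (\<lambda>s. f (sol \<phi> (s - r)))"
  using is_solution_sol is_solution_iff by auto

lemma flow_carr: "\<phi> \<in> carr X \<Longrightarrow> t \<ge> 0 \<Longrightarrow> flow t \<phi> \<in> carr X"
  unfolding dde_flow_def by (rule history_carr[OF sol_admissible])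

lemma flow_zero:
  assumes "\<phi> \<in> carr X" shows "flow 0 \<phi> = \<phi>"
proof (rule extensionalityI)
  show "flow 0 \<phi> \<in> extensional I" "\<phi> \<in> extensional I"
    using assms by (auto simp: dde_flow_def history_def carr_X)
  show "flow 0 \<phi> t = \<phi> t" if "t \<in> I" for t
    using sol_admissible[OF assms] that by (simp add: dde_flow_def history_def admissible_def)
qed

text \<open>
  The solution translated by \<open>t\<close> solves the equation for the history at time
  \<open>t\<close>, and solutions are unique.
\<close>

theorem flow_add:
  assumes phi: "\<phi> \<in> carr X" and t: "t \<ge> 0" and s: "s \<ge> 0"
  shows "flow (t + s) \<phi> = flow s (flow t \<phi>)"
proof -
  let ?x = "sol \<phi>"
  define y where "y = (\<lambda>u\<in>{-R..}. ?x (t + u))"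
  note adm = sol_admissible[OF phi]
  have "continuous_on {0..} (\<lambda>u. ?x (t + u))"
  proof (rule continuous_on_compose2[where g = ?x and t = "{0..}"])
    show "continuous_on {0..} ?x" using adm by (simp add: admissible_def)
  qed (use t in \<open>auto intro!: continuous_intros\<close>)
  then have "continuous_on {0..} y"
    by (rule continuous_on_eq) (use R_pos in \<open>auto simp: y_def\<close>)
  then have y: "admissible (flow t \<phi>) y"
    by (auto simp: admissible_def y_def dde_flow_def history_def)
  moreover have "y u = flow t \<phi> 0 + integral {0..u} (\<lambda>s. f (y (s - r)))" if u: "u \<ge> 0" for u
  proof -
    have int: "(\<lambda>s. f (?x (s - r))) integrable_on {0..t + u}"
      using delayed_integrable[OF adm phi] by (simp add: absolutely_integrable_on_def)
    have "y u = ?x (t + u)" using u R_pos by (simp add: y_def)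
    also have "\<dots> = \<phi> 0 + integral {0..t + u} (\<lambda>s. f (?x (s - r)))"
      using sol_eq[OF phi] t u by simp
    also have "\<dots> = \<phi> 0 + (integral {0..t} (\<lambda>s. f (?x (s - r))) + integral {t..t + u} (\<lambda>s. f (?x (s - r))))"
      using Henstock_Kurzweil_Integration.integral_combine[OF t _ int] u by simp
    also have "\<dots> = ?x t + integral {t..t + u} (\<lambda>s. f (?x (s - r)))"
      using sol_eq[OF phi t] by (simp add: add.assoc)
    also have "integral {t..t + u} (\<lambda>s. f (?x (s - r))) = integral {0..u} (\<lambda>s. f (?x (t + s - r)))"
      using integral_shift_Icc[of 0 u "\<lambda>s. f (?x (s - r))" t] by (simp add: add.commute)
    also have "\<dots> = integral {0..u} (\<lambda>s. f (y (s - r)))"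
      by (rule Henstock_Kurzweil_Integration.integral_cong) (use r_le_R in \<open>auto simp: y_def algebra_simps\<close>)
    finally show ?thesis using R_pos by (simp add: dde_flow_def history_def)
  qed
  ultimately have "is_solution R r f (flow t \<phi>) y"
    by (simp add: is_solution_iff flow_carr phi t)
  then have "sol (flow t \<phi>) = y"
    using solution_unique is_solution_sol flow_carr[OF phi t] by blast
  then show ?thesis
    using s by (auto simp: dde_flow_def history_def y_def fun_eq_iff add.assoc)
qed


section \<open>The flow for times up to the delay\<close>

text \<open>
  The history at time \<open>t\<close> of the solution with right-hand side 0.
\<close>

definition delay_shift :: "real \<Rightarrow> (real \<Rightarrow> real^'n) \<Rightarrow> real \<Rightarrow> real^'n" where
  "delay_shift t h = (\<lambda>\<theta>\<in>I. if t + \<theta> \<le> 0 then h (t + \<theta>) else h 0)"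

text \<open>
  The contribution of a right-hand side \<open>g\<close> to the history at time \<open>t\<close>;
  the maximum makes it vanish at those \<open>\<theta>\<close> for which
  \<open>t + \<theta>\<close> still lies in the initial interval.
\<close>

definition drift :: "real \<Rightarrow> (real \<Rightarrow> real^'n) \<Rightarrow> real \<Rightarrow> real^'n" where
  "drift t g = (\<lambda>\<theta>\<in>I. integral {0..max 0 (t + \<theta>)} (\<lambda>s. g (s - r)))"

text \<open>
  Up to time \<open>r\<close> the delayed argument runs through the initial interval only, so the
  flow is explicit: linear in \<open>\<phi>\<close> but for the superposition operator.
\<close>

lemma flow_eq:
  assumes phi: "\<phi> \<in> carr X" and t: "0 \<le> t" "t \<le> r"
  shows "flow t \<phi> = vadd X (delay_shift t \<phi>) (drift t (\<lambda>\<theta>. f (\<phi> \<theta>)))"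
proof -
  have "sol \<phi> (t + \<theta>) = delay_shift t \<phi> \<theta> + drift t (\<lambda>\<theta>. f (\<phi> \<theta>)) \<theta>" if th: "\<theta> \<in> I" for \<theta>
  proof (cases "t + \<theta> \<le> 0")
    case True
    then show ?thesis using sol_admissible[OF phi] th t
      by (auto simp: admissible_def delay_shift_def drift_def max_def)
  next
    case False
    have "integral {0..t + \<theta>} (\<lambda>s. f (sol \<phi> (s - r))) = integral {0..t + \<theta>} (\<lambda>s. f (\<phi> (s - r)))"
      by (rule Henstock_Kurzweil_Integration.integral_cong)
         (use sol_admissible[OF phi] t th r_le_R in \<open>auto simp: admissible_def\<close>)
    then show ?thesis
      using False sol_eq[OF phi, of "t + \<theta>"] th by (simp add: delay_shift_def drift_def max_def)
  qed
  then show ?thesis by (auto simp: dde_flow_def history_def vadd_X fun_eq_iff)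
qed

text \<open>
  Shifting loses part of the integral of \<open>h\<close> and adds an interval of length
  \<open>t \<le> R\<close> on which the function is constantly \<open>h 0\<close>. The latter is
  bounded by the point mass at 0 in the seminorm.
\<close>

lemma delay_shift_bound:
  assumes h: "h \<in> carr X" and t: "0 \<le> t" "t \<le> r"
  shows "delay_shift t h \<in> carr X" and "vnorm X (delay_shift t h) \<le> (R + 1) powr (1/p) * vnorm X h"
proof -
  let ?g = "\<lambda>\<theta>. if t + \<theta> \<le> 0 then h (t + \<theta>) else h 0"
  have tR: "t \<le> R" using t r_le_R by simp
  have late: "?g \<theta> = h 0" if "\<theta> \<in> {-t..0}" for \<theta>
    using that by (cases "t + \<theta> = 0") auto
  have glue: "(\<lambda>\<theta>. G (?g \<theta>)) absolutely_integrable_on I" if G: "(\<lambda>\<theta>. G (h \<theta>)) absolutely_integrable_on I"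
    for G :: "real^'n \<Rightarrow> 'b::euclidean_space"
  proof (rule absolutely_integrable_glue[where c = "-t"])
    have "(\<lambda>\<theta>. G (h \<theta>)) absolutely_integrable_on {-R + t..-t + t}"
      by (rule absolutely_integrable_on_subinterval[OF G]) (use t in auto)
    then have "(\<lambda>\<theta>. G (h (t + \<theta>))) absolutely_integrable_on {-R..-t}"
      by (rule absolutely_integrable_shift[where g = "\<lambda>\<theta>. G (h \<theta>)", THEN iffD2])
    then show "(\<lambda>\<theta>. G (?g \<theta>)) absolutely_integrable_on {-R..-t}"
      by (rule absolutely_integrable_cong_Icc[THEN iffD1, rotated]) auto
    have "(\<lambda>\<theta>. G (h 0)) absolutely_integrable_on {-t..0}"
      by (rule absolutely_integrable_continuous_real) simp
    moreover have "G (h 0) = G (?g \<theta>)" if "\<theta> \<in> {-t..0}" for \<theta>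
      using late[OF that] by (simp only:)
    ultimately show "(\<lambda>\<theta>. G (?g \<theta>)) absolutely_integrable_on {-t..0}"
      by (rule absolutely_integrable_cong_Icc[THEN iffD1, rotated])
  qed (use t tR in auto)
  have m: "?g \<in> borel_measurable L"
    using glue[OF history_integrable(2)[OF h]]
    by (intro borel_measurable_integrable) (simp add: integrable_lebesgue_on_iff)
  have i: "(\<lambda>\<theta>. \<nu> (?g \<theta>) powr p) absolutely_integrable_on I"
    by (rule glue[OF history_integrable(3)[OF h]])
  then show c: "delay_shift t h \<in> carr X"
    unfolding delay_shift_def by (intro restrict_carr_X m) (simp add: integrable_lebesgue_on_iff)
  have nn: "(LINT \<theta>|L. \<nu> (h \<theta>) powr p) = integral I (\<lambda>\<theta>. \<nu> (h \<theta>) powr p)"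
    using history_integrable(3)[OF h] by (rule integral_lebesgue_on_eq)
  have "(LINT \<theta>|L. \<nu> (delay_shift t h \<theta>) powr p) = (LINT \<theta>|L. \<nu> (?g \<theta>) powr p)"
    by (rule integral_L_cong) (simp add: delay_shift_def)
  also have "\<dots> = integral I (\<lambda>\<theta>. \<nu> (?g \<theta>) powr p)" by (rule integral_lebesgue_on_eq[OF i])
  also have "\<dots> = integral {-R..-t} (\<lambda>\<theta>. \<nu> (?g \<theta>) powr p) + integral {-t..0} (\<lambda>\<theta>. \<nu> (?g \<theta>) powr p)"
    by (rule Henstock_Kurzweil_Integration.integral_combine[symmetric])
       (use t tR i in \<open>auto simp: absolutely_integrable_on_def\<close>)
  also have "integral {-t..0} (\<lambda>\<theta>. \<nu> (?g \<theta>) powr p) = integral {-t..0} (\<lambda>\<theta>. \<nu> (h 0) powr p)"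
    by (rule Henstock_Kurzweil_Integration.integral_cong) (simp only: late)
  also have "\<dots> = t * \<nu> (h 0) powr p" using t by simp
  also have "integral {-R..-t} (\<lambda>\<theta>. \<nu> (?g \<theta>) powr p) = integral {-R..-t} (\<lambda>\<theta>. \<nu> (h (t + \<theta>)) powr p)"
    by (rule Henstock_Kurzweil_Integration.integral_cong) auto
  also have "\<dots> = integral {-R + t..0} (\<lambda>\<theta>. \<nu> (h \<theta>) powr p)"
    using integral_shift_Icc[of "-R" "-t" "\<lambda>\<theta>. \<nu> (h \<theta>) powr p" t] by simp
  also have "\<dots> \<le> integral I (\<lambda>\<theta>. \<nu> (h \<theta>) powr p)"
  proof (rule integral_subset_le)
    have "(\<lambda>\<theta>. \<nu> (h \<theta>) powr p) absolutely_integrable_on {-R + t..0}"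
      by (rule absolutely_integrable_on_subinterval[OF history_integrable(3)[OF h]]) (use t in auto)
    then show "(\<lambda>\<theta>. \<nu> (h \<theta>) powr p) integrable_on {-R + t..0}" by (simp add: absolutely_integrable_on_def)
  qed (use t history_integrable(3)[OF h] in \<open>auto simp: absolutely_integrable_on_def\<close>)
  finally have "(LINT \<theta>|L. \<nu> (delay_shift t h \<theta>) powr p) \<le> (LINT \<theta>|L. \<nu> (h \<theta>) powr p) + t * \<nu> (h 0) powr p"
    by (simp add: nn)
  moreover have "delay_shift t h 0 = h 0" using t R_pos by (auto simp: delay_shift_def)
  moreover have "t * \<nu> (h 0) powr p \<le> R * \<nu> (h 0) powr p" using tR by (intro mult_right_mono) auto
  moreover have "0 \<le> R * (LINT \<theta>|L. \<nu> (h \<theta>) powr p)" using R_pos by simp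
  ultimately have "pmoment (delay_shift t h) \<le> (R + 1) * pmoment h"
    unfolding pmoment_def ring_distribs by simp
  also have "\<dots> = ((R + 1) powr (1/p) * vnorm X h) powr p"
    using R_pos p_pos by (simp add: powr_mult powr_powr vnorm_nonneg pmoment_eq)
  finally show "vnorm X (delay_shift t h) \<le> (R + 1) powr (1/p) * vnorm X h"
    using vnorm_nonneg by (subst vnorm_le_iff) auto
qed

lemma drift_integrable:
  fixes g :: "real \<Rightarrow> 'b::euclidean_space"
  assumes "integrable L g" "0 \<le> u" "u \<le> r"
  shows "(\<lambda>s. g (s - r)) absolutely_integrable_on {0..u}"
proof -
  have "g absolutely_integrable_on I" using assms(1) unfolding integrable_lebesgue_on_iff .
  then have "g absolutely_integrable_on {0 + -r..u + -r}"
    by (rule absolutely_integrable_on_subinterval) (use assms r_le_R in auto)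
  from absolutely_integrable_shift[THEN iffD2, OF this] show ?thesis by simp
qed

lemma norm_drift_le:
  assumes g: "integrable L g" and u: "0 \<le> u" "u \<le> r"
  shows "norm (integral {0..u} (\<lambda>s. g (s - r))) \<le> (LINT \<theta>|L. norm (g \<theta> :: real^'n))"
proof -
  have gi: "(\<lambda>\<theta>. norm (g \<theta>)) absolutely_integrable_on I"
    using g by (simp flip: integrable_lebesgue_on_iff)
  have "norm (integral {0..u} (\<lambda>s. g (s - r))) \<le> integral {0..u} (\<lambda>s. norm (g (s - r)))"
    using drift_integrable[OF g u] by (intro integral_norm_bound_integral) (auto simp: absolutely_integrable_on_def)
  also have "\<dots> = integral {0 + -r..u + -r} (\<lambda>s. norm (g s))"
    using integral_shift_Icc[of 0 u "\<lambda>s. norm (g s)" "-r"] by simp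
  also have "\<dots> \<le> integral I (\<lambda>s. norm (g s))"
  proof (rule integral_subset_le)
    show "(\<lambda>s. norm (g s)) integrable_on {0 + -r..u + -r}"
      using absolutely_integrable_on_subinterval[OF gi, of "0 + -r" "u + -r"] u r_le_R
      by (simp add: absolutely_integrable_on_def)
  qed (use u r_le_R gi in \<open>auto simp: absolutely_integrable_on_def\<close>)
  also have "\<dots> = (LINT \<theta>|L. norm (g \<theta>))" by (rule integral_lebesgue_on_eq[OF gi, symmetric])
  finally show ?thesis .
qed

text \<open>
  The indefinite integral of an \<open>L\<^sup>1\<close> function is bounded by its
  \<open>L\<^sup>1\<close> norm.
\<close>

lemma drift_bound:
  obtains B where "B > 0"
    "\<And>t g. \<lbrakk>0 \<le> t; t \<le> r; integrable L g\<rbrakk> \<Longrightarrow> drift t g \<in> carr X"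
    "\<And>t g. \<lbrakk>0 \<le> t; t \<le> r; integrable L g\<rbrakk> \<Longrightarrow> vnorm X (drift t g) \<le> B * (LINT \<theta>|L. norm (g \<theta>))"
proof -
  obtain c where c: "c > 0" "\<And>x. \<nu> x \<le> c * norm x" using nu_le_norm by blast
  have main: "drift t g \<in> carr X"
    "vnorm X (drift t g) \<le> ((R + 1) powr (1/p) * c) * (LINT \<theta>|L. norm (g \<theta>))"
    if t: "0 \<le> t" "t \<le> r" and g: "integrable L g" for t g
  proof -
    let ?G = "\<lambda>u. integral {0..u} (\<lambda>s. g (s - r))"
    have "continuous_on {0..r} ?G"
      using drift_integrable[OF g, of r] r_pos
      by (intro indefinite_integral_continuous_1) (simp add: absolutely_integrable_on_def)
    then have "continuous_on I (\<lambda>\<theta>. ?G (max 0 (t + \<theta>)))"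
      by (rule continuous_on_compose2) (use t in \<open>auto intro!: continuous_intros\<close>)
    then have m: "(\<lambda>\<theta>. ?G (max 0 (t + \<theta>))) \<in> borel_measurable L"
      by (rule continuous_imp_measurable_on_sets_lebesgue) simp
    then have m': "drift t g \<in> borel_measurable L"
      unfolding drift_def by (rule borel_measurable_L_restrict)
    have b: "\<nu> (drift t g \<theta>) \<le> c * (LINT \<theta>|L. norm (g \<theta>))" if "\<theta> \<in> I" for \<theta>
    proof -
      have "norm (drift t g \<theta>) \<le> (LINT \<theta>|L. norm (g \<theta>))"
        using norm_drift_le[OF g, of "max 0 (t + \<theta>)"] that t r_pos by (simp add: drift_def)
      then show ?thesis using c(2)[of "drift t g \<theta>"] c(1) by (meson less_imp_le mult_left_mono order_trans)
    qed
    have nn: "0 \<le> c * (LINT \<theta>|L. norm (g \<theta>))" using c by simp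
    note vb = vnorm_bounded[OF m' nn b]
    show "vnorm X (drift t g) \<le> ((R + 1) powr (1/p) * c) * (LINT \<theta>|L. norm (g \<theta>))"
      using vb(2) by (simp add: mult.assoc)
    show "drift t g \<in> carr X"
      using vb(1) m' by (simp add: carr_X) (simp add: drift_def)
  qed
  show ?thesis
    by (rule that[OF _ main]) (use c R_pos in auto)
qed

lemma drift_diff:
  assumes "integrable L g" "integrable L h" "0 \<le> t" "t \<le> r"
  shows "drift t (\<lambda>\<theta>. g \<theta> - h \<theta>) = vminus X (drift t g) (drift t h)"
  using drift_integrable[OF assms(1)] drift_integrable[OF assms(2)] assms(3,4)
  by (auto simp: drift_def vminus_X fun_eq_iff absolutely_integrable_on_def max_def
      intro!: Henstock_Kurzweil_Integration.integral_diff)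

lemma drift_add:
  assumes "integrable L g" "integrable L h" "0 \<le> t" "t \<le> r"
  shows "drift t (\<lambda>\<theta>. g \<theta> + h \<theta>) = vadd X (drift t g) (drift t h)"
  using drift_integrable[OF assms(1)] drift_integrable[OF assms(2)] assms(3,4)
  by (auto simp: drift_def vadd_X fun_eq_iff absolutely_integrable_on_def max_def
      intro!: Henstock_Kurzweil_Integration.integral_add)

lemma drift_scale: "drift t (\<lambda>\<theta>. c *\<^sub>R g \<theta>) = vscale X c (drift t g)"
  by (auto simp: drift_def vscale_X fun_eq_iff)

lemma drift_cong:
  assumes "\<And>\<theta>. \<theta> \<in> I \<Longrightarrow> g \<theta> = h \<theta>" "t \<le> r"
  shows "drift t g = drift t h"
  unfolding drift_def
  by (intro restrict_ext Henstock_Kurzweil_Integration.integral_cong)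
     (use assms r_pos r_le_R in \<open>auto simp: max_def split: if_splits\<close>)

text \<open>
  The derivative of the formula in \<open>flow_eq\<close>.
\<close>

definition flow_deriv :: "real \<Rightarrow> (real \<Rightarrow> real^'n) \<Rightarrow> (real \<Rightarrow> real^'n) \<Rightarrow> real \<Rightarrow> real^'n" where
  "flow_deriv t \<phi> = (\<lambda>h\<in>carr X. vadd X (delay_shift t h) (drift t (\<lambda>\<theta>. J (\<phi> \<theta>) *v h \<theta>)))"

lemma flow_deriv_blin:
  assumes phi: "\<phi> \<in> carr X" and t: "0 \<le> t" "t \<le> r"
  shows "flow_deriv t \<phi> \<in> carr (blin_space X X)"
proof -
  obtain B where B: "B > 0"
    "\<And>t g. \<lbrakk>0 \<le> t; t \<le> r; integrable L g\<rbrakk> \<Longrightarrow> drift t g \<in> carr X"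
    "\<And>t g. \<lbrakk>0 \<le> t; t \<le> r; integrable L g\<rbrakk> \<Longrightarrow> vnorm X (drift t g) \<le> B * (LINT \<theta>|L. norm (g \<theta>))"
    by (rule drift_bound) (rule that; assumption)
  obtain K where K: "K \<ge> 0" "\<And>h. h \<in> carr X \<Longrightarrow> integrable L (\<lambda>\<theta>. J (\<phi> \<theta>) *v h \<theta>)"
    "\<And>h. h \<in> carr X \<Longrightarrow> (LINT \<theta>|L. norm (J (\<phi> \<theta>) *v h \<theta>)) \<le> K * vnorm X h"
    by (rule integrable_J[OF phi]) (rule that; assumption)
  let ?S = "(R + 1) powr (1/p)"
  let ?D = "\<lambda>h. vadd X (delay_shift t h) (drift t (\<lambda>\<theta>. J (\<phi> \<theta>) *v h \<theta>))"
  note dc = delay_shift_bound(1)[OF _ t] and ic = B(2)[OF t K(2)]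
  have 1: "flow_deriv t \<phi> \<in> carr X \<rightarrow>\<^sub>E carr X"
    using X.add_closed[OF dc ic] by (auto simp: flow_deriv_def)
  have 2: "?D (vadd X g h) = vadd X (?D g) (?D h)" if gh: "g \<in> carr X" "h \<in> carr X" for g h
  proof -
    have s: "delay_shift t (vadd X g h) = vadd X (delay_shift t g) (delay_shift t h)"
      using t R_pos by (auto simp: delay_shift_def vadd_X fun_eq_iff)
    have "drift t (\<lambda>\<theta>. J (\<phi> \<theta>) *v vadd X g h \<theta>) = drift t (\<lambda>\<theta>. J (\<phi> \<theta>) *v g \<theta> + J (\<phi> \<theta>) *v h \<theta>)"
      by (rule drift_cong) (use t in \<open>auto simp: vadd_X matrix_vector_right_distrib\<close>)
    also have "\<dots> = vadd X (drift t (\<lambda>\<theta>. J (\<phi> \<theta>) *v g \<theta>)) (drift t (\<lambda>\<theta>. J (\<phi> \<theta>) *v h \<theta>))"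
      by (rule drift_add[OF K(2)[OF gh(1)] K(2)[OF gh(2)] t])
    finally show ?thesis unfolding s by (simp add: vadd_X fun_eq_iff algebra_simps)
  qed
  have 3: "?D (vscale X c h) = vscale X c (?D h)" if h: "h \<in> carr X" for c h
  proof -
    have s: "delay_shift t (vscale X c h) = vscale X c (delay_shift t h)"
      using t R_pos by (auto simp: delay_shift_def vscale_X fun_eq_iff)
    have "drift t (\<lambda>\<theta>. J (\<phi> \<theta>) *v vscale X c h \<theta>) = drift t (\<lambda>\<theta>. c *\<^sub>R (J (\<phi> \<theta>) *v h \<theta>))"
      by (rule drift_cong) (use t in \<open>auto simp: vscale_X matrix_vector_mult_scaleR\<close>)
    also have "\<dots> = vscale X c (drift t (\<lambda>\<theta>. J (\<phi> \<theta>) *v h \<theta>))" by (rule drift_scale)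
    finally show ?thesis unfolding s by (simp add: vadd_X vscale_X fun_eq_iff algebra_simps)
  qed
  have 4: "vnorm X (?D h) \<le> (?S + B * K) * vnorm X h" if h: "h \<in> carr X" for h
  proof -
    have "vnorm X (?D h) \<le> vnorm X (delay_shift t h) + vnorm X (drift t (\<lambda>\<theta>. J (\<phi> \<theta>) *v h \<theta>))"
      by (rule vnorm_triangle[OF dc[OF h] ic[OF h]])
    also have "\<dots> \<le> ?S * vnorm X h + B * (K * vnorm X h)"
      using delay_shift_bound(2)[OF h t] B(3)[OF t K(2)[OF h]] mult_left_mono[OF K(3)[OF h] less_imp_le[OF B(1)]]
      by linarith
    finally show ?thesis by (simp add: algebra_simps)
  qed
  show ?thesis
    by (rule X.blinI[OF 1]) (use 2 3 4 in \<open>auto simp: flow_deriv_def X.closed\<close>)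
qed

text \<open>
  Since \<open>drift\<close> is linear, the remainder of the flow is the drift of the remainder
  of the superposition operator, and the increment of the derivative is the drift of the
  increment of \<open>h \<mapsto> Df(\<phi>) h\<close>.
\<close>

theorem flow_C1_short:
  assumes t: "0 \<le> t" "t \<le> r"
  shows "X.C1_self_map (flow t)"
  unfolding X.C1_self_map_def
proof (intro conjI exI[of _ "flow_deriv t"] ballI allI impI)
  obtain B where B: "B > 0"
    "\<And>t g. \<lbrakk>0 \<le> t; t \<le> r; integrable L g\<rbrakk> \<Longrightarrow> drift t g \<in> carr X"
    "\<And>t g. \<lbrakk>0 \<le> t; t \<le> r; integrable L g\<rbrakk> \<Longrightarrow> vnorm X (drift t g) \<le> B * (LINT \<theta>|L. norm (g \<theta>))"
    by (rule drift_bound) (rule that; assumption)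
  have JI: "integrable L (\<lambda>\<theta>. J (\<phi> \<theta>) *v h \<theta>)" if "\<phi> \<in> carr X" "h \<in> carr X" for \<phi> h
    using that integrable_J by blast
  show "flow t \<in> carr X \<rightarrow> carr X" using flow_carr t by auto
  fix \<phi> assume phi: "\<phi> \<in> carr X"
  show "frechet_at X X (flow t) \<phi> (flow_deriv t \<phi>)"
    unfolding frechet_at_def
  proof (intro conjI allI impI flow_deriv_blin phi t)
    fix e :: real assume e: "e > 0"
    obtain d where d: "d > 0" "\<And>h. \<lbrakk>h \<in> carr X; vnorm X h < d\<rbrakk> \<Longrightarrow>
       (LINT \<theta>|L. norm (f (\<phi> \<theta> + h \<theta>) - f (\<phi> \<theta>) - J (\<phi> \<theta>) *v h \<theta>)) \<le> (e / B) * vnorm X h"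
      using superposition_estimate[OF phi divide_pos_pos[OF e B(1)]] by blast
    show "\<exists>d>0. \<forall>h\<in>carr X. vnorm X h < d \<longrightarrow>
        X.gap (vminus X (flow t (vadd X \<phi> h)) (flow t \<phi>)) (flow_deriv t \<phi> h) \<le> e * vnorm X h"
    proof (intro exI[of _ d] conjI ballI impI d(1))
      fix h assume h: "h \<in> carr X" "vnorm X h < d"
      let ?\<psi> = "vadd X \<phi> h"
      have psi: "?\<psi> \<in> carr X" using phi h by (simp add: X.closed)
      let ?g = "\<lambda>\<theta>. f (?\<psi> \<theta>) - f (\<phi> \<theta>) - J (\<phi> \<theta>) *v h \<theta>"
      have gi: "integrable L ?g"
        using integrable_f[OF psi] integrable_f[OF phi] JI[OF phi h(1)] by simp
      have "drift t ?g = vminus X (vminus X (drift t (\<lambda>\<theta>. f (?\<psi> \<theta>))) (drift t (\<lambda>\<theta>. f (\<phi> \<theta>)))) (drift t (\<lambda>\<theta>. J (\<phi> \<theta>) *v h \<theta>))"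
        using integrable_f[OF psi] integrable_f[OF phi] JI[OF phi h(1)] t by (simp add: drift_diff)
      moreover have "delay_shift t ?\<psi> \<theta> = delay_shift t \<phi> \<theta> + delay_shift t h \<theta>" if "\<theta> \<in> I" for \<theta>
        using t R_pos that by (auto simp: delay_shift_def vadd_X)
      ultimately have eq: "vminus X (vminus X (flow t ?\<psi>) (flow t \<phi>)) (flow_deriv t \<phi> h) = drift t ?g"
        using h by (auto simp: flow_eq[OF psi t] flow_eq[OF phi t] flow_deriv_def vminus_X vadd_X[of "delay_shift _ _"] fun_eq_iff)
      have "(LINT \<theta>|L. norm (?g \<theta>)) = (LINT \<theta>|L. norm (f (\<phi> \<theta> + h \<theta>) - f (\<phi> \<theta>) - J (\<phi> \<theta>) *v h \<theta>))"
        by (rule integral_L_cong) (simp add: vadd_X)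
      also have "\<dots> \<le> (e / B) * vnorm X h" by (rule d(2)[OF h])
      finally have "B * (LINT \<theta>|L. norm (?g \<theta>)) \<le> e * vnorm X h" using B(1) by (simp add: field_simps)
      then show "X.gap (vminus X (flow t ?\<psi>) (flow t \<phi>)) (flow_deriv t \<phi> h) \<le> e * vnorm X h"
        unfolding eq using B(3)[OF t gi] by linarith
    qed
  qed
  fix e :: real assume e: "e > 0"
  obtain d where d: "d > 0" "\<And>\<psi> h. \<lbrakk>\<psi> \<in> carr X; X.gap \<psi> \<phi> < d; h \<in> carr X\<rbrakk> \<Longrightarrow>
     (LINT \<theta>|L. norm (J (\<psi> \<theta>) *v h \<theta> - J (\<phi> \<theta>) *v h \<theta>)) \<le> (e / B) * vnorm X h"
    using superposition_derivative_continuous[OF phi divide_pos_pos[OF e B(1)]] by blast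
  show "\<exists>d>0. \<forall>\<psi>\<in>carr X. X.gap \<psi> \<phi> < d \<longrightarrow>
      (\<forall>h\<in>carr X. X.gap (flow_deriv t \<psi> h) (flow_deriv t \<phi> h) \<le> e * vnorm X h)"
  proof (intro exI[of _ d] conjI ballI impI d(1))
    fix \<psi> h assume psi: "\<psi> \<in> carr X" "X.gap \<psi> \<phi> < d" and h: "h \<in> carr X"
    let ?g = "\<lambda>\<theta>. J (\<psi> \<theta>) *v h \<theta> - J (\<phi> \<theta>) *v h \<theta>"
    have gi: "integrable L ?g" using JI[OF psi(1) h] JI[OF phi h] by simp
    have "drift t ?g = vminus X (drift t (\<lambda>\<theta>. J (\<psi> \<theta>) *v h \<theta>)) (drift t (\<lambda>\<theta>. J (\<phi> \<theta>) *v h \<theta>))"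
      by (rule drift_diff[OF JI[OF psi(1) h] JI[OF phi h] t])
    then have eq: "vminus X (flow_deriv t \<psi> h) (flow_deriv t \<phi> h) = drift t ?g"
      using h by (auto simp: flow_deriv_def vminus_X vadd_X fun_eq_iff)
    have "B * (LINT \<theta>|L. norm (?g \<theta>)) \<le> e * vnorm X h"
      using d(2)[OF psi h] B(1) by (simp add: field_simps)
    then show "X.gap (flow_deriv t \<psi> h) (flow_deriv t \<phi> h) \<le> e * vnorm X h"
      unfolding eq using B(3)[OF t gi] by linarith
  qed
qed

text \<open>
  The time-\<open>t\<close> map is the square of the time-\<open>t/2\<close> map, to which the
  chain rule applies.
\<close>

lemma flow_C1_doubling:
  assumes "0 \<le> t" "t \<le> 2 ^ n * r"
  shows "X.C1_self_map (flow t)"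
  using assms
proof (induction n arbitrary: t)
  case 0 then show ?case by (simp add: flow_C1_short)
next
  case (Suc n)
  then have "X.C1_self_map (flow (t / 2))" by simp
  then have c: "X.C1_self_map (\<lambda>\<phi>. flow (t / 2) (flow (t / 2) \<phi>))"
    by (rule X.C1_self_map_compose) fact
  have eq: "flow t \<phi> = flow (t / 2) (flow (t / 2) \<phi>)" if "\<phi> \<in> carr X" for \<phi>
    using flow_add[OF that, of "t / 2" "t / 2"] Suc.prems by simp
  show ?case
    using c unfolding X.C1_self_map_def frechet_at_def
    by (simp add: eq X.closed Pi_iff cong: ball_cong)
qed

theorem flow_C1:
  assumes "0 \<le> t" shows "X.C1_self_map (flow t)"
proof -
  obtain n where "t / r < 2 ^ n" using real_arch_pow[of 2 "t / r"] by auto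
  then show ?thesis using flow_C1_doubling[of t n] assms r_pos by (simp add: field_simps)
qed

end


section \<open>Joint continuity of the flow\<close>

context history_space
begin

text \<open>
  Radial truncation at level \<open>m\<close>: the identity on the ball of radius
  \<open>m\<close>, and continuous.
\<close>

definition truncate :: "real \<Rightarrow> real^'n \<Rightarrow> real^'n" where
  "truncate m y = (m / max m (\<nu> y)) *\<^sub>R y"

lemma continuous_truncate: "m > 0 \<Longrightarrow> continuous_on UNIV (truncate m)"
  unfolding truncate_def
  by (intro continuous_intros continuous_on_nu) (auto simp: max_def)

lemma nu_truncate_le: "m > 0 \<Longrightarrow> \<nu> (truncate m y) \<le> m"
  by (auto simp: truncate_def nu_scale max_def)

lemma truncate_eq: "m > 0 \<Longrightarrow> \<nu> y \<le> m \<Longrightarrow> truncate m y = y"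
  by (simp add: truncate_def max_def)

lemma nu_minus_truncate_le:
  assumes "m > 0" shows "\<nu> (y - truncate m y) \<le> \<nu> y"
proof -
  have "y - truncate m y = (1 - m / max m (\<nu> y)) *\<^sub>R y" by (simp add: truncate_def scaleR_diff_left)
  then have "\<nu> (y - truncate m y) = \<bar>1 - m / max m (\<nu> y)\<bar> * \<nu> y" by (simp only: nu_scale)
  moreover have "0 \<le> m / max m (\<nu> y)" "m / max m (\<nu> y) \<le> 1" using assms by (auto simp: max_def)
  then have "\<bar>1 - m / max m (\<nu> y)\<bar> \<le> 1" by linarith
  then have "\<bar>1 - m / max m (\<nu> y)\<bar> * \<nu> y \<le> 1 * \<nu> y" by (rule mult_right_mono) simp
  ultimately show ?thesis by simp
qed

lemma nu_powr_triangle: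
  "\<nu> (x - w) powr p \<le> 2 powr (p - 1) * (\<nu> (x - y) powr p + \<nu> (y - w) powr p)"
proof -
  have "\<nu> (x - w) powr p \<le> (\<nu> (x - y) + \<nu> (y - w)) powr p"
    using nu_triangle[of "x - y" "y - w"] p_pos by (intro powr_mono2) auto
  also have "\<dots> \<le> 2 powr (p - 1) * (\<nu> (x - y) powr p + \<nu> (y - w) powr p)"
    using p_ge_1 by (intro powr_add_le) auto
  finally show ?thesis .
qed

text \<open>
  A measurable function is the almost everywhere limit of continuous functions. Truncating both
  makes the convergence dominated, hence valid in \<open>L\<^sup>p\<close>; the truncation error
  of \<open>x\<close> itself is small for a high level.
\<close>

lemma continuous_functions_dense:
  fixes a b :: real and x :: "real \<Rightarrow> real^'n"
  defines "M \<equiv> lebesgue_on {a..b}"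
  assumes x: "x \<in> borel_measurable M" and xi: "integrable M (\<lambda>s. \<nu> (x s) powr p)" and e: "e > 0"
  obtains g where "continuous_on UNIV g" "integrable M (\<lambda>s. \<nu> (x s - g s) powr p)"
    "(LINT s|M. \<nu> (x s - g s) powr p) < e"
proof -
  note [measurable] = x
  define P where "P = (2::real) powr (p - 1)"
  have P: "P > 0" by (simp add: P_def)
  define e1 where "e1 = e / (2 * P)"
  have e1: "e1 > 0" using e P by (simp add: e1_def)
  have fin: "finite_measure M" unfolding M_def by (rule finite_measure_lebesgue_on) simp
  have tm [measurable]: "truncate m \<in> borel_measurable borel" if "m > 0" for m
    by (rule borel_measurable_continuous_onI[OF continuous_truncate[OF that]])
  have m1: "(\<lambda>s. \<nu> (x s - truncate m (x s)) powr p) \<in> borel_measurable M" if "m > 0" for m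
    using tm[OF that] by measurable
  have "(\<lambda>n. LINT s|M. \<nu> (x s - truncate (real (Suc n)) (x s)) powr p) \<longlonglongrightarrow> (LINT s|M. 0)"
  proof (rule integral_dominated_convergence[where w = "\<lambda>s. \<nu> (x s) powr p"])
    show "AE s in M. (\<lambda>n. \<nu> (x s - truncate (real (Suc n)) (x s)) powr p) \<longlonglongrightarrow> 0"
    proof (rule AE_I2)
      fix s
      obtain N :: nat where N: "\<nu> (x s) < real N" using reals_Archimedean2 by blast
      have "eventually (\<lambda>n. \<nu> (x s - truncate (real (Suc n)) (x s)) powr p = 0) sequentially"
        using eventually_ge_at_top[of N] by eventually_elim (use N in \<open>simp add: truncate_eq\<close>)
      then show "(\<lambda>n. \<nu> (x s - truncate (real (Suc n)) (x s)) powr p) \<longlonglongrightarrow> 0" by (rule tendsto_eventually)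
    qed
    show "AE s in M. norm (\<nu> (x s - truncate (real (Suc n)) (x s)) powr p) \<le> \<nu> (x s) powr p" for n
      by (rule AE_I2) (use p_pos nu_minus_truncate_le in \<open>auto intro!: powr_mono2\<close>)
  qed (use xi m1 in auto)
  then have "eventually (\<lambda>n. (LINT s|M. \<nu> (x s - truncate (real (Suc n)) (x s)) powr p) < e1) sequentially"
    using e1 by (intro order_tendstoD) auto
  then obtain n0 where n0: "(LINT s|M. \<nu> (x s - truncate (real (Suc n0)) (x s)) powr p) < e1"
    by (auto simp: eventually_sequentially)
  define m where "m = real (Suc n0)"
  have m: "m > 0" by (simp add: m_def)
  have i1: "integrable M (\<lambda>s. \<nu> (x s - truncate m (x s)) powr p)"
    by (rule Bochner_Integration.integrable_bound[OF xi m1[OF m]])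
       (rule AE_I2, use m p_pos nu_minus_truncate_le in \<open>auto intro!: powr_mono2\<close>)
  have "x measurable_on {a..b}" using x by (simp add: M_def measurable_on_iff_borel_measurable)
  then obtain N g where N: "negligible N" and g: "\<And>n. continuous_on UNIV (g n)"
    and lim: "\<And>s. s \<notin> N \<Longrightarrow> (\<lambda>n. g n s) \<longlonglongrightarrow> (if s \<in> {a..b} then x s else 0)"
    unfolding measurable_on_def by blast
  let ?g = "\<lambda>n s. truncate m (g n s)"
  have gc: "continuous_on UNIV (?g n)" for n
    using continuous_on_compose2[OF continuous_truncate[OF m] g] by blast
  have gm [measurable]: "?g n \<in> borel_measurable M" for n
    unfolding M_def by (intro continuous_imp_measurable_on_sets_lebesgue continuous_on_subset[OF gc]) auto
  have tx [measurable]: "(\<lambda>s. truncate m (x s)) \<in> borel_measurable M"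
    using tm[OF m] by measurable
  have bd: "\<nu> (truncate m y - truncate m z) powr p \<le> (2 * m) powr p" for y z
    using nu_diff[of "truncate m y" "truncate m z"] nu_truncate_le[OF m, of y] nu_truncate_le[OF m, of z] p_pos
    by (intro powr_mono2) auto
  have ci: "integrable M (\<lambda>_. (2 * m) powr p)" by (rule finite_measure.integrable_const[OF fin])
  have aeN: "AE s in M. s \<notin> N"
    unfolding M_def using N
    by (subst AE_restrict_space_iff) (auto simp: negligible_iff_null_sets intro!: AE_I' elim: null_setsD1)
  have "(\<lambda>n. LINT s|M. \<nu> (truncate m (x s) - ?g n s) powr p) \<longlonglongrightarrow> (LINT s|M. 0)"
  proof (rule integral_dominated_convergence[where w = "\<lambda>s. (2 * m) powr p"])
    show "AE s in M. (\<lambda>n. \<nu> (truncate m (x s) - ?g n s) powr p) \<longlonglongrightarrow> 0"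
      using aeN AE_space
    proof eventually_elim
      case (elim s)
      then have "(\<lambda>n. g n s) \<longlonglongrightarrow> x s" using lim[of s] by (simp add: M_def)
      moreover have "continuous_on UNIV (\<lambda>y. \<nu> (truncate m (x s) - truncate m y) powr p)"
        using p_pos by (intro continuous_on_powr' continuous_intros continuous_truncate m) auto
      then have "isCont (\<lambda>y. \<nu> (truncate m (x s) - truncate m y) powr p) (x s)"
        by (simp add: continuous_on_eq_continuous_at)
      ultimately have "(\<lambda>n. \<nu> (truncate m (x s) - ?g n s) powr p) \<longlonglongrightarrow> \<nu> (truncate m (x s) - truncate m (x s)) powr p"
        by (rule isCont_tendsto_compose[rotated])
      then show ?case by simp
    qed
    show "AE s in M. norm (\<nu> (truncate m (x s) - ?g n s) powr p) \<le> (2 * m) powr p" for n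
      by (rule AE_I2) (use bd in simp)
  qed (use ci in auto)
  then have "eventually (\<lambda>n. (LINT s|M. \<nu> (truncate m (x s) - ?g n s) powr p) < e1) sequentially"
    using e1 by (intro order_tendstoD) auto
  then obtain n where n: "(LINT s|M. \<nu> (truncate m (x s) - ?g n s) powr p) < e1"
    by (auto simp: eventually_sequentially)
  have i2: "integrable M (\<lambda>s. \<nu> (truncate m (x s) - ?g n s) powr p)"
    by (rule Bochner_Integration.integrable_bound[OF ci]) (measurable, rule AE_I2, use bd in simp)
  have i12: "integrable M (\<lambda>s. P * (\<nu> (x s - truncate m (x s)) powr p + \<nu> (truncate m (x s) - ?g n s) powr p))"
    using i1 i2 by simp
  have pt: "\<nu> (x s - ?g n s) powr p \<le> P * (\<nu> (x s - truncate m (x s)) powr p + \<nu> (truncate m (x s) - ?g n s) powr p)" for s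
    unfolding P_def by (rule nu_powr_triangle)
  have i3: "integrable M (\<lambda>s. \<nu> (x s - ?g n s) powr p)"
  proof (rule Bochner_Integration.integrable_bound[OF i12])
    show "AE s in M. norm (\<nu> (x s - ?g n s) powr p)
        \<le> norm (P * (\<nu> (x s - truncate m (x s)) powr p + \<nu> (truncate m (x s) - ?g n s) powr p))"
      by (rule AE_I2) (use pt P in \<open>simp add: abs_mult\<close>)
  qed measurable
  have "(LINT s|M. \<nu> (x s - ?g n s) powr p)
      \<le> (LINT s|M. P * (\<nu> (x s - truncate m (x s)) powr p + \<nu> (truncate m (x s) - ?g n s) powr p))"
    by (rule integral_mono[OF i3 i12 pt])
  also have "\<dots> = P * ((LINT s|M. \<nu> (x s - truncate m (x s)) powr p) + (LINT s|M. \<nu> (truncate m (x s) - ?g n s) powr p))"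
    using i1 i2 by simp
  also have "\<dots> < P * (e1 + e1)"
    using n0 n P by (intro mult_strict_left_mono add_strict_mono) (auto simp: m_def)
  also have "\<dots> = e" using P by (simp add: e1_def)
  finally show ?thesis by (intro that[OF gc i3])
qed

end

context delay_equation
begin

text \<open>
  Continuity of translation in \<open>L\<^sup>p\<close>. On the interval
  \<open>[-R, t0 + 1]\<close> the trajectory is replaced by a continuous \<open>g\<close> at the
  cost of two error terms below \<open>\<eta>\<close>, and \<open>g\<close> is uniformly
  continuous there. The point mass at 0 is handled by continuity of the trajectory at
  \<open>t0\<close>. The constants \<open>\<eta>\<close>, \<open>\<zeta>\<close> and
  \<open>\<xi>\<close> distribute the \<open>p\<close>-th power of \<open>e / 2\<close> over
  these contributions.
\<close>

lemma history_continuous: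
  assumes adm: "admissible \<phi> x" and phi: "\<phi> \<in> carr X" and t0: "t0 \<ge> 0" and e: "e > 0"
  shows "\<exists>d>0. \<forall>t\<ge>0. \<bar>t - t0\<bar> < d \<longrightarrow> X.gap (history R t x) (history R t0 x) < e"
proof -
  let ?b = "t0 + 1"
  define E where "E = (e / 2) powr p"
  define P where "P = (2::real) powr (p - 1)"
  have P: "P \<ge> 1" unfolding P_def using p_gt_1 by (simp add: ge_one_powr_ge_zero)
  have E: "E > 0" using e by (simp add: E_def)
  define \<eta> where "\<eta> = E / (8 * P * P)"
  have eta: "\<eta> > 0" "P * P * (2 * \<eta>) = E / 4" using E P by (auto simp: \<eta>_def)
  define \<zeta> where "\<zeta> = (E / (4 * P * P * R)) powr (1 / p)"
  have zeta: "\<zeta> > 0" "P * P * (R * \<zeta> powr p) = E / 4"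
    using E P R_pos p_pos by (auto simp: \<zeta>_def powr_powr)
  define \<xi> where "\<xi> = (E / 2) powr (1 / p)"
  have xi: "\<xi> > 0" "\<xi> powr p = E / 2" using E p_pos by (auto simp: \<xi>_def powr_powr)
  have xm: "x \<in> borel_measurable (lebesgue_on {-R..?b})"
    using absolutely_integrable_admissible[OF adm history_integrable(2)[OF phi] continuous_on_id, of "-R" ?b]
    by (intro borel_measurable_integrable) (simp add: integrable_lebesgue_on_iff)
  have xi': "integrable (lebesgue_on {-R..?b}) (\<lambda>s. \<nu> (x s) powr p)"
    using absolutely_integrable_admissible[OF adm history_integrable(3)[OF phi] continuous_on_nu_powr, of "-R" ?b]
    by (simp add: integrable_lebesgue_on_iff)
  obtain g where g: "continuous_on UNIV g"
    and gi: "integrable (lebesgue_on {-R..?b}) (\<lambda>s. \<nu> (x s - g s) powr p)"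
    and gl: "(LINT s|lebesgue_on {-R..?b}. \<nu> (x s - g s) powr p) < \<eta>"
    using continuous_functions_dense[OF xm xi' eta(1)] .
  let ?q = "\<lambda>s. \<nu> (x s - g s) powr p"
  have qi: "?q absolutely_integrable_on {-R..?b}" using gi by (simp add: integrable_lebesgue_on_iff)
  have ql: "integral {-R..?b} ?q < \<eta>" using gl integral_lebesgue_on_eq[OF qi] by simp
  have shift: "(\<lambda>\<theta>. ?q (t + \<theta>)) absolutely_integrable_on I" "(LINT \<theta>|L. ?q (t + \<theta>)) \<le> \<eta>"
    if t: "0 \<le> t" "t \<le> ?b" for t
  proof -
    have sub: "?q absolutely_integrable_on {-R + t..0 + t}"
      by (rule absolutely_integrable_on_subinterval[OF qi]) (use t in auto)
    then show i: "(\<lambda>\<theta>. ?q (t + \<theta>)) absolutely_integrable_on I"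
      by (rule absolutely_integrable_shift[where g = ?q, THEN iffD2])
    have "(LINT \<theta>|L. ?q (t + \<theta>)) = integral {-R + t..0 + t} ?q"
      unfolding integral_lebesgue_on_eq[OF i] by (rule integral_shift_Icc)
    also have "\<dots> \<le> integral {-R..?b} ?q"
      by (rule integral_subset_le) (use t sub qi in \<open>auto simp: absolutely_integrable_on_def\<close>)
    finally show "(LINT \<theta>|L. ?q (t + \<theta>)) \<le> \<eta>" using ql by simp
  qed
  obtain c where c: "c > 0" "\<And>x. \<nu> x \<le> c * norm x" using nu_le_norm by blast
  have "uniformly_continuous_on {-R..?b} g"
    by (rule compact_uniformly_continuous[OF continuous_on_subset[OF g]]) auto
  then obtain d1 where d1: "d1 > 0" "\<And>u v. \<lbrakk>u \<in> {-R..?b}; v \<in> {-R..?b}; dist v u < d1\<rbrakk> \<Longrightarrow> dist (g v) (g u) < \<zeta> / c"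
    using divide_pos_pos[OF zeta(1) c(1)] unfolding uniformly_continuous_on_def by metis
  have close_g: "\<nu> (g v - g u) powr p \<le> \<zeta> powr p"
    if "u \<in> {-R..?b}" "v \<in> {-R..?b}" "\<bar>v - u\<bar> < d1" for u v
  proof -
    have "c * norm (g v - g u) \<le> \<zeta>"
      using d1(2)[OF that(1,2)] that(3) c(1) by (simp add: dist_norm field_simps)
    then show ?thesis using c(2)[of "g v - g u"] p_pos by (intro powr_mono2) auto
  qed
  have "continuous_on {0..} x" using adm by (simp add: admissible_def)
  then obtain d2 where d2: "d2 > 0" "\<And>t. \<lbrakk>t \<ge> 0; dist t t0 < d2\<rbrakk> \<Longrightarrow> dist (x t) (x t0) < \<xi> / c"
    using t0 divide_pos_pos[OF xi(1) c(1)] unfolding continuous_on_iff by (metis atLeast_iff)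
  show ?thesis
  proof (intro exI[of _ "Min {1, d1, d2}"] conjI allI impI)
    show "Min {1, d1, d2} > 0" using d1 d2 by simp
    fix t :: real assume t: "t \<ge> 0" "\<bar>t - t0\<bar> < Min {1, d1, d2}"
    let ?h = "vminus X (history R t x) (history R t0 x)"
    have hh: "?h \<in> carr X" using history_carr[OF adm phi] t t0 by (simp add: X.closed)
    have h: "?h \<theta> = x (t + \<theta>) - x (t0 + \<theta>)" if "\<theta> \<in> I" for \<theta>
      using that by (simp add: vminus_X history_def)
    have tb: "0 \<le> t" "t \<le> ?b" "0 \<le> t0" "t0 \<le> ?b" using t t0 by auto
    have pt: "\<nu> (?h \<theta>) powr p \<le> P * P * (?q (t + \<theta>) + (\<zeta> powr p + ?q (t0 + \<theta>)))" if th: "\<theta> \<in> I" for \<theta>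
    proof -
      have "\<nu> (?h \<theta>) powr p \<le> P * (?q (t + \<theta>) + \<nu> (g (t + \<theta>) - x (t0 + \<theta>)) powr p)"
        unfolding h[OF th] P_def by (rule nu_powr_triangle)
      also have "\<dots> \<le> P * (P * ?q (t + \<theta>) + P * (\<nu> (g (t + \<theta>) - g (t0 + \<theta>)) powr p + ?q (t0 + \<theta>)))"
      proof (intro mult_left_mono add_mono)
        show "?q (t + \<theta>) \<le> P * ?q (t + \<theta>)" using P mult_right_mono[of 1 P "?q (t + \<theta>)"] by simp
        show "\<nu> (g (t + \<theta>) - x (t0 + \<theta>)) powr p \<le> P * (\<nu> (g (t + \<theta>) - g (t0 + \<theta>)) powr p + ?q (t0 + \<theta>))"
          using nu_powr_triangle[of "g (t + \<theta>)" "x (t0 + \<theta>)" "g (t0 + \<theta>)"]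
          by (simp add: P_def nu_minus_commute)
      qed (use P in simp)
      also have "\<dots> \<le> P * (P * ?q (t + \<theta>) + P * (\<zeta> powr p + ?q (t0 + \<theta>)))"
        using P th t tb R_pos by (intro mult_left_mono add_mono close_g) auto
      also have "\<dots> = P * P * (?q (t + \<theta>) + (\<zeta> powr p + ?q (t0 + \<theta>)))" by (simp add: algebra_simps)
      finally show ?thesis .
    qed
    note s1 = shift[OF tb(1,2)] and s2 = shift[OF tb(3,4)]
    have i1: "integrable L (\<lambda>\<theta>. ?q (t + \<theta>))" and i2: "integrable L (\<lambda>\<theta>. ?q (t0 + \<theta>))"
      using s1(1) s2(1) unfolding integrable_lebesgue_on_iff by blast+
    have i3: "integrable L (\<lambda>\<theta>. \<zeta> powr p + ?q (t0 + \<theta>))"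
      by (intro Bochner_Integration.integrable_add i2 integrable_L_const)
    have "(LINT \<theta>|L. \<nu> (?h \<theta>) powr p) \<le> (LINT \<theta>|L. P * P * (?q (t + \<theta>) + (\<zeta> powr p + ?q (t0 + \<theta>))))"
      by (intro integral_mono carr_XD(3)[OF hh] integrable_mult_right Bochner_Integration.integrable_add i1 i3)
         (use pt in simp)
    also have "\<dots> = P * P * ((LINT \<theta>|L. ?q (t + \<theta>)) + (R * \<zeta> powr p + (LINT \<theta>|L. ?q (t0 + \<theta>))))"
      using i1 i2 i3 integrable_L_const by (simp add: measure_L)
    also have "\<dots> \<le> P * P * (\<eta> + (R * \<zeta> powr p + \<eta>))"
      using s1(2) s2(2) P R_pos by (intro mult_left_mono add_mono) auto
    also have "\<dots> = P * P * (2 * \<eta>) + P * P * (R * \<zeta> powr p)" by (simp add: algebra_simps)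
    also have "\<dots> = E / 2" using eta zeta by simp
    finally have int: "(LINT \<theta>|L. \<nu> (?h \<theta>) powr p) \<le> E / 2" .
    have "\<nu> (?h 0) \<le> \<xi>"
    proof -
      have "c * norm (x t - x t0) \<le> \<xi>"
        using d2(2)[OF t(1)] t(2) c(1) by (simp add: dist_norm field_simps)
      then show ?thesis using c(2)[of "x t - x t0"] h[OF zero_in_I] by simp
    qed
    then have "\<nu> (?h 0) powr p \<le> E / 2" using p_pos xi(2) powr_mono2[of p "\<nu> (?h 0)" \<xi>] by simp
    then have "pmoment ?h \<le> (e / 2) powr p" using int by (simp add: pmoment_def E_def)
    then have "vnorm X ?h \<le> e / 2" using e by (subst vnorm_le_iff) auto
    then show "vnorm X ?h < e" using e by simp
  qed
qed

text \<open>
  The bounds for \<open>delay_shift\<close> and \<open>drift\<close> do not depend on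
  \<open>t\<close>, so neither does the Lipschitz constant. This uniformity is what joint
  continuity requires beyond the continuity of each time map.
\<close>

lemma flow_uniformly_lipschitz:
  assumes phi: "\<phi> \<in> carr X"
  obtains d K where "d > 0" "K > 0" "\<And>t \<psi>. \<lbrakk>0 \<le> t; t \<le> r; \<psi> \<in> carr X; X.gap \<psi> \<phi> < d\<rbrakk> \<Longrightarrow>
     X.gap (flow t \<psi>) (flow t \<phi>) \<le> K * X.gap \<psi> \<phi>"
proof -
  obtain B where B: "B > 0"
    "\<And>t g. \<lbrakk>0 \<le> t; t \<le> r; integrable L g\<rbrakk> \<Longrightarrow> drift t g \<in> carr X"
    "\<And>t g. \<lbrakk>0 \<le> t; t \<le> r; integrable L g\<rbrakk> \<Longrightarrow> vnorm X (drift t g) \<le> B * (LINT \<theta>|L. norm (g \<theta>))"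
    by (rule drift_bound) (rule that; assumption)
  obtain K where K: "K \<ge> 0" "\<And>h. h \<in> carr X \<Longrightarrow> integrable L (\<lambda>\<theta>. J (\<phi> \<theta>) *v h \<theta>)"
    "\<And>h. h \<in> carr X \<Longrightarrow> (LINT \<theta>|L. norm (J (\<phi> \<theta>) *v h \<theta>)) \<le> K * vnorm X h"
    by (rule integrable_J[OF phi]) (rule that; assumption)
  obtain d where d: "d > 0" "\<And>h. \<lbrakk>h \<in> carr X; vnorm X h < d\<rbrakk> \<Longrightarrow>
       (LINT \<theta>|L. norm (f (\<phi> \<theta> + h \<theta>) - f (\<phi> \<theta>) - J (\<phi> \<theta>) *v h \<theta>)) \<le> 1 * vnorm X h"
    using superposition_estimate[OF phi zero_less_one] by blast
  let ?S = "(R + 1) powr (1/p)"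
  show ?thesis
  proof (rule that[of d "?S + B * (1 + K)"])
    show "?S + B * (1 + K) > 0" using B K R_pos by (simp add: add_pos_pos)
    fix t \<psi> assume t: "0 \<le> t" "t \<le> r" and psi: "\<psi> \<in> carr X" "X.gap \<psi> \<phi> < d"
    let ?k = "vminus X \<psi> \<phi>"
    have k: "?k \<in> carr X" using psi phi by (simp add: X.closed)
    let ?g = "\<lambda>\<theta>. f (\<psi> \<theta>) - f (\<phi> \<theta>)"
    have fi: "integrable L (\<lambda>\<theta>. f (\<psi> \<theta>))" "integrable L (\<lambda>\<theta>. f (\<phi> \<theta>))"
      using integrable_f psi phi by auto
    then have gi: "integrable L ?g" by simp
    have i1: "integrable L (\<lambda>\<theta>. norm (?g \<theta> - J (\<phi> \<theta>) *v ?k \<theta>))" and i2: "integrable L (\<lambda>\<theta>. norm (J (\<phi> \<theta>) *v ?k \<theta>))"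
      using gi K(2)[OF k] by auto
    have "(LINT \<theta>|L. norm (?g \<theta>)) \<le> (LINT \<theta>|L. norm (?g \<theta> - J (\<phi> \<theta>) *v ?k \<theta>) + norm (J (\<phi> \<theta>) *v ?k \<theta>))"
    proof (rule integral_mono)
      show "norm (?g \<theta>) \<le> norm (?g \<theta> - J (\<phi> \<theta>) *v ?k \<theta>) + norm (J (\<phi> \<theta>) *v ?k \<theta>)" for \<theta>
        using norm_triangle_ineq[of "?g \<theta> - J (\<phi> \<theta>) *v ?k \<theta>" "J (\<phi> \<theta>) *v ?k \<theta>"] by simp
    qed (use gi i1 i2 in auto)
    also have "\<dots> = (LINT \<theta>|L. norm (?g \<theta> - J (\<phi> \<theta>) *v ?k \<theta>)) + (LINT \<theta>|L. norm (J (\<phi> \<theta>) *v ?k \<theta>))"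
      by (rule Bochner_Integration.integral_add[OF i1 i2])
    also have "(LINT \<theta>|L. norm (?g \<theta> - J (\<phi> \<theta>) *v ?k \<theta>))
        = (LINT \<theta>|L. norm (f (\<phi> \<theta> + ?k \<theta>) - f (\<phi> \<theta>) - J (\<phi> \<theta>) *v ?k \<theta>))"
      by (rule integral_L_cong) (simp add: vminus_X)
    also have "\<dots> + (LINT \<theta>|L. norm (J (\<phi> \<theta>) *v ?k \<theta>)) \<le> (1 + K) * vnorm X ?k"
      using d(2)[OF k psi(2)] K(3)[OF k] by (simp add: ring_distribs)
    finally have est: "B * (LINT \<theta>|L. norm (?g \<theta>)) \<le> B * ((1 + K) * vnorm X ?k)"
      using B(1) by (intro mult_left_mono) auto
    have "drift t ?g = vminus X (drift t (\<lambda>\<theta>. f (\<psi> \<theta>))) (drift t (\<lambda>\<theta>. f (\<phi> \<theta>)))"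
      by (rule drift_diff[OF fi t])
    moreover have "delay_shift t ?k = vminus X (delay_shift t \<psi>) (delay_shift t \<phi>)"
      using t R_pos by (auto simp: delay_shift_def vminus_X fun_eq_iff)
    ultimately have "vminus X (flow t \<psi>) (flow t \<phi>) = vadd X (delay_shift t ?k) (drift t ?g)"
      using X.add_minus_add delay_shift_bound(1)[OF _ t] B(2)[OF t] fi psi phi
      by (simp add: flow_eq[OF psi(1) t] flow_eq[OF phi t])
    then have "X.gap (flow t \<psi>) (flow t \<phi>) \<le> vnorm X (delay_shift t ?k) + vnorm X (drift t ?g)"
      using vnorm_triangle[OF delay_shift_bound(1)[OF k t] B(2)[OF t gi]] by simp
    also have "\<dots> \<le> ?S * vnorm X ?k + B * ((1 + K) * vnorm X ?k)"
      using delay_shift_bound(2)[OF k t] B(3)[OF t gi] est by linarith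
    finally show "X.gap (flow t \<psi>) (flow t \<phi>) \<le> (?S + B * (1 + K)) * vnorm X ?k"
      by (simp add: algebra_simps)
  qed (fact d)
qed

text \<open>
  Up to time \<open>r\<close>, a change of history is controlled uniformly in time and a change
  of time by \<open>history_continuous\<close>. From there on, time intervals are doubled as in
  \<open>flow_C1_doubling\<close>.
\<close>

lemma flow_continuous_doubling:
  assumes "0 \<le> t0" "t0 \<le> 2 ^ n * r" "\<phi> \<in> carr X" "e > 0"
  shows "\<exists>d>0. \<forall>t \<psi>. 0 \<le> t \<longrightarrow> t \<le> 2 ^ n * r \<longrightarrow> \<psi> \<in> carr X \<longrightarrow> \<bar>t - t0\<bar> < d \<longrightarrow>
     X.gap \<psi> \<phi> < d \<longrightarrow> X.gap (flow t \<psi>) (flow t0 \<phi>) < e"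
  using assms
proof (induction n arbitrary: t0 \<phi> e)
  case 0
  note phi = \<open>\<phi> \<in> carr X\<close>
  have e2: "e / 2 > 0" using 0 by simp
  obtain d1 K where K: "d1 > 0" "K > 0" "\<And>t \<psi>. \<lbrakk>0 \<le> t; t \<le> r; \<psi> \<in> carr X; X.gap \<psi> \<phi> < d1\<rbrakk> \<Longrightarrow>
     X.gap (flow t \<psi>) (flow t \<phi>) \<le> K * X.gap \<psi> \<phi>"
    by (rule flow_uniformly_lipschitz[OF phi]) (rule that; assumption)
  obtain d2 where d2: "d2 > 0" "\<And>t. \<lbrakk>t \<ge> 0; \<bar>t - t0\<bar> < d2\<rbrakk> \<Longrightarrow>
      X.gap (flow t \<phi>) (flow t0 \<phi>) < e / 2"
    using history_continuous[OF sol_admissible[OF phi] phi _ e2] 0 unfolding dde_flow_def by blast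
  show ?case
  proof (intro exI[of _ "Min {d1, d2, e / (2 * K)}"] conjI allI impI)
    show "Min {d1, d2, e / (2 * K)} > 0" using K d2 0 by simp
    fix t \<psi> assume t: "0 \<le> t" "t \<le> 2 ^ 0 * r" and psi: "\<psi> \<in> carr X"
      and close: "\<bar>t - t0\<bar> < Min {d1, d2, e / (2 * K)}" "X.gap \<psi> \<phi> < Min {d1, d2, e / (2 * K)}"
    have "X.gap (flow t \<psi>) (flow t \<phi>) \<le> K * X.gap \<psi> \<phi>"
      using K(3) t psi close by simp
    also have "\<dots> < e / 2" using close K(2) by (simp add: field_simps)
    finally show "X.gap (flow t \<psi>) (flow t0 \<phi>) < e"
      using X.norm_minus_triangle[of "flow t \<psi>" "flow t \<phi>" "flow t0 \<phi>"] d2(2)[OF t(1)] close(1)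
        flow_carr psi phi t 0 by simp
  qed
next
  case (Suc n)
  let ?s0 = "t0 / 2"
  have s0: "0 \<le> ?s0" "?s0 \<le> 2 ^ n * r" using Suc.prems by auto
  have phi: "\<phi> \<in> carr X" "flow ?s0 \<phi> \<in> carr X" using Suc.prems flow_carr s0 by auto
  obtain d1 where d1: "d1 > 0" "\<And>t \<psi>. \<lbrakk>0 \<le> t; t \<le> 2 ^ n * r; \<psi> \<in> carr X; \<bar>t - ?s0\<bar> < d1;
      X.gap \<psi> (flow ?s0 \<phi>) < d1\<rbrakk> \<Longrightarrow> X.gap (flow t \<psi>) (flow ?s0 (flow ?s0 \<phi>)) < e"
    using Suc.IH[OF s0 phi(2) Suc.prems(4)] by blast
  obtain d2 where d2: "d2 > 0" "\<And>t \<psi>. \<lbrakk>0 \<le> t; t \<le> 2 ^ n * r; \<psi> \<in> carr X; \<bar>t - ?s0\<bar> < d2;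
      X.gap \<psi> \<phi> < d2\<rbrakk> \<Longrightarrow> X.gap (flow t \<psi>) (flow ?s0 \<phi>) < d1"
    using Suc.IH[OF s0 phi(1) d1(1)] by blast
  have half: "flow t \<psi> = flow (t / 2) (flow (t / 2) \<psi>)" if "t \<ge> 0" "\<psi> \<in> carr X" for t \<psi>
    using flow_add[OF that(2), of "t / 2" "t / 2"] that(1) by simp
  show ?case
  proof (intro exI[of _ "min d1 d2"] conjI allI impI)
    show "min d1 d2 > 0" using d1 d2 by simp
    fix t \<psi> assume t: "0 \<le> t" "t \<le> 2 ^ Suc n * r" "\<psi> \<in> carr X" "\<bar>t - t0\<bar> < min d1 d2"
      "X.gap \<psi> \<phi> < min d1 d2"
    have close: "\<bar>t / 2 - ?s0\<bar> < d1" "\<bar>t / 2 - ?s0\<bar> < d2" using t(4) by (auto simp: abs_if)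
    have "X.gap (flow (t / 2) \<psi>) (flow ?s0 \<phi>) < d1"
      using d2(2)[of "t / 2" \<psi>] t close by simp
    then have "X.gap (flow (t / 2) (flow (t / 2) \<psi>)) (flow ?s0 (flow ?s0 \<phi>)) < e"
      using d1(2)[of "t / 2" "flow (t / 2) \<psi>"] t close flow_carr by simp
    then show "X.gap (flow t \<psi>) (flow t0 \<phi>) < e"
      using half[of t \<psi>] half[of t0 \<phi>] t Suc.prems by simp
  qed
qed

theorem flow_jointly_continuous:
  assumes "0 \<le> t0" "\<phi> \<in> carr X" "e > 0"
  shows "\<exists>d>0. \<forall>t\<ge>0. \<forall>\<psi>\<in>carr X. \<bar>t - t0\<bar> < d \<longrightarrow> X.gap \<psi> \<phi> < d \<longrightarrow>
     X.gap (flow t \<psi>) (flow t0 \<phi>) < e"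
proof -
  \<comment> \<open>The margin 1 keeps all times near \<open>t0\<close> below the bound \<open>2 ^ n * r\<close>.\<close>
  obtain n where "(t0 + 1) / r < 2 ^ n" using real_arch_pow[of 2 "(t0 + 1) / r"] by auto
  then have n: "t0 + 1 \<le> 2 ^ n * r" using r_pos by (simp add: field_simps)
  then have "t0 \<le> 2 ^ n * r" by simp
  from flow_continuous_doubling[OF assms(1) this assms(2,3)]
  obtain d where d: "d > 0" "\<And>t \<psi>. \<lbrakk>0 \<le> t; t \<le> 2 ^ n * r; \<psi> \<in> carr X; \<bar>t - t0\<bar> < d;
     X.gap \<psi> \<phi> < d\<rbrakk> \<Longrightarrow> X.gap (flow t \<psi>) (flow t0 \<phi>) < e" by blast
  show ?thesis
    by (rule exI[of _ "min 1 d"]) (use d n in auto)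
qed

theorem induced_flow_eq:
  assumes "t \<ge> 0" "\<phi> \<in> carr X"
  shows "induced_flow \<nu> p R r f t (vclass X \<phi>) = vclass X (flow t \<phi>)"
  using X.qlift_vclass[OF _ assms(2) X.C1_self_map_respects[OF flow_C1[OF assms(1)]]] flow_carr assms(1)
  by (auto simp: induced_flow_def X.qlift_def)

theorem induced_flow_C1_semiflow: "C1_semiflow (Mspace \<nu> p R) (induced_flow \<nu> p R r f)"
proof -
  have "C1_semiflow (quot_space X) (\<lambda>t. X.qlift (flow t))"
    by (rule X.C1_semiflow_quot) (use flow_C1 flow_zero flow_add flow_jointly_continuous in auto)
  then show ?thesis by (simp add: Mspace_def induced_flow_def[abs_def] X.qlift_def[abs_def])
qed

end

theorem theorem3p12:
  fixes \<nu> :: "real^'n \<Rightarrow> real"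
    and f :: "real^'n \<Rightarrow> real^'n"
    and R r \<alpha> p :: real
  assumes "is_norm \<nu>"
    and "R > 0" and "0 < r" and "r \<le> R"
    and "C1_vec f"
    and "\<alpha> \<ge> 1"
    and "\<exists>C>0. \<exists>K>0. \<forall>x. \<nu> x \<ge> K \<longrightarrow>
           matrix_opnorm \<nu> (jacobian f (at x)) \<le> C * \<nu> x powr \<alpha>"
    and "\<alpha> + 1 \<le> p"
  shows "(\<forall>\<phi>\<in>carr (Lbar \<nu> p R). \<exists>!x. is_solution R r f \<phi> x) \<and>
         (\<forall>t\<ge>0. \<forall>\<phi>\<in>carr (Lbar \<nu> p R).
            dde_flow R r f t \<phi> \<in> carr (Lbar \<nu> p R) \<and>
            induced_flow \<nu> p R r f t (vclass (Lbar \<nu> p R) \<phi>)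
              = vclass (Lbar \<nu> p R) (dde_flow R r f t \<phi>)) \<and>
         C1_semiflow (Mspace \<nu> p R) (induced_flow \<nu> p R r f)"
proof -
  interpret delay_equation \<nu> p R f \<alpha> r
    using assms by unfold_locales auto
  show ?thesis
    using ex1_solution flow_carr induced_flow_eq induced_flow_C1_semiflow by blast
qed

end
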